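(* Suppose that $f\in\mathbb{C}[x_1,\dots,x_n]$ is a central, not necessarily reduced, hyperplane arrangement of rank at most $2$ and let $F=(f_1,\dots,f_r)$ correspond to any factorization $f=f_1\cdots f_r$. Let $f'$ divide $f$ (with $f'$ and $f$ generating different ideals) and $g=\frac{f}{f'}$. Then $$\mathrm{V}(B_{f'F}^g)=\mathrm{V}\left(\prod_{\substack{X\in L(A)\\ X\text{ indecomposable}}}\ \prod_{j_X=0}^{d_{X,\mathrm{red}}+d_X-2r(X)-d'_X}\left(P_{f'F,X}^g+j_X\right)\right).$$ If $L=(l_1,\dots,l_d)$ is a factorization of $f=l_1\cdots l_d$ into irreducibles, then $B_{f'L}^g$ is the principal ideal of $\mathbb{C}[S]$ generated by $$\prod_{\substack{X\in L(A)\\ X\text{ indecomposable}}}\ \prod_{j_X=0}^{d_{X,\mathrm{red}}+d_X-2r(X)-d'_X}\left(P_{f'L,X}^g+j_X\right).$$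
   Context: A central, not necessarily reduced arrangement is a product $f=l_1\cdots l_d$ of homogeneous linear forms (repetitions allowed); its rank is the codimension of the intersection of all its hyperplanes. $L(A)$ is the set of all intersections of the hyperplanes $\mathrm{V}(l_i)$, including $\mathbb{C}^n$; its elements are edges; $r(X)$ is the codimension of $X$. $J(X)=\{j:X\subseteq\mathrm{V}(l_j)\}$, $f_X=\prod_{j\in J(X)}l_j$, $d_X=|J(X)|$, $d_{X,\mathrm{red}}$ is the number of distinct hyperplanes containing $X$. An edge $X\ne\mathbb{C}^n$ is decomposable if after a linear change of coordinates into disjoint sets of variables $y_1\sqcup y_2$, $f_X=pq$ with $p,q$ nonconstant arrangements using only variables of $y_1$, $y_2$ respectively; otherwise (and $X\neq\mathbb{C}^n$) it is indecomposable. For a factorization $f=f_1\cdots f_r$ (each $f_k$ a product of some of the $l_m$), $d_{X,k}$ is the number of linear factors of $f_k$ (with multiplicity) vanishing on $X$; $d'_X$ is the number of linear factors of $f'$ (with multiplicity) vanishing on $X$. For an indecomposable edge, $P_{f'F,X}^g=\sum_kd_{X,k}s_k+r(X)+d'_X\in\mathbb{C}[S]$, $S=s_1,\dots,s_r$. Empty products are $1$. $A_n(\mathbb{C})[S]$ (Weyl algebra with central variables $S$) acts on the free $\mathbb{C}[x][\frac1f][S]$-module on the symbol $F^S=f_1^{s_1}\cdots f_r^{s_r}$ by $\partial_i(hF^S)=(\partial_i\bullet h+h\sum_k\frac{\partial_i\bullet f_k}{f_k}s_k)F^S$. $B_{f'F}^g=\{B(S)\in\mathbb{C}[S]:B(S)f'F^S\in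 A_n(\mathbb{C})[S]gf'F^S\}$. $\mathrm{V}(-)$ is the zero locus in $\mathbb{C}^r$. *)

theory Defs
  imports
    "HOL-Analysis.Analysis"
    "HOL-Library.Poly_Mapping"
    "HOL-Computational_Algebra.Fraction_Field"
begin

section \<open>Multivariate polynomials\<close>

text \<open>
  Polynomials over \<open>'c\<close> in variables indexed by \<open>'v\<close> are finitely supported maps from exponent
  vectors to coefficients, with the convolution product of \<^theory>\<open>HOL-Library.Poly_Mapping\<close>.
  The ring is an integral domain (so that \<open>fract\<close> applies to it) when \<open>'v\<close> is linearly ordered.
\<close>

type_synonym ('v, 'c) mpoly = "('v \<Rightarrow>\<^sub>0 nat) \<Rightarrow>\<^sub>0 'c"

definition Const :: "'c::zero \<Rightarrow> ('v, 'c) mpoly" where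
  "Const c = Poly_Mapping.single 0 c"

definition Var :: "'v \<Rightarrow> ('v, 'c::zero_neq_one) mpoly" where
  "Var i = Poly_Mapping.single (Poly_Mapping.single i 1) 1"

definition poly_vars :: "('v, 'c::zero) mpoly \<Rightarrow> 'v set" where
  "poly_vars p = (\<Union>m\<in>Poly_Mapping.keys p. Poly_Mapping.keys m)"

text \<open>\<open>subst_poly h \<sigma>\<close> maps coefficients by \<open>h\<close> and replaces each variable \<open>i\<close> by \<open>\<sigma> i\<close>.\<close>

definition subst_poly ::
    "('c::comm_semiring_1 \<Rightarrow> 'a::comm_semiring_1) \<Rightarrow> ('v \<Rightarrow> 'a) \<Rightarrow> ('v, 'c) mpoly \<Rightarrow> 'a" where
  "subst_poly h \<sigma> p =
     (\<Sum>m\<in>Poly_Mapping.keys p.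
        h (Poly_Mapping.lookup p m) * (\<Prod>i\<in>Poly_Mapping.keys m. \<sigma> i ^ Poly_Mapping.lookup m i))"

definition zero_locus :: "('v::finite, complex) mpoly set \<Rightarrow> (complex ^ 'v) set" where
  "zero_locus I = {v. \<forall>p\<in>I. subst_poly (\<lambda>c. c) (($) v) p = 0}"

definition principal_ideal :: "('v, 'c::comm_ring_1) mpoly \<Rightarrow> ('v, 'c) mpoly set" where
  "principal_ideal p = {p * h | h. True}"

definition pderiv_poly :: "'v \<Rightarrow> ('v, 'c::comm_ring_1) mpoly \<Rightarrow> ('v, 'c) mpoly" where
  "pderiv_poly i p =
     (\<Sum>m\<in>Poly_Mapping.keys p.
        Poly_Mapping.single (m - Poly_Mapping.single i 1)
          (of_nat (Poly_Mapping.lookup m i) * Poly_Mapping.lookup p m))"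

lemma pderiv_poly_single:
  "pderiv_poly i (Poly_Mapping.single m c) =
     Poly_Mapping.single (m - Poly_Mapping.single i 1) (of_nat (Poly_Mapping.lookup m i) * c)"
  by (cases "c = 0") (simp_all add: pderiv_poly_def)

lemma pderiv_poly_add: "pderiv_poly i (p + q) = pderiv_poly i p + pderiv_poly i q"
  unfolding pderiv_poly_def
  by (rule setsum_keys_plus_distrib) (simp_all add: single_add[symmetric] distrib_left)

lemma pderiv_poly_sum: "pderiv_poly i (sum P A) = (\<Sum>a\<in>A. pderiv_poly i (P a))"
proof (induction A rule: infinite_finite_induct)
  case (insert x F)
  then show ?case by (simp add: pderiv_poly_add)
qed (simp_all add: pderiv_poly_def)

lemma poly_as_sum:
  fixes p :: "('v, 'c::comm_ring_1) mpoly"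
  shows "p = (\<Sum>m\<in>Poly_Mapping.keys p. Poly_Mapping.single m (Poly_Mapping.lookup p m))"
proof (rule poly_mapping_eqI)
  fix k
  show "Poly_Mapping.lookup p k =
    Poly_Mapping.lookup (\<Sum>m\<in>Poly_Mapping.keys p. Poly_Mapping.single m (Poly_Mapping.lookup p m)) k"
    by (auto simp: lookup_sum lookup_single when_def sum.delta in_keys_iff)
qed

lemma pderiv_poly_mult_single:
  fixes c d :: "'c::comm_ring_1"
  shows "pderiv_poly i (Poly_Mapping.single m c * Poly_Mapping.single k d) =
    pderiv_poly i (Poly_Mapping.single m c) * Poly_Mapping.single k d +
    Poly_Mapping.single m c * pderiv_poly i (Poly_Mapping.single k d)"
proof -
  let ?e = "Poly_Mapping.single i (1::nat)"
  have A: "Poly_Mapping.single (m + k - ?e) (of_nat (Poly_Mapping.lookup m i) * (c * d)) =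
        Poly_Mapping.single ((m - ?e) + k) (of_nat (Poly_Mapping.lookup m i) * (c * d))"
    for m k :: "'a \<Rightarrow>\<^sub>0 nat"
  proof (cases "Poly_Mapping.lookup m i = 0")
    case False
    then have "m + k - ?e = (m - ?e) + k"
      by (intro poly_mapping_eqI)
        (auto simp: lookup_add lookup_minus lookup_single when_def)
    then show ?thesis by simp
  qed simp
  show ?thesis
    using A[of m k] A[of k m]
    by (simp add: pderiv_poly_single mult_single lookup_add distrib_right distrib_left single_add
        add.commute mult.assoc mult.left_commute)
qed

lemma pderiv_poly_mult:
  fixes p q :: "('v, 'c::comm_ring_1) mpoly"
  shows "pderiv_poly i (p * q) = pderiv_poly i p * q + p * pderiv_poly i q"
proof -
  define P where "P = (\<lambda>m. Poly_Mapping.single m (Poly_Mapping.lookup p m))"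
  define Q where "Q = (\<lambda>m. Poly_Mapping.single m (Poly_Mapping.lookup q m))"
  define A where "A = Poly_Mapping.keys p"
  define B where "B = Poly_Mapping.keys q"
  have p: "p = sum P A" and q: "q = sum Q B"
    unfolding P_def Q_def A_def B_def by (rule poly_as_sum)+
  have *: "pderiv_poly i (P a * Q b) = pderiv_poly i (P a) * Q b + P a * pderiv_poly i (Q b)" for a b
    unfolding P_def Q_def by (rule pderiv_poly_mult_single)
  show ?thesis
    unfolding p q sum_product pderiv_poly_sum * sum.distrib ..
qed

text \<open>The partial derivatives on the field of rational functions, by the quotient rule.\<close>

lift_definition pderiv_fract ::
    "'v::linorder \<Rightarrow> ('v, complex) mpoly fract \<Rightarrow> ('v, complex) mpoly fract"
  is "\<lambda>i q. (pderiv_poly i (fst q) * snd q - fst q * pderiv_poly i (snd q), snd q * snd q)"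
proof -
  fix i :: 'v and q q' :: "('v, complex) mpoly \<times> ('v, complex) mpoly"
  assume "fractrel q q'"
  moreover obtain a b c d where q: "q = (a, b)" "q' = (c, d)" by fastforce
  ultimately have nz: "b \<noteq> 0" "d \<noteq> 0" and eq: "a * d = c * b" by auto
  have "pderiv_poly i a * d + a * pderiv_poly i d = pderiv_poly i c * b + c * pderiv_poly i b"
    using arg_cong[OF eq, of "pderiv_poly i"] by (simp add: pderiv_poly_mult)
  with eq have "(pderiv_poly i a * b - a * pderiv_poly i b) * (d * d) =
        (pderiv_poly i c * d - c * pderiv_poly i d) * (b * b)"
    by algebra
  with nz show "fractrel
      (pderiv_poly i (fst q) * snd q - fst q * pderiv_poly i (snd q), snd q * snd q)
      (pderiv_poly i (fst q') * snd q' - fst q' * pderiv_poly i (snd q'), snd q' * snd q')"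
    by (simp add: q)
qed


section \<open>Central arrangements and their edges\<close>

text \<open>Linear forms are nonzero, as they are to define hyperplanes.\<close>

definition linear_form :: "('n::finite, complex) mpoly \<Rightarrow> bool" where
  "linear_form p \<longleftrightarrow> p \<noteq> 0 \<and> (\<exists>a :: complex ^ 'n. p = (\<Sum>i\<in>UNIV. Const (a $ i) * Var i))"

definition arrangement :: "('n::finite, complex) mpoly \<Rightarrow> bool" where
  "arrangement p \<longleftrightarrow> (\<exists>ls. (\<forall>l\<in>set ls. linear_form l) \<and> p = prod_list ls)"

abbreviation (input) hyperplane :: "('n::finite, complex) mpoly \<Rightarrow> (complex ^ 'n) set" where
  "hyperplane l \<equiv> zero_locus {l}"

text \<open>An arrangement \<open>l\<^sub>1 \<cdots> l\<^sub>d\<close> is given by the family \<open>l\<close> of its factors.\<close>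

definition codim :: "(complex ^ 'n) set \<Rightarrow> nat" where
  "codim X = CARD('n) - vec.dim X"

definition arr_rank :: "('d::finite \<Rightarrow> ('n::finite, complex) mpoly) \<Rightarrow> nat" where
  "arr_rank l = codim (\<Inter>m. hyperplane (l m))"

definition edges :: "('d::finite \<Rightarrow> ('n::finite, complex) mpoly) \<Rightarrow> (complex ^ 'n) set set" where
  "edges l = {\<Inter>m\<in>I. hyperplane (l m) | I. True}"

lemma finite_edges: "finite (edges l)"
proof -
  have "edges l = (\<lambda>I. \<Inter>m\<in>I. hyperplane (l m)) ` UNIV"
    by (auto simp: edges_def)
  then show ?thesis by simp
qed

definition J_at :: "('d::finite \<Rightarrow> ('n::finite, complex) mpoly) \<Rightarrow> (complex ^ 'n) set \<Rightarrow> 'd set" where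
  "J_at l X = {m. X \<subseteq> hyperplane (l m)}"

definition d_at :: "('d::finite \<Rightarrow> ('n::finite, complex) mpoly) \<Rightarrow> (complex ^ 'n) set \<Rightarrow> nat" where
  "d_at l X = card (J_at l X)"

definition d_red_at :: "('d::finite \<Rightarrow> ('n::finite, complex) mpoly) \<Rightarrow> (complex ^ 'n) set \<Rightarrow> nat" where
  "d_red_at l X = card ((\<lambda>m. hyperplane (l m)) ` J_at l X)"

definition localized_arr ::
    "('d::finite \<Rightarrow> ('n::finite, complex) mpoly) \<Rightarrow> (complex ^ 'n) set \<Rightarrow> ('n, complex) mpoly" where
  "localized_arr l X = (\<Prod>m\<in>J_at l X. l m)"

definition linear_change ::
    "complex ^ 'n ^ 'n \<Rightarrow> ('n::finite, complex) mpoly \<Rightarrow> ('n, complex) mpoly" where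
  "linear_change A p = subst_poly Const (\<lambda>i. \<Sum>j\<in>UNIV. Const (A $ i $ j) * Var j) p"

text \<open>The set \<open>Y\<close> and its complement index the two disjoint sets of new coordinates.\<close>

definition decomposable ::
    "('d::finite \<Rightarrow> ('n::finite, complex) mpoly) \<Rightarrow> (complex ^ 'n) set \<Rightarrow> bool" where
  "decomposable l X \<longleftrightarrow>
     X \<in> edges l \<and> X \<noteq> UNIV \<and>
     (\<exists>(A :: complex ^ 'n ^ 'n) Y p q.
        invertible A \<and>
        arrangement p \<and> poly_vars p \<noteq> {} \<and> poly_vars p \<subseteq> Y \<and>
        arrangement q \<and> poly_vars q \<noteq> {} \<and> poly_vars q \<subseteq> - Y \<and>
        linear_change A (localized_arr l X) = p * q)"

definition indecomposable ::
    "('d::finite \<Rightarrow> ('n::finite, complex) mpoly) \<Rightarrow> (complex ^ 'n) set \<Rightarrow> bool" where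
  "indecomposable l X \<longleftrightarrow> X \<in> edges l \<and> X \<noteq> UNIV \<and> \<not> decomposable l X"

text \<open>
  The number of linear factors of \<open>p\<close>, with multiplicity, vanishing on \<open>X\<close>, for \<open>p\<close> a nonzero
  constant times a product of linear forms; it does not depend on the chosen factors because
  factorizations are unique up to constants.
\<close>

definition num_factors_at :: "('n::finite, complex) mpoly \<Rightarrow> (complex ^ 'n) set \<Rightarrow> nat" where
  "num_factors_at p X =
     (THE k. \<exists>c ls. c \<noteq> 0 \<and> (\<forall>l\<in>set ls. linear_form l) \<and> p = Const c * prod_list ls \<and>
             k = length (filter (\<lambda>l. X \<subseteq> hyperplane l) ls))"

text \<open>
  A factorization \<open>f = f\<^sub>1 \<cdots> f\<^sub>r\<close> of \<open>f = l\<^sub>1 \<cdots> l\<^sub>d\<close> distributes the factors \<open>l\<^sub>m\<close> among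
  the \<open>f\<^sub>k\<close>.
\<close>

definition factorization ::
    "('d::finite \<Rightarrow> ('n::finite, complex) mpoly) \<Rightarrow> ('r::finite \<Rightarrow> ('n, complex) mpoly) \<Rightarrow> bool" where
  "factorization l F \<longleftrightarrow> (\<exists>\<phi>. \<forall>k. F k = (\<Prod>m | \<phi> m = k. l m))"

lemma factorization_prod:
  assumes "factorization l F"
  shows "(\<Prod>k\<in>UNIV. F k) = (\<Prod>m\<in>UNIV. l m)"
proof -
  from assms obtain \<phi> where "\<And>k. F k = (\<Prod>m | \<phi> m = k. l m)"
    unfolding factorization_def by blast
  then show ?thesis
    using prod.group[of UNIV UNIV \<phi> l] by simp
qed

lemma factorization_self: "factorization l l"
  unfolding factorization_def by (rule exI[of _ id]) simp

definition P_at ::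
    "('n::finite, complex) mpoly \<Rightarrow> ('r::finite \<Rightarrow> ('n, complex) mpoly) \<Rightarrow> (complex ^ 'n) set
       \<Rightarrow> ('r, complex) mpoly" where
  "P_at f' F X =
     (\<Sum>k\<in>UNIV. of_nat (num_factors_at (F k) X) * Var k) + of_nat (codim X)
       + of_nat (num_factors_at f' X)"


section \<open>The Weyl algebra acting on \<open>F\<^sup>S\<close>, and Bernstein--Sato ideals\<close>

text \<open>
  An element \<open>h F\<^sup>S\<close> is represented by its coefficient \<open>h\<close>, a polynomial in \<open>S\<close> over the rational
  functions in \<open>x\<close>.  The module over \<open>\<complex>[x][1/f][S]\<close> consists of those \<open>h\<close> whose coefficients have
  a power of \<open>f = f\<^sub>1 \<cdots> f\<^sub>r\<close> as denominator (\<open>FS_module\<close>); the action below preserves it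
  (lemma \<open>weyl_action_FS_module\<close>).
\<close>

type_synonym ('n, 'r) FS = "('r, ('n, complex) mpoly fract) mpoly"

definition emb_x :: "('n::linorder, complex) mpoly \<Rightarrow> ('n, 'r) FS" where
  "emb_x p = Const (Fract p 1)"

definition emb_S :: "('r, complex) mpoly \<Rightarrow> ('n::linorder, 'r) FS" where
  "emb_S b = Poly_Mapping.map (\<lambda>c. Fract (Const c) 1) b"

definition partial_FS ::
    "('r::finite \<Rightarrow> ('n::linorder, complex) mpoly) \<Rightarrow> 'n \<Rightarrow> ('n, 'r) FS \<Rightarrow> ('n, 'r) FS" where
  "partial_FS F i h =
     Poly_Mapping.map (pderiv_fract i) h
       + h * (\<Sum>k\<in>UNIV. Const (Fract (pderiv_poly i (F k)) (F k)) * Var k)"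

text \<open>
  The operators by which the elements of \<open>A\<^sub>n(\<complex>)[S]\<close> act: the \<open>\<complex>\<close>-algebra of endomorphisms
  generated by the actions of the \<open>x\<^sub>i\<close>, \<open>\<partial>\<^sub>i\<close> and \<open>s\<^sub>k\<close>.
\<close>

inductive_set weyl_action ::
    "('r::finite \<Rightarrow> ('n::linorder, complex) mpoly) \<Rightarrow> (('n, 'r) FS \<Rightarrow> ('n, 'r) FS) set"
  for F where
    scalar: "(\<lambda>h. emb_x (Const c) * h) \<in> weyl_action F"
  | mult_x: "(\<lambda>h. emb_x (Var i) * h) \<in> weyl_action F"
  | mult_s: "(\<lambda>h. emb_S (Var k) * h) \<in> weyl_action F"
  | partial: "partial_FS F i \<in> weyl_action F"
  | add: "\<lbrakk>P \<in> weyl_action F; Q \<in> weyl_action F\<rbrakk> \<Longrightarrow> (\<lambda>h. P h + Q h) \<in> weyl_action F"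
  | comp: "\<lbrakk>P \<in> weyl_action F; Q \<in> weyl_action F\<rbrakk> \<Longrightarrow> (\<lambda>h. P (Q h)) \<in> weyl_action F"

definition localization :: "'a::idom \<Rightarrow> 'a fract set" where
  "localization f = {Fract p (f ^ k) | p k. True}"

definition FS_module :: "('r::finite \<Rightarrow> ('n::linorder, complex) mpoly) \<Rightarrow> ('n, 'r) FS set" where
  "FS_module F = {h. \<forall>m. Poly_Mapping.lookup h m \<in> localization (\<Prod>k\<in>UNIV. F k)}"

lemma localization_add:
  assumes "f \<noteq> 0" "a \<in> localization f" "b \<in> localization f"
  shows "a + b \<in> localization f"
proof -
  from assms obtain p j q k where "a = Fract p (f ^ j)" "b = Fract q (f ^ k)"
    by (auto simp: localization_def)
  with assms(1) have "a + b = Fract (p * f ^ k + q * f ^ j) (f ^ (j + k))"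
    by (simp add: power_add)
  then show ?thesis unfolding localization_def by blast
qed

lemma localization_mult:
  assumes "a \<in> localization f" "b \<in> localization f"
  shows "a * b \<in> localization f"
proof -
  from assms obtain p j q k where "a = Fract p (f ^ j)" "b = Fract q (f ^ k)"
    by (auto simp: localization_def)
  then have "a * b = Fract (p * q) (f ^ (j + k))"
    by (simp add: power_add)
  then show ?thesis unfolding localization_def by blast
qed

lemma localization_Fract_1: "Fract p 1 \<in> localization f"
proof -
  have "Fract p 1 = Fract p (f ^ 0)" by simp
  then show ?thesis unfolding localization_def by blast
qed

lemma localization_0: "0 \<in> localization f"
  using localization_Fract_1[of 0 f] by (simp add: Zero_fract_def)

lemma localization_1: "1 \<in> localization f"
  using localization_Fract_1[of 1 f] by (simp add: One_fract_def)

lemma localization_sum: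
  assumes "f \<noteq> 0" "\<And>x. x \<in> A \<Longrightarrow> h x \<in> localization f"
  shows "sum h A \<in> localization f"
  using assms(2)
proof (induction A rule: infinite_finite_induct)
  case (insert x A)
  then show ?case by (simp add: localization_add[OF assms(1)])
qed (simp_all add: localization_0)

lemma pderiv_fract_Fract:
  assumes "q \<noteq> 0"
  shows "pderiv_fract i (Fract p q) = Fract (pderiv_poly i p * q - p * pderiv_poly i q) (q * q)"
  using assms
  by (transfer fixing: i)
    (simp only: if_False fst_conv snd_conv fractrel_iff mult_eq_0_iff simp_thms)

lemma localization_pderiv:
  assumes "f \<noteq> 0" "a \<in> localization f"
  shows "pderiv_fract i a \<in> localization f"
proof -
  from assms obtain p k where "a = Fract p (f ^ k)"
    by (auto simp: localization_def)
  then have "pderiv_fract i a =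
      Fract (pderiv_poly i p * f ^ k - p * pderiv_poly i (f ^ k)) (f ^ (k + k))"
    using assms(1) by (simp add: pderiv_fract_Fract power_add)
  then show ?thesis unfolding localization_def by blast
qed

context
  fixes F :: "'r::finite \<Rightarrow> ('n::linorder, complex) mpoly"
  assumes nz: "\<And>k. F k \<noteq> 0"
begin

lemma prod_nz: "(\<Prod>k\<in>UNIV. F k) \<noteq> 0"
  using nz by simp

lemma FS_module_add: "h \<in> FS_module F \<Longrightarrow> h' \<in> FS_module F \<Longrightarrow> h + h' \<in> FS_module F"
  by (simp add: FS_module_def lookup_add localization_add[OF prod_nz])

lemma FS_module_sum: "(\<And>x. x \<in> A \<Longrightarrow> h x \<in> FS_module F) \<Longrightarrow> sum h A \<in> FS_module F"
  by (simp add: FS_module_def lookup_sum localization_sum[OF prod_nz])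

lemma FS_module_single:
  "c \<in> localization (\<Prod>k\<in>UNIV. F k) \<Longrightarrow> Poly_Mapping.single m c \<in> FS_module F"
  by (simp add: FS_module_def lookup_single when_def localization_0)

lemma FS_module_mult:
  assumes "h \<in> FS_module F" "h' \<in> FS_module F"
  shows "h * h' \<in> FS_module F"
proof -
  have "h * h' =
      (\<Sum>m\<in>Poly_Mapping.keys h. \<Sum>k\<in>Poly_Mapping.keys h'.
        Poly_Mapping.single (m + k) (Poly_Mapping.lookup h m * Poly_Mapping.lookup h' k))"
    by (subst poly_as_sum[of h], subst poly_as_sum[of h']) (simp add: sum_product mult_single)
  also have "\<dots> \<in> FS_module F"
    using assms
    by (intro FS_module_sum FS_module_single localization_mult) (simp_all add: FS_module_def)
  finally show ?thesis .
qed

lemma FS_module_emb_x: "emb_x p \<in> FS_module F"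
  by (simp add: emb_x_def Const_def FS_module_single localization_Fract_1)

lemma FS_module_Var: "Var k \<in> FS_module F"
  by (simp add: Var_def FS_module_single localization_1)

lemma FS_module_emb_S: "emb_S b \<in> FS_module F"
  by (auto simp: emb_S_def FS_module_def Poly_Mapping.map.rep_eq when_def
      localization_0 localization_Fract_1)

lemma FS_module_log_pderiv: "Const (Fract (pderiv_poly i (F k)) (F k)) \<in> FS_module F"
proof -
  define G where "G = (\<Prod>j\<in>UNIV - {k}. F j)"
  have prod: "(\<Prod>k\<in>UNIV. F k) = G * F k"
    unfolding G_def by (simp add: prod.remove[of UNIV k] mult.commute)
  have "G \<noteq> 0"
    using nz by (simp add: G_def)
  then have "Fract (pderiv_poly i (F k)) (F k) =
      Fract (G * pderiv_poly i (F k)) ((\<Prod>k\<in>UNIV. F k) ^ 1)"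
    using nz by (simp add: prod mult_fract_cancel)
  then have "Fract (pderiv_poly i (F k)) (F k) \<in> localization (\<Prod>k\<in>UNIV. F k)"
    unfolding localization_def by blast
  then show ?thesis by (simp add: Const_def FS_module_single)
qed

lemma FS_module_partial:
  assumes "h \<in> FS_module F"
  shows "partial_FS F i h \<in> FS_module F"
proof -
  have "Poly_Mapping.map (pderiv_fract i) h \<in> FS_module F"
    using assms
    by (auto simp: FS_module_def Poly_Mapping.map.rep_eq when_def localization_0
        localization_pderiv[OF prod_nz])
  then show ?thesis
    unfolding partial_FS_def using assms
    by (intro FS_module_add FS_module_mult FS_module_sum FS_module_log_pderiv FS_module_Var)
qed

lemma weyl_action_FS_module:
  assumes "P \<in> weyl_action F" "h \<in> FS_module F"
  shows "P h \<in> FS_module F"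
  using assms
  by (induction arbitrary: h)
    (simp_all add: FS_module_mult FS_module_emb_x FS_module_emb_S FS_module_partial FS_module_add)

end

definition BS_ideal ::
    "('n::linorder, complex) mpoly \<Rightarrow> ('n, complex) mpoly \<Rightarrow> ('r::finite \<Rightarrow> ('n, complex) mpoly)
       \<Rightarrow> ('r, complex) mpoly set" where
  "BS_ideal g f' F =
     {b. emb_S b * emb_x f' \<in> {P (emb_x (g * f')) | P. P \<in> weyl_action F}}"

end

theory Submission
  imports Defs
begin

text \<open>
  Let \<open>f\<close> have \<open>q\<close> distinct lines (in the two essential variables \<open>u, v\<close>) and let \<open>n = deg g\<close>.

  \<^emph>\<open>Membership.\<close>  Adjoin the factors of \<open>g\<close> to \<open>f'\<close> one at a time.  A derivation that is transversal to the new
  factor, tangent to a second line, and multiplied by the remaining lines lowers the exponent of the new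
  factor only, at the price of one hyperplane factor of the Bernstein--Sato polynomial.  By induction on \<open>n\<close>
  the product of all hyperplane factors maps \<open>p f' F\<^sup>S\<close> into \<open>D[S] f F\<^sup>S\<close> for every \<open>p\<close> of degree
  \<open>n + q - 3\<close> in \<open>u, v\<close>.  For \<open>h\<close> homogeneous of degree \<open>\<epsilon>\<close> one has \<open>(\<epsilon> + 2) h = \<partial>\<^sub>u (u h) + \<partial>\<^sub>v (v h)\<close>,
  and iterating this trades the \<open>n + q - 3\<close> degrees for the factors of the center.

  \<^emph>\<open>Necessity.\<close>  At a zero of a hyperplane factor, the order along the hyperplane gives a submodule that
  contains \<open>f F\<^sup>\<sigma>\<close> but not \<open>f' F\<^sup>\<sigma>\<close>.  At a zero \<open>\<sigma>\<close> of a factor of the center, where \<open>f' F\<^sup>\<sigma>\<close> has degree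
  \<open>-2 - j\<close>, specialize \<open>S\<close> to \<open>\<sigma> + t (1, \<dots>, 1)\<close> and integrate by parts: if \<open>b(\<sigma>) \<noteq> 0\<close>, then every polynomial
  of degree \<open>j\<close> in \<open>u, v\<close> is a multiple of \<open>g\<close> plus an element \<open>\<delta>(R) + a R\<close> with \<open>\<delta>\<close> the Hamiltonian
  derivation of the reduced equation.  This is impossible, because
  \<open>(j - n + 1) + (j + 3 - q) < j + 1\<close>.  The parameter \<open>t\<close> is needed since at \<open>\<sigma>\<close> itself \<open>f' F\<^sup>\<sigma>\<close> may lie in
  \<open>D f F\<^sup>\<sigma>\<close>.

  The zero locus thus determined, the ideal is principal for \<open>F = L\<close> because the affine factors are
  then pairwise distinct irreducible polynomials.
\<close>

section \<open>Polynomials as functions\<close>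

text \<open>The number n + q - 3 counts the factors of the center, whose index ends at q + d - 4 -
  d' = n + q - 4. It is both the degree at which the induction on n closes and the first value of j
  at which the dimension count is no contradiction; so the two directions meet.

  Necessity at the center is a residue argument. For p of degree j the 2-form p f' F^\<sigma> du dv
  has degree zero. Integration by parts makes it, up to a multiple of f F^\<sigma> of controlled
  degree, the differential of a 1-form of degree zero, and by Cartan's formula contraction with the
  Euler field leaves a single rational function with known twisted derivative. The obstacle is to
  show that this function is divisible by f' and once more by every line. That can fail only along a
  line where the homogeneous equation has a solution of too low an order; the term of order one in t
  excludes it. Nothing beyond order one in t is used.

  The operators are given by generators, so submodules are always described by closure under
  generators.\<close>

lemma Const_0 [simp]: "Const 0 = 0"
  by (simp add: Const_def)

lemma Const_1 [simp]: "Const 1 = 1"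
  by (simp add: Const_def)

lemma Const_add: "Const (a + b) = Const a + Const b"
  by (simp add: Const_def single_add)

lemma Const_mult: "Const (a * b) = Const a * (Const b :: ('v, 'c::comm_ring_1) mpoly)"
  by (simp add: Const_def mult_single)

lemma Const_uminus: "Const (- a) = - Const (a :: 'c::comm_ring_1)"
  by (simp add: Const_def single_uminus)

lemma Const_diff: "Const (a - b) = Const a - Const (b :: 'c::comm_ring_1)"
  by (simp add: Const_def single_diff)

lemma Const_sum: "Const (sum g A) = (\<Sum>a\<in>A. Const (g a))"
  by (induction A rule: infinite_finite_induct) (auto simp: Const_add)

lemma Const_of_nat: "Const (of_nat n) = (of_nat n :: ('v, 'c::comm_ring_1) mpoly)"
  by (simp add: Const_def single_of_nat)

lemma Const_eq_iff [simp]: "Const a = Const b \<longleftrightarrow> a = b"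
  unfolding Const_def by (metis lookup_single_eq)

lemma Const_eq_0_iff [simp]: "Const a = 0 \<longleftrightarrow> a = 0"
  using Const_eq_iff[of a 0] by (simp del: Const_eq_iff)

lemma Var_power: "Var i ^ n = Poly_Mapping.single (Poly_Mapping.single i n) (1 :: 'c::comm_ring_1)"
proof (induction n)
  case (Suc n)
  then show ?case
    by (simp add: Var_def mult_single single_add[symmetric])
qed simp

text \<open>Constants and variables generate the ring, so homomorphisms and derivations need to be
  compared only there. Monomials are built by adjoining the power of one variable at a time.\<close>

lemma mpoly_induct [case_names Const Var add mult]:
  fixes p :: "('v, 'c::comm_ring_1) mpoly"
  assumes C: "\<And>c. P (Const c)" and V: "\<And>i. P (Var i)"
    and A: "\<And>p q. P p \<Longrightarrow> P q \<Longrightarrow> P (p + q)" and M: "\<And>p q. P p \<Longrightarrow> P q \<Longrightarrow> P (p * q)"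
  shows "P p"
proof -
  have mono: "P (Poly_Mapping.single m 1)" for m :: "'v \<Rightarrow>\<^sub>0 nat"
  proof (induction m rule: update_induct)
    case const
    then show ?case using C[of 1] by (simp add: Const_def)
  next
    case (update m i n)
    have "P (Var i ^ k)" for k
      by (induction k) (use C[of 1] in \<open>auto intro: V M\<close>)
    then have "P (Poly_Mapping.single m 1 * Var i ^ n)"
      using update by (intro M)
    moreover have "Poly_Mapping.update i n m = m + Poly_Mapping.single i n"
      using update(1)
      by (intro poly_mapping_eqI)
        (auto simp: lookup_update lookup_add lookup_single when_def in_keys_iff)
    ultimately show ?case
      by (simp add: Var_power mult_single)
  qed
  have "P (Poly_Mapping.single m c)" for m :: "'v \<Rightarrow>\<^sub>0 nat" and c
    using M[OF C[of c] mono[of m]] by (simp add: Const_def mult_single)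
  moreover have "P 0"
    using C[of 0] by simp
  ultimately have "P (\<Sum>m\<in>A. Poly_Mapping.single m (Poly_Mapping.lookup p m))" for A
    by (induction A rule: infinite_finite_induct) (auto intro: A)
  then show ?thesis
    by (subst poly_as_sum)
qed

section \<open>Ring homomorphisms and substitution\<close>

text \<open>One predicate for evaluation, substitution, restriction to lines and coefficient
  embeddings, so that all of them share the rules \<open>is_homD\<close>.\<close>

definition is_hom :: "('a::comm_ring_1 \<Rightarrow> 'b::comm_ring_1) \<Rightarrow> bool" where
  "is_hom h \<longleftrightarrow> h 0 = 0 \<and> h 1 = 1 \<and> (\<forall>a b. h (a + b) = h a + h b) \<and> (\<forall>a b. h (a * b) = h a * h b)"

lemma is_homD:
  assumes "is_hom h"
  shows "h 0 = 0" "h 1 = 1" "h (a + b) = h a + h b" "h (a * b) = h a * h b"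
    "h (- a) = - h a" "h (a - b) = h a - h b" "h (a ^ n) = h a ^ n"
    "h (sum g A) = (\<Sum>x\<in>A. h (g x))" "h (prod g A) = (\<Prod>x\<in>A. h (g x))"
proof -
  show 1: "h 0 = 0" "h 1 = 1" and 2: "h (a + b) = h a + h b" "h (a * b) = h a * h b" for a b
    using assms by (auto simp: is_hom_def)
  have "h (- a) + h a = 0" for a
    by (simp only: 2[symmetric]) (simp add: 1)
  then show 3: "h (- a) = - h a" for a
    by (simp add: eq_neg_iff_add_eq_0)
  show "h (a - b) = h a - h b"
    using 2[of a "-b"] 3[of b] by simp
  show "h (a ^ n) = h a ^ n"
    by (induction n) (simp_all add: 1 2)
  show "h (sum g A) = (\<Sum>x\<in>A. h (g x))"
    by (induction A rule: infinite_finite_induct) (auto simp: 1 2)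
  show "h (prod g A) = (\<Prod>x\<in>A. h (g x))"
    by (induction A rule: infinite_finite_induct) (auto simp: 1 2)
qed

lemma is_hom_id: "is_hom (\<lambda>c. c)"
  by (simp add: is_hom_def)

lemma is_hom_Const: "is_hom Const"
  by (simp add: is_hom_def Const_add Const_mult)

lemma is_hom_pconst: "is_hom (\<lambda>c. [:c:])"
  by (simp add: is_hom_def)

lemma is_hom_comp: "is_hom g \<Longrightarrow> is_hom h \<Longrightarrow> is_hom (\<lambda>x. g (h x))"
  by (simp add: is_hom_def)

lemma subst_poly_single:
  assumes "is_hom h"
  shows "subst_poly h \<sigma> (Poly_Mapping.single m c) =
    h c * (\<Prod>i\<in>Poly_Mapping.keys m. \<sigma> i ^ Poly_Mapping.lookup m i)"
  using is_homD(1)[OF assms] by (cases "c = 0") (simp_all add: subst_poly_def)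

lemma subst_poly_add:
  assumes "is_hom h"
  shows "subst_poly h \<sigma> (p + q) = subst_poly h \<sigma> p + subst_poly h \<sigma> q"
  unfolding subst_poly_def
  by (rule setsum_keys_plus_distrib) (simp_all add: is_homD[OF assms] distrib_right)

lemma subst_poly_sum:
  assumes "is_hom h"
  shows "subst_poly h \<sigma> (sum g A) = (\<Sum>a\<in>A. subst_poly h \<sigma> (g a))"
  by (induction A rule: infinite_finite_induct) (simp_all add: subst_poly_add[OF assms], simp_all add: subst_poly_def)

lemma monom_value_add:
  fixes \<sigma> :: "'v \<Rightarrow> 'a::comm_ring_1"
  shows "(\<Prod>i\<in>Poly_Mapping.keys (m + k). \<sigma> i ^ Poly_Mapping.lookup (m + k) i) =
    (\<Prod>i\<in>Poly_Mapping.keys m. \<sigma> i ^ Poly_Mapping.lookup m i) *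
    (\<Prod>i\<in>Poly_Mapping.keys k. \<sigma> i ^ Poly_Mapping.lookup k i)"
proof -
  let ?A = "Poly_Mapping.keys m \<union> Poly_Mapping.keys k"
  have *: "(\<Prod>i\<in>Poly_Mapping.keys x. \<sigma> i ^ Poly_Mapping.lookup x i) = (\<Prod>i\<in>?A. \<sigma> i ^ Poly_Mapping.lookup x i)"
    if "Poly_Mapping.keys x \<subseteq> ?A" for x
    using that by (intro prod.mono_neutral_left) (auto simp: in_keys_iff)
  have "(\<Prod>i\<in>Poly_Mapping.keys (m + k). \<sigma> i ^ Poly_Mapping.lookup (m + k) i) =
      (\<Prod>i\<in>?A. \<sigma> i ^ Poly_Mapping.lookup (m + k) i)"
    by (rule *[OF keys_add])
  then show ?thesis
    by (simp add: *[of m] *[of k] lookup_add power_add prod.distrib)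
qed

lemma subst_poly_mult:
  assumes "is_hom h"
  shows "subst_poly h \<sigma> (p * q) = subst_poly h \<sigma> p * subst_poly h \<sigma> q"
proof -
  define P where "P = (\<lambda>m. Poly_Mapping.single m (Poly_Mapping.lookup p m))"
  define Q where "Q = (\<lambda>m. Poly_Mapping.single m (Poly_Mapping.lookup q m))"
  define A where "A = Poly_Mapping.keys p"
  define B where "B = Poly_Mapping.keys q"
  have p: "p = sum P A" and q: "q = sum Q B"
    unfolding P_def Q_def A_def B_def by (rule poly_as_sum)+
  have *: "subst_poly h \<sigma> (P a * Q b) = subst_poly h \<sigma> (P a) * subst_poly h \<sigma> (Q b)" for a b
    by (simp add: P_def Q_def mult_single subst_poly_single[OF assms] monom_value_add is_homD[OF assms])
  show ?thesis
    unfolding p q sum_product subst_poly_sum[OF assms] * ..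
qed

lemma subst_poly_Const [simp]: "is_hom h \<Longrightarrow> subst_poly h \<sigma> (Const c) = h c"
  by (simp add: Const_def subst_poly_single)

lemma subst_poly_Var [simp]: "is_hom h \<Longrightarrow> subst_poly h \<sigma> (Var i) = \<sigma> i"
  by (simp add: Var_def subst_poly_single is_homD)

lemma is_hom_subst: "is_hom h \<Longrightarrow> is_hom (subst_poly h \<sigma>)"
  using subst_poly_Const[of h \<sigma> 1]
  by (simp add: is_hom_def subst_poly_add subst_poly_mult del: subst_poly_Const)
     (simp add: subst_poly_def)

lemma hom_eqI:
  fixes g h :: "('v, 'c::comm_ring_1) mpoly \<Rightarrow> 'a::comm_ring_1"
  assumes "is_hom g" "is_hom h" "\<And>c. g (Const c) = h (Const c)" "\<And>i. g (Var i) = h (Var i)"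
  shows "g p = h p"
  by (induction p rule: mpoly_induct) (simp_all add: assms is_homD[OF assms(1)] is_homD[OF assms(2)])

section \<open>Derivatives, evaluation and restriction to lines\<close>

lemma pderiv_poly_Const [simp]: "pderiv_poly i (Const c) = 0"
  by (simp add: Const_def pderiv_poly_single)

lemma pderiv_poly_Var: "pderiv_poly i (Var j) = (if i = j then 1 else 0)"
  by (auto simp: Var_def pderiv_poly_single lookup_single when_def)

lemma pderiv_poly_0 [simp]: "pderiv_poly i 0 = 0"
  using pderiv_poly_Const[of i 0] by simp

lemma pderiv_poly_1 [simp]: "pderiv_poly i 1 = 0"
  using pderiv_poly_Const[of i 1] by simp

lemma pderiv_poly_commute: "pderiv_poly i (pderiv_poly j p) = pderiv_poly j (pderiv_poly i p)"
  by (induction p rule: mpoly_induct)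
    (simp_all add: pderiv_poly_add pderiv_poly_mult pderiv_poly_Var algebra_simps)

definition ev :: "complex ^ 'v \<Rightarrow> ('v::finite, complex) mpoly \<Rightarrow> complex" where
  "ev x = subst_poly (\<lambda>c. c) (($) x)"

lemma is_hom_ev: "is_hom (ev x)"
  unfolding ev_def by (intro is_hom_subst is_hom_id)

lemmas ev_simps = is_homD[OF is_hom_ev]

lemma ev_Const [simp]: "ev x (Const c) = c"
  by (simp add: ev_def is_hom_id)

lemma ev_Var [simp]: "ev x (Var i) = x $ i"
  by (simp add: ev_def is_hom_id)

lemma zero_locus_ev: "zero_locus I = {v. \<forall>p\<in>I. ev v p = 0}"
  by (simp add: zero_locus_def ev_def)

text \<open>Differentiation along a constant vector field; directions adapted to the hyperplanes
  replace the coordinate directions throughout.\<close>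

definition dpoly :: "complex ^ 'v \<Rightarrow> ('v::finite, complex) mpoly \<Rightarrow> ('v, complex) mpoly" where
  "dpoly w p = (\<Sum>i\<in>UNIV. Const (w $ i) * pderiv_poly i p)"

lemma dpoly_add: "dpoly w (p + q) = dpoly w p + dpoly w q"
  by (simp add: dpoly_def pderiv_poly_add distrib_left sum.distrib)

lemma dpoly_mult: "dpoly w (p * q) = dpoly w p * q + p * dpoly w q"
  by (simp add: dpoly_def pderiv_poly_mult distrib_left sum.distrib sum_distrib_left
      sum_distrib_right mult_ac)

lemma dpoly_Const [simp]: "dpoly w (Const c) = 0"
  by (simp add: dpoly_def)

lemma dpoly_0 [simp]: "dpoly w 0 = 0" and dpoly_1 [simp]: "dpoly w 1 = 0"
  using dpoly_Const[of w 0] dpoly_Const[of w 1] by simp_all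

lemma dpoly_Var: "dpoly w (Var i) = Const (w $ i)"
proof -
  have "dpoly w (Var i) = (\<Sum>j\<in>UNIV. if j = i then Const (w $ j) else 0)"
    unfolding dpoly_def by (intro sum.cong) (simp_all add: pderiv_poly_Var)
  then show ?thesis by simp
qed

lemma dpoly_axis: "dpoly (axis i 1) p = pderiv_poly i p"
proof -
  have "dpoly (axis i 1) p = (\<Sum>j\<in>UNIV. if j = i then pderiv_poly j p else 0)"
    unfolding dpoly_def by (intro sum.cong) (simp_all add: axis_def)
  then show ?thesis by simp
qed

text \<open>Restriction to the affine line \<open>a + t w\<close> as a polynomial in
  \<open>t\<close>. It reduces questions to one variable and later dehomogenizes forms in two
  variables.\<close>

definition on_line :: "complex ^ 'v \<Rightarrow> complex ^ 'v \<Rightarrow> ('v::finite, complex) mpoly \<Rightarrow> complex poly" where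
  "on_line a w = subst_poly (\<lambda>c. [:c:]) (\<lambda>i. [:a $ i, w $ i:])"

lemma is_hom_on_line: "is_hom (on_line a w)"
  unfolding on_line_def by (intro is_hom_subst is_hom_pconst)

lemmas on_line_simps = is_homD[OF is_hom_on_line]

lemma on_line_Const [simp]: "on_line a w (Const c) = [:c:]"
  by (simp add: on_line_def is_hom_pconst)

lemma on_line_Var [simp]: "on_line a w (Var i) = [:a $ i, w $ i:]"
  by (simp add: on_line_def is_hom_pconst)

lemma poly_on_line: "poly (on_line a w p) t = ev (a + t *s w) p"
proof (rule hom_eqI[OF _ is_hom_ev])
  show "is_hom (\<lambda>p. poly (on_line a w p) t)"
    by (simp add: is_hom_def on_line_simps)
qed auto

lemma pderiv_on_line: "pderiv (on_line a w p) = on_line a w (dpoly w p)"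
  by (induction p rule: mpoly_induct)
    (simp_all add: on_line_simps dpoly_add dpoly_mult pderiv_add pderiv_mult dpoly_Var pderiv_pCons
      mult_ac add_ac)

lemma lookup_pderiv_poly:
  fixes p :: "('v, 'c::comm_ring_1) mpoly"
  shows "Poly_Mapping.lookup (pderiv_poly i p) m =
    of_nat (Suc (Poly_Mapping.lookup m i)) * Poly_Mapping.lookup p (m + Poly_Mapping.single i 1)"
proof -
  have *: "Poly_Mapping.lookup (pderiv_poly i (Poly_Mapping.single k c)) m =
      of_nat (Suc (Poly_Mapping.lookup m i)) *
      Poly_Mapping.lookup (Poly_Mapping.single k c) (m + Poly_Mapping.single i 1)" for k :: "'v \<Rightarrow>\<^sub>0 nat" and c :: 'c
  proof (cases "Poly_Mapping.lookup k i = 0")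
    case True
    then have "k \<noteq> m + Poly_Mapping.single i 1"
      by (auto simp: lookup_add)
    with True show ?thesis
      by (simp add: pderiv_poly_single lookup_single when_def)
  next
    case False
    then have "k - Poly_Mapping.single i 1 = m \<longleftrightarrow> k = m + Poly_Mapping.single i 1"
      by (auto simp: poly_mapping_eq_iff fun_eq_iff lookup_add lookup_minus lookup_single when_def)
    then show ?thesis
      by (auto simp: pderiv_poly_single lookup_single when_def lookup_add)
  qed
  show ?thesis
    by (subst (1 2) poly_as_sum[of p])
      (simp only: pderiv_poly_sum lookup_sum * sum_distrib_left)
qed

lemma ev_zero: "ev 0 p = Poly_Mapping.lookup p 0"
proof -
  have *: "ev 0 (Poly_Mapping.single m c) = Poly_Mapping.lookup (Poly_Mapping.single m c) 0"
    for m :: "'a \<Rightarrow>\<^sub>0 nat" and c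
  proof (cases "m = 0")
    case False
    then obtain i where "i \<in> Poly_Mapping.keys m"
      by (metis ex_in_conv keys_eq_empty)
    then have "(\<Prod>i\<in>Poly_Mapping.keys m. (0 :: complex ^ 'a) $ i ^ Poly_Mapping.lookup m i) = 0"
      by (intro prod_zero) (auto simp: in_keys_iff)
    with False show ?thesis
      by (simp add: ev_def subst_poly_single[OF is_hom_id] lookup_single)
  qed (simp add: ev_def subst_poly_single[OF is_hom_id])
  show ?thesis
    by (subst (1 2) poly_as_sum[of p]) (simp only: ev_simps lookup_sum *)
qed

lemma ev_pderiv_poly: "ev x (dpoly w p) = poly (pderiv (on_line x w p)) 0"
  using poly_on_line[of x w "dpoly w p" 0] by (simp add: pderiv_on_line)

text \<open>Vanishing passes to the partial derivatives, and the iterated derivatives at the origin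
  recover the coefficients.\<close>

lemma mpoly_eq_0I:
  fixes p :: "('v::finite, complex) mpoly"
  assumes "\<And>x. ev x p = 0"
  shows "p = 0"
proof -
  have "Poly_Mapping.lookup p m = 0" if "\<And>x. ev x p = 0" for m and p :: "('v, complex) mpoly"
    using that
  proof (induction "\<Sum>i\<in>UNIV. Poly_Mapping.lookup m i" arbitrary: m p)
    case 0
    then have "m = 0"
      by (intro poly_mapping_eqI) simp
    with 0 show ?case
      using ev_zero[of p] by simp
  next
    case (Suc n)
    then obtain i where i: "Poly_Mapping.lookup m i \<noteq> 0"
      by (metis Zero_not_Suc sum.neutral)
    define m' where "m' = m - Poly_Mapping.single i 1"
    have m: "m = m' + Poly_Mapping.single i 1"
      using i unfolding m'_def
      by (intro poly_mapping_eqI) (auto simp: lookup_add lookup_minus lookup_single when_def)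
    have "(\<Sum>j\<in>UNIV. Poly_Mapping.lookup (Poly_Mapping.single i (1::nat)) j) = 1"
      by (simp add: lookup_single when_def)
    then have n: "n = (\<Sum>j\<in>UNIV. Poly_Mapping.lookup m' j)"
      using Suc(2) by (simp add: m lookup_add sum.distrib)
    have "on_line x w p = 0" for x w
      using Suc(3) by (simp add: poly_on_line flip: poly_all_0_iff_0)
    then have "ev x (dpoly (axis i 1) p) = 0" for x
      by (simp add: ev_pderiv_poly)
    then have "ev x (pderiv_poly i p) = 0" for x
      by (simp add: dpoly_axis)
    then have "Poly_Mapping.lookup (pderiv_poly i p) m' = 0"
      by (rule Suc(1)[OF n])
    then show ?case
      by (simp only: lookup_pderiv_poly mult_eq_0_iff m[symmetric] of_nat_eq_0_iff) simp
  qed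
  with assms show ?thesis
    by (intro poly_mapping_eqI) simp
qed

lemma mpoly_eqI:
  fixes p q :: "('v::finite, complex) mpoly"
  assumes "\<And>x. ev x p = ev x q"
  shows "p = q"
  using mpoly_eq_0I[of "p - q"] assms by (simp add: ev_simps)

text \<open>Complex affine subspaces are irreducible: finitely many polynomials that are each nonzero
  somewhere on one have a common point of nonvanishing on the line through two such points.\<close>

lemma common_nonzero:
  fixes C :: "(complex ^ 'v::finite) set"
  assumes "finite A" "C \<noteq> {}"
    and C: "\<And>x y t. x \<in> C \<Longrightarrow> y \<in> C \<Longrightarrow> x + t *s (y - x) \<in> C"
    and nz: "\<And>a. a \<in> A \<Longrightarrow> \<exists>x\<in>C. ev x (p a) \<noteq> 0"
  shows "\<exists>x\<in>C. \<forall>a\<in>A. ev x (p a) \<noteq> 0"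
  using assms(1) nz
proof (induction A rule: finite_induct)
  case empty
  then show ?case using assms(2) by auto
next
  case (insert b A)
  then obtain x where x: "x \<in> C" "\<forall>a\<in>A. ev x (p a) \<noteq> 0" by auto
  from insert obtain y where y: "y \<in> C" "ev y (p b) \<noteq> 0" by auto
  define L where "L = (\<lambda>a. on_line x (y - x) (p a))"
  have "L a \<noteq> 0" if "a \<in> A" for a
    using x(2) that poly_on_line[of x "y - x" "p a" 0] by (auto simp: L_def)
  moreover have "L b \<noteq> 0"
    using y(2) poly_on_line[of x "y - x" "p b" 1] by (auto simp: L_def)
  ultimately have "finite (\<Union>a\<in>insert b A. {t. poly (L a) t = 0})"
    using insert(1) by (auto intro: poly_roots_finite)
  then obtain t where "t \<notin> (\<Union>a\<in>insert b A. {t. poly (L a) t = 0})"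
    using infinite_UNIV_char_0[where 'a = complex] ex_new_if_finite by blast
  then show ?case
    using C[OF x(1) y(1), of t] by (auto simp: L_def poly_on_line)
qed

section \<open>Linear forms and affine functions\<close>

text \<open>The complex bilinear pairing of coefficients with points. The inner product of
  \<open>complex ^ 'v\<close> is real-valued and cannot express linear forms.\<close>

definition bil :: "complex ^ 'v \<Rightarrow> complex ^ 'v \<Rightarrow> complex" where
  "bil a x = (\<Sum>i\<in>(UNIV::'v::finite set). a $ i * x $ i)"

definition lf :: "complex ^ 'v \<Rightarrow> ('v::finite, complex) mpoly" where
  "lf a = (\<Sum>i\<in>UNIV. Const (a $ i) * Var i)"

lemma bil_simps [simp]:
  "bil a 0 = 0" "bil 0 x = 0" "bil a (x + y) = bil a x + bil a y" "bil (a + b) x = bil a x + bil b x"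
  "bil a (x - y) = bil a x - bil a y" "bil (a - b) x = bil a x - bil b x"
  "bil a (t *s x) = t * bil a x" "bil (t *s a) x = t * bil a x" "bil (- a) x = - bil a x" "bil a (- x) = - bil a x"
  by (simp_all add: bil_def algebra_simps sum.distrib sum_subtractf sum_distrib_left sum_negf)

lemma bil_axis [simp]: "bil a (axis i 1) = a $ i" "bil (axis i 1) a = a $ i"
proof -
  have "bil a (axis i 1) = (\<Sum>j\<in>UNIV. if j = i then a $ j else 0)"
    unfolding bil_def by (intro sum.cong) (simp_all add: axis_def)
  then show "bil a (axis i 1) = a $ i" by simp
  have "bil (axis i 1) a = (\<Sum>j\<in>UNIV. if j = i then a $ j else 0)"
    unfolding bil_def by (intro sum.cong) (simp_all add: axis_def)
  then show "bil (axis i 1) a = a $ i" by simp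
qed

lemma ev_lf [simp]: "ev x (lf a) = bil a x"
  by (simp add: lf_def bil_def ev_simps)

lemma lf_0 [simp]: "lf 0 = 0" and lf_add: "lf (a + b) = lf a + lf b"
  and lf_scale: "lf (t *s a) = Const t * lf a" and lf_minus: "lf (a - b) = lf a - lf b"
  by (simp_all add: lf_def Const_add Const_diff Const_mult algebra_simps sum.distrib sum_subtractf sum_distrib_left)

lemma lf_eq_iff [simp]: "lf a = lf b \<longleftrightarrow> a = b"
proof
  assume "lf a = lf b"
  then have "bil a x = bil b x" for x
    by (metis ev_lf)
  from this[of "axis _ 1"] show "a = b"
    by (simp add: vec_eq_iff)
qed simp

lemma lf_eq_0_iff [simp]: "lf a = 0 \<longleftrightarrow> a = 0"
  using lf_eq_iff[of a 0] by (simp del: lf_eq_iff)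

lemma lf_axis: "lf (axis i 1) = Var i"
  by (rule mpoly_eqI) simp

lemma dpoly_lf [simp]: "dpoly w (lf a) = Const (bil a w)"
proof -
  have "dpoly w (sum g A) = (\<Sum>x\<in>A. dpoly w (g x))" for g :: "'a \<Rightarrow> _" and A
    by (induction A rule: infinite_finite_induct) (simp_all add: dpoly_add)
  then show ?thesis
    by (simp add: lf_def dpoly_mult dpoly_Var bil_def Const_sum Const_mult)
qed

lemma on_line_lf [simp]: "on_line x w (lf a) = [:bil a x, bil a w:]"
proof -
  have *: "on_line x w (lf a) = (\<Sum>i\<in>UNIV. [:a $ i * x $ i, a $ i * w $ i:])"
    by (simp add: lf_def on_line_simps mult.commute)
  have "(\<Sum>i\<in>A. [:a $ i * x $ i, a $ i * w $ i:]) =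
      [:\<Sum>i\<in>A. a $ i * x $ i, \<Sum>i\<in>A. a $ i * w $ i:]" for A
    by (induction A rule: infinite_finite_induct) auto
  then show ?thesis
    unfolding * bil_def .
qed

lemma linear_form_iff: "linear_form p \<longleftrightarrow> (\<exists>a. a \<noteq> 0 \<and> p = lf a)"
  unfolding linear_form_def lf_def[symmetric] by auto

lemma hyperplane_lf: "zero_locus {lf a} = {x. bil a x = 0}"
  by (simp add: zero_locus_ev)

text \<open>A polynomial is congruent, modulo an affine function \<open>\<lambda>\<close> with \<open>a\<^sub>i \<noteq> 0\<close>, to its pullback
  under the projection along the \<open>i\<close>-th axis onto the zero locus of \<open>\<lambda>\<close>.\<close>

lemma affine_dvd_iff:
  fixes p :: "('v::finite, complex) mpoly"
  assumes "a \<noteq> 0"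
  shows "lf a + Const c dvd p \<longleftrightarrow> (\<forall>x. bil a x + c = 0 \<longrightarrow> ev x p = 0)"
proof
  assume "lf a + Const c dvd p"
  then show "\<forall>x. bil a x + c = 0 \<longrightarrow> ev x p = 0"
    by (auto simp: dvd_def ev_simps)
next
  assume van: "\<forall>x. bil a x + c = 0 \<longrightarrow> ev x p = 0"
  from assms obtain i where i: "a $ i \<noteq> 0"
    by (auto simp: vec_eq_iff)
  define L where "L = lf a + Const c"
  define \<tau> where "\<tau> = (\<lambda>j. if j = i then Var i - Const (1 / a $ i) * L else Var j)"
  have hom: "is_hom (subst_poly Const \<tau>)"
    by (intro is_hom_subst is_hom_Const)
  have cong: "L dvd r - subst_poly Const \<tau> r" for r
  proof (induction r rule: mpoly_induct)
    case (Const c)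
    then show ?case by (simp add: is_hom_Const)
  next
    case (Var j)
    then show ?case by (auto simp: \<tau>_def is_hom_Const)
  next
    case (add p q)
    then have "L dvd (p - subst_poly Const \<tau> p) + (q - subst_poly Const \<tau> q)"
      by (rule dvd_add)
    then show ?case by (simp add: is_homD[OF hom] algebra_simps)
  next
    case (mult p q)
    then have "L dvd (p - subst_poly Const \<tau> p) * q + subst_poly Const \<tau> p * (q - subst_poly Const \<tau> q)"
      by (intro dvd_add dvd_mult dvd_mult2)
    then show ?case by (simp add: is_homD[OF hom] algebra_simps)
  qed
  have "ev x (subst_poly Const \<tau> p) = 0" for x
  proof -
    define y where "y = x - ((bil a x + c) / a $ i) *s axis i 1"
    have "ev x (subst_poly Const \<tau> r) = ev y r" for r
      by (rule hom_eqI[OF is_hom_comp[OF is_hom_ev hom] is_hom_ev])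
        (auto simp: ev_simps is_hom_Const \<tau>_def L_def y_def axis_def)
    moreover have "bil a y + c = 0"
      using i by (simp add: y_def)
    ultimately show ?thesis
      using van by simp
  qed
  then have "subst_poly Const \<tau> p = 0"
    by (rule mpoly_eq_0I)
  with cong[of p] show "lf a + Const c dvd p"
    by (simp add: L_def)
qed

lemma lf_dvd_iff: "a \<noteq> 0 \<Longrightarrow> lf a dvd p \<longleftrightarrow> (\<forall>x. bil a x = 0 \<longrightarrow> ev x p = 0)"
  using affine_dvd_iff[of a 0 p] by simp

text \<open>A hyperplane is irreducible: if neither factor vanished identically on it, both would be
  nonzero at a common point, by \<open>common_nonzero\<close>.\<close>

lemma lf_prime:
  fixes p q :: "('v::finite, complex) mpoly"
  assumes "a \<noteq> 0" "lf a dvd p * q"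
  shows "lf a dvd p \<or> lf a dvd q"
proof (rule ccontr)
  let ?C = "{x. bil a x = 0}"
  assume "\<not> ?thesis"
  then have "\<exists>x\<in>?C. ev x (if b then p else q) \<noteq> 0" for b
    using assms(1) by (auto simp: lf_dvd_iff)
  moreover have "\<exists>x. bil a x = 0"
    by (rule exI[of _ 0]) simp
  ultimately obtain x where x: "x \<in> ?C" "\<forall>b\<in>UNIV. ev x (if b then p else q) \<noteq> 0"
    using common_nonzero[of "UNIV :: bool set" ?C "\<lambda>b. if b then p else q"] by auto
  then have "ev x p \<noteq> 0" "ev x q \<noteq> 0"
    by (metis UNIV_I)+
  moreover have "ev x (p * q) = 0"
    using x assms by (simp add: lf_dvd_iff)
  ultimately show False
    by (simp add: ev_simps)
qed

lemma lf_dvd_lf_iff: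
  assumes "a \<noteq> 0"
  shows "lf a dvd lf b \<longleftrightarrow> (\<exists>t. b = t *s a)"
proof
  assume "lf a dvd lf b"
  then have *: "bil b x = 0" if "bil a x = 0" for x
    using that assms by (simp add: lf_dvd_iff)
  from assms obtain i where i: "a $ i \<noteq> 0"
    by (auto simp: vec_eq_iff)
  \<comment> \<open>The test vector, a combination of the axes \<open>i\<close> and
    \<open>j\<close>, is chosen in the kernel of \<open>a\<close>.\<close>
  have "b $ j = (b $ i / a $ i) * a $ j" for j
    using *[of "axis j 1 - (a $ j / a $ i) *s axis i 1"] i by simp
  then have "b = (b $ i / a $ i) *s a"
    unfolding vec_eq_iff vector_smult_component by blast
  then show "\<exists>t. b = t *s a" ..
qed (auto simp: lf_scale)

lemma lf_dvd_prod:
  assumes "a \<noteq> 0" "finite A" "lf a dvd (\<Prod>x\<in>A. p x)"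
  shows "\<exists>x\<in>A. lf a dvd p x"
  using assms(2,3)
proof (induction A rule: finite_induct)
  case empty
  then show ?case
    using lf_dvd_iff[OF assms(1), of 1] by (auto simp: ev_simps) (metis bil_simps(1))
next
  case (insert x A)
  then show ?case
    using lf_prime[OF assms(1), of "p x" "\<Prod>x\<in>A. p x"] by auto
qed

lemma lf_dvd_power: "a \<noteq> 0 \<Longrightarrow> lf a dvd p ^ n \<Longrightarrow> lf a dvd p"
  using lf_dvd_prod[of a "{..<n}" "\<lambda>_. p"] by auto

text \<open>On every line through the origin a unit restricts to a unit in one variable, hence to a
  constant, so it has everywhere the value it has at the origin.\<close>

lemma mpoly_unit:
  fixes p q :: "('v::finite, complex) mpoly"
  assumes "p * q = 1"
  shows "\<exists>c. c \<noteq> 0 \<and> p = Const c"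
proof -
  have "ev x p = ev 0 p" for x
  proof -
    have "on_line 0 x p * on_line 0 x q = 1"
      using assms by (simp add: on_line_simps(4)[symmetric] on_line_simps)
    then have "is_unit (on_line 0 x p)"
      by (metis dvd_triv_left)
    then obtain c where "on_line 0 x p = [:c:]"
      by (auto simp: is_unit_poly_iff)
    with poly_on_line[of 0 x p 0] poly_on_line[of 0 x p 1] show ?thesis
      by simp
  qed
  then have "p = Const (ev 0 p)"
    by (intro mpoly_eqI) simp
  moreover have "ev 0 p \<noteq> 0"
    using arg_cong[OF assms, of "ev 0"] by (auto simp: ev_simps)
  ultimately show ?thesis by blast
qed

lemma lf_not_Const: "a \<noteq> 0 \<Longrightarrow> \<not> lf a dvd Const c \<longleftrightarrow> c \<noteq> 0"
  by (auto simp: lf_dvd_iff) (metis bil_simps(1))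

section \<open>Derivations of rational functions\<close>

definition kp :: "('n::linorder, complex) mpoly \<Rightarrow> ('n, complex) mpoly fract" where
  "kp p = Fract p 1"

definition kc :: "complex \<Rightarrow> ('n::linorder, complex) mpoly fract" where
  "kc c = kp (Const c)"

lemma is_hom_kp: "is_hom kp"
  by (simp add: is_hom_def kp_def Zero_fract_def One_fract_def)

lemma is_hom_kc: "is_hom kc"
  using is_hom_comp[OF is_hom_kp is_hom_Const] by (simp add: kc_def[abs_def])

lemmas kp_simps = is_homD[OF is_hom_kp]
lemmas kc_simps = is_homD[OF is_hom_kc]

lemma kp_eq_iff [simp]: "kp p = kp q \<longleftrightarrow> p = q"
  by (simp add: kp_def eq_fract)

lemma kp_eq_0_iff [simp]: "kp p = 0 \<longleftrightarrow> p = 0"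
  using kp_eq_iff[of p 0] by (simp add: kp_simps del: kp_eq_iff)

lemma kc_eq_iff [simp]: "kc a = kc b \<longleftrightarrow> a = b"
  by (simp add: kc_def)

lemma kc_eq_0_iff [simp]: "kc a = 0 \<longleftrightarrow> a = 0"
  by (simp add: kc_def)

lemma Fract_kp: "Fract p q = kp p / kp q"
  by (simp add: kp_def)

lemma fract_cases_kp: obtains p q where "q \<noteq> 0" "x = kp p / kp q"
  by (cases x rule: Fract_cases) (use Fract_kp in blast)

lemma pderiv_fract_kp [simp]: "pderiv_fract i (kp p) = kp (pderiv_poly i p)"
  by (simp add: kp_def pderiv_fract_Fract)

lemma pderiv_fract_add: "pderiv_fract i (x + y) = pderiv_fract i x + pderiv_fract i y"
proof -
  obtain a b where x: "b \<noteq> 0" "x = Fract a b" by (cases x rule: Fract_cases) auto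
  obtain c d where y: "d \<noteq> 0" "y = Fract c d" by (cases y rule: Fract_cases) auto
  show ?thesis
    using x(1) y(1)
    by (simp add: x(2) y(2) pderiv_fract_Fract eq_fract pderiv_poly_add pderiv_poly_mult algebra_simps)
qed

lemma pderiv_fract_mult: "pderiv_fract i (x * y) = pderiv_fract i x * y + x * pderiv_fract i y"
proof -
  obtain a b where x: "b \<noteq> 0" "x = Fract a b" by (cases x rule: Fract_cases) auto
  obtain c d where y: "d \<noteq> 0" "y = Fract c d" by (cases y rule: Fract_cases) auto
  show ?thesis
    using x(1) y(1)
    by (simp add: x(2) y(2) pderiv_fract_Fract eq_fract pderiv_poly_mult algebra_simps)
qed

definition dK :: "complex ^ 'n::{finite,linorder} \<Rightarrow> ('n::{finite,linorder}, complex) mpoly fract \<Rightarrow> ('n, complex) mpoly fract" where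
  "dK w x = (\<Sum>i\<in>UNIV. kc (w $ i) * pderiv_fract i x)"

lemma dK_add: "dK w (x + y) = dK w x + dK w y"
  by (simp add: dK_def pderiv_fract_add distrib_left sum.distrib)

lemma dK_mult: "dK w (x * y) = dK w x * y + x * dK w y"
  by (simp add: dK_def pderiv_fract_mult distrib_left sum.distrib sum_distrib_left
      sum_distrib_right mult_ac)

lemma dK_kp [simp]: "dK w (kp p) = kp (dpoly w p)"
  by (simp add: dK_def dpoly_def kp_simps kc_def)

lemma dK_kc [simp]: "dK w (kc c) = 0"
  by (simp add: kc_def kp_simps)

lemma dK_0 [simp]: "dK w 0 = 0" and dK_1 [simp]: "dK w 1 = 0"
  using dK_kc[of w 0] dK_kc[of w 1] by (simp_all only: kc_simps)

lemma dK_sum: "dK w (sum g A) = (\<Sum>a\<in>A. dK w (g a))"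
  by (induction A rule: infinite_finite_induct) (simp_all add: dK_add)

lemma dK_minus: "dK w (- x) = - dK w x"
  using dK_add[of w x "- x"] by (simp add: eq_neg_iff_add_eq_0 add.commute)

lemma dK_diff: "dK w (x - y) = dK w x - dK w y"
  using dK_add[of w x "- y"] by (simp add: dK_minus)

lemma dK_inverse: "dK w (inverse x) = - dK w x * inverse x * inverse x"
proof (cases "x = 0")
  case False
  then have "0 = dK w (x * inverse x)" by simp
  also have "\<dots> = dK w x * inverse x + x * dK w (inverse x)"
    by (rule dK_mult)
  finally have "x * dK w (inverse x) = - dK w x * inverse x"
    by (simp add: eq_neg_iff_add_eq_0 add.commute)
  moreover have "dK w (inverse x) = inverse x * (x * dK w (inverse x))"
    using False by (simp flip: mult.assoc)
  ultimately show ?thesis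
    by (simp add: mult_ac)
qed simp

lemma dK_axis: "dK (axis i 1) x = pderiv_fract i x"
proof -
  have "dK (axis i 1) x = (\<Sum>j\<in>UNIV. if j = i then pderiv_fract j x else 0)"
    unfolding dK_def by (intro sum.cong) (simp_all add: axis_def kc_simps)
  then show ?thesis by simp
qed

lemma dK_dir_add: "dK (v + w) x = dK v x + dK w x"
  by (simp add: dK_def kc_simps distrib_right sum.distrib)

lemma dK_dir_scale: "dK (t *s w) x = kc t * dK w x"
  by (simp add: dK_def kc_simps sum_distrib_left mult_ac)

lemma dpoly_sum: "dpoly w (sum g A) = (\<Sum>a\<in>A. dpoly w (g a))"
  by (induction A rule: infinite_finite_induct) (simp_all add: dpoly_add)

lemma pderiv_poly_dpoly: "pderiv_poly i (dpoly w p) = dpoly w (pderiv_poly i p)"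
  by (simp add: dpoly_def pderiv_poly_sum pderiv_poly_mult pderiv_poly_commute[of i])

lemma dpoly_commute: "dpoly v (dpoly w p) = dpoly w (dpoly v p)"
  unfolding dpoly_def[of v] by (simp add: pderiv_poly_dpoly dpoly_sum dpoly_mult)

lemma dK_commute: "dK v (dK w x) = dK w (dK v x)"
proof -
  obtain p q where x: "q \<noteq> 0" "x = kp p * inverse (kp q)"
    by (metis fract_cases_kp divide_inverse)
  show ?thesis
    by (simp add: x(2) dK_mult dK_inverse dK_add dK_diff dK_minus dpoly_commute[of v] algebra_simps)
qed

lemma dK_log_prod:
  assumes "\<And>a. a \<in> A \<Longrightarrow> x a \<noteq> 0"
  shows "dK w (\<Prod>a\<in>A. x a) = (\<Prod>a\<in>A. x a) * (\<Sum>a\<in>A. dK w (x a) / x a)"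
  using assms
  by (induction A rule: infinite_finite_induct) (simp_all add: dK_mult field_simps)

section \<open>The differential operators acting on \<open>F\<^sup>S\<close>\<close>

lemma lookup_map0: "h 0 = 0 \<Longrightarrow> Poly_Mapping.lookup (Poly_Mapping.map h p) k = h (Poly_Mapping.lookup p k)"
  by (simp add: Poly_Mapping.map.rep_eq when_def)

lemma map_add:
  assumes "h 0 = 0" "\<And>a b. h (a + b) = h a + h b"
  shows "Poly_Mapping.map h (p + q) = Poly_Mapping.map h p + Poly_Mapping.map h q"
  by (intro poly_mapping_eqI) (simp add: lookup_map0 lookup_add assms)

lemma map_sum:
  assumes "h 0 = 0" "\<And>a b. h (a + b) = h a + h b"
  shows "Poly_Mapping.map h (sum g A) = (\<Sum>a\<in>A. Poly_Mapping.map h (g a))"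
  by (induction A rule: infinite_finite_induct)
    (simp_all add: map_add[OF assms], simp_all add: poly_mapping_eq_iff fun_eq_iff lookup_map0 assms)

lemma map_zero0: "h 0 = 0 \<Longrightarrow> Poly_Mapping.map h 0 = 0"
  by (intro poly_mapping_eqI) (simp add: lookup_map0)

lemma map_single0: "h 0 = 0 \<Longrightarrow> Poly_Mapping.map h (Poly_Mapping.single m c) = Poly_Mapping.single m (h c)"
  by (intro poly_mapping_eqI) (auto simp: lookup_map0 lookup_single when_def)

lemma map_Const: "h 0 = 0 \<Longrightarrow> Poly_Mapping.map h (Const c) = Const (h c)"
  by (simp add: Const_def map_single0)

lemma map_Var: "h 0 = 0 \<Longrightarrow> Poly_Mapping.map h (Var k) = Poly_Mapping.single (Poly_Mapping.single k 1) (h 1)"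
  by (simp add: Var_def map_single0)

lemma map_mult:
  fixes p q :: "('v, 'c::comm_ring_1) mpoly" and h :: "'c \<Rightarrow> 'e::comm_ring_1"
  assumes "is_hom h"
  shows "Poly_Mapping.map h (p * q) = Poly_Mapping.map h p * Poly_Mapping.map h q"
proof -
  define P where "P = (\<lambda>m. Poly_Mapping.single m (Poly_Mapping.lookup p m))"
  define Q where "Q = (\<lambda>m. Poly_Mapping.single m (Poly_Mapping.lookup q m))"
  define A where "A = Poly_Mapping.keys p"
  define B where "B = Poly_Mapping.keys q"
  have p: "p = sum P A" and q: "q = sum Q B"
    unfolding P_def Q_def A_def B_def by (rule poly_as_sum)+
  note h = is_homD[OF assms]
  have *: "Poly_Mapping.map h (P a * Q b) = Poly_Mapping.map h (P a) * Poly_Mapping.map h (Q b)" for a b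
    by (simp add: P_def Q_def mult_single map_single0 h)
  show ?thesis
    unfolding p q sum_product map_sum[of h, OF h(1,3)] * ..
qed

lemma map_derivation:
  fixes p q :: "('v, 'c::comm_ring_1) mpoly" and h :: "'c \<Rightarrow> 'c"
  assumes h: "h 0 = 0" "\<And>a b. h (a + b) = h a + h b" "\<And>a b. h (a * b) = h a * b + a * h b"
  shows "Poly_Mapping.map h (p * q) = Poly_Mapping.map h p * q + p * Poly_Mapping.map h q"
proof -
  define P where "P = (\<lambda>m. Poly_Mapping.single m (Poly_Mapping.lookup p m))"
  define Q where "Q = (\<lambda>m. Poly_Mapping.single m (Poly_Mapping.lookup q m))"
  define A where "A = Poly_Mapping.keys p"
  define B where "B = Poly_Mapping.keys q"
  have p: "p = sum P A" and q: "q = sum Q B"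
    unfolding P_def Q_def A_def B_def by (rule poly_as_sum)+
  have *: "Poly_Mapping.map h (P a * Q b) = Poly_Mapping.map h (P a) * Q b + P a * Poly_Mapping.map h (Q b)" for a b
    by (simp add: P_def Q_def mult_single map_single0 h single_add)
  show ?thesis
    unfolding p q sum_product map_sum[of h, OF h(1,2)] * sum.distrib ..
qed

lemma emb_x_kp: "emb_x p = Const (kp p)"
  by (simp add: emb_x_def kp_def)

lemma is_hom_emb_x: "is_hom emb_x"
  using is_hom_comp[OF is_hom_Const is_hom_kp] by (simp add: emb_x_kp[abs_def])

lemma emb_S_kc: "emb_S b = Poly_Mapping.map kc b"
  by (simp add: emb_S_def kc_def[abs_def] kp_def)

lemma is_hom_emb_S: "is_hom emb_S"
proof -
  have "emb_S 1 = emb_S (Const 1)" by simp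
  also have "\<dots> = 1"
    unfolding emb_S_kc by (subst map_Const) (simp_all add: kc_simps)
  finally show ?thesis
    unfolding is_hom_def emb_S_kc
    by (intro conjI allI map_mult is_hom_kc map_add map_zero0) (simp_all add: kc_simps)
qed

lemmas emb_x_simps = is_homD[OF is_hom_emb_x]
lemmas emb_S_simps = is_homD[OF is_hom_emb_S]

lemma emb_S_Const [simp]: "emb_S (Const c) = emb_x (Const c)"
  unfolding emb_S_kc emb_x_kp kc_def[symmetric] by (rule map_Const) (simp add: kc_simps)

lemma emb_S_Var [simp]: "emb_S (Var k) = Var k"
  unfolding emb_S_kc by (subst map_Var) (simp_all add: kc_simps Var_def)

lemmas pderiv_fract_derivation =
  pderiv_fract_kp[of _ 0, simplified kp_simps pderiv_poly_0] pderiv_fract_add pderiv_fract_mult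

lemma map_pderiv_fract_emb_S [simp]: "Poly_Mapping.map (pderiv_fract i) (emb_S b) = 0"
proof (rule poly_mapping_eqI)
  fix m
  have "pderiv_fract i (kc c) = 0" for c
    by (simp add: kc_def kp_simps)
  then show "Poly_Mapping.lookup (Poly_Mapping.map (pderiv_fract i) (emb_S b)) m = Poly_Mapping.lookup 0 m"
    by (simp add: lookup_map0 pderiv_fract_derivation emb_S_kc kc_simps)
qed

lemma map_pderiv_fract_Var [simp]: "Poly_Mapping.map (pderiv_fract i) (Var k) = 0"
  using map_pderiv_fract_emb_S[of i "Var k"] by simp

lemmas map_pderiv_fract_mult = map_derivation[of "pderiv_fract _", OF pderiv_fract_derivation]
lemmas map_pderiv_fract_add = map_add[of "pderiv_fract _", OF pderiv_fract_derivation(1,2)]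
lemmas map_pderiv_fract_Const = map_Const[of "pderiv_fract _", OF pderiv_fract_derivation(1)]

text \<open>The connection \<open>d + dlog F^S\<close> in the direction \<open>w\<close>, which need
  not be a coordinate axis.\<close>

definition nabF ::
    "('r::finite \<Rightarrow> ('n::{finite,linorder}, complex) mpoly) \<Rightarrow> complex ^ 'n::{finite,linorder} \<Rightarrow> ('n, 'r) FS \<Rightarrow> ('n, 'r) FS" where
  "nabF F w h = (\<Sum>i\<in>UNIV. emb_x (Const (w $ i)) * partial_FS F i h)"

lemma partial_FS_emb_S: "partial_FS F i (emb_S b * h) = emb_S b * partial_FS F i h"
  by (simp add: partial_FS_def map_pderiv_fract_mult algebra_simps)

lemma partial_FS_Const:
  "partial_FS F i (Const x * h) = Const (pderiv_fract i x) * h + Const x * partial_FS F i h"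
  by (simp add: partial_FS_def map_pderiv_fract_mult map_pderiv_fract_Const algebra_simps)

lemma nabF_emb_S: "nabF F w (emb_S b * h) = emb_S b * nabF F w h"
  unfolding nabF_def partial_FS_emb_S sum_distrib_left by (simp add: mult.left_commute)

lemma nabF_Const: "nabF F w (Const x * h) = Const (dK w x) * h + Const x * nabF F w h"
  unfolding nabF_def partial_FS_Const
  by (simp add: dK_def Const_sum Const_mult sum_distrib_left sum_distrib_right distrib_left
      sum.distrib emb_x_kp kc_def mult_ac)

lemma nabF_emb_x: "nabF F w (emb_x p * h) = emb_x (dpoly w p) * h + emb_x p * nabF F w h"
  by (simp add: emb_x_kp nabF_Const)

text \<open>The forms are carried by their coefficient vectors, so that proportionality and
  directional derivatives become statements about \<open>bil\<close>; \<open>\<phi> m\<close> tells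
  which \<open>F k\<close> receives the factor \<open>m\<close>.\<close>

locale arr =
  fixes \<alpha> :: "'d::finite \<Rightarrow> complex ^ 'n::{finite,linorder}" and \<phi> :: "'d \<Rightarrow> 'r::finite"
    and F :: "'r \<Rightarrow> ('n, complex) mpoly"
  assumes \<alpha>_nz: "\<And>m. \<alpha> m \<noteq> 0"
    and F_eq: "\<And>k. F k = (\<Prod>m | \<phi> m = k. lf (\<alpha> m))"
begin

abbreviation "L m \<equiv> lf (\<alpha> m)"

abbreviation "f \<equiv> (\<Prod>m\<in>UNIV. L m)"

lemma L_nz: "L m \<noteq> 0"
  by (simp add: \<alpha>_nz)

lemma f_nz: "f \<noteq> 0"
  by (simp add: \<alpha>_nz)

text \<open>The logarithmic differential of F^S evaluated on \<open>w\<close>, expanded over the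
  single linear forms instead of the \<open>F k\<close>.\<close>

definition OmF :: "(complex, 'n) vec \<Rightarrow> ('n, 'r) FS" where
  "OmF w = (\<Sum>m\<in>UNIV. Const (kc (bil (\<alpha> m) w) / kp (L m)) * Var (\<phi> m))"

lemma log_pderiv_F:
  "Fract (pderiv_poly i (F k)) (F k) = (\<Sum>m | \<phi> m = k. kc (\<alpha> m $ i) / kp (L m))"
proof -
  have "Fract (pderiv_poly i (F k)) (F k) = dK (axis i 1) (kp (F k)) / kp (F k)"
    by (simp add: Fract_kp dpoly_axis)
  also have "kp (F k) = (\<Prod>m | \<phi> m = k. kp (L m))"
    by (simp add: F_eq kp_simps)
  also have "dK (axis i 1) \<dots> / \<dots> = (\<Sum>m | \<phi> m = k. dK (axis i 1) (kp (L m)) / kp (L m))"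
    by (subst dK_log_prod) (simp_all add: \<alpha>_nz)
  finally show ?thesis
    by (simp add: kc_def)
qed

lemma partial_FS_OmF: "partial_FS F i h = Poly_Mapping.map (pderiv_fract i) h + h * OmF (axis i 1)"
proof -
  have "(\<Sum>k\<in>UNIV. Const (Fract (pderiv_poly i (F k)) (F k)) * Var k) =
      (\<Sum>k\<in>UNIV. \<Sum>m | m \<in> UNIV \<and> \<phi> m = k. Const (kc (\<alpha> m $ i) / kp (L m)) * Var (\<phi> m))"
    unfolding log_pderiv_F Const_sum sum_distrib_right by (intro sum.cong) auto
  also have "\<dots> = OmF (axis i 1)"
    by (subst sum.group) (simp_all add: OmF_def)
  finally show ?thesis
    by (simp add: partial_FS_def)
qed

lemma OmF_sum: "OmF w = (\<Sum>i\<in>UNIV. emb_x (Const (w $ i)) * OmF (axis i 1))"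
proof -
  have "kc (bil (\<alpha> m) w) / kp (L m) = (\<Sum>i\<in>UNIV. kc (w $ i) * (kc (\<alpha> m $ i) / kp (L m)))" for m
    by (simp add: bil_def kc_simps sum_divide_distrib mult_ac)
  then show ?thesis
    unfolding OmF_def emb_x_kp kc_def[symmetric]
    by (simp add: Const_sum Const_mult sum_distrib_left sum_distrib_right mult.assoc
        del: times_divide_eq_right) (rule sum.swap)
qed

lemma nabF_Const1: "nabF F w (Const x) = Const (dK w x) + Const x * OmF w"
proof -
  have 1: "Poly_Mapping.map (pderiv_fract i) (1 :: ('n, 'r) FS) = 0" for i
    using map_pderiv_fract_emb_S[of i "1 :: ('r, complex) mpoly"] by (simp only: emb_S_simps)
  have "nabF F w 1 = OmF w"
    unfolding nabF_def partial_FS_OmF by (subst OmF_sum) (simp add: 1)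
  then show ?thesis
    using nabF_Const[of F w x 1] by simp
qed

end

section \<open>Specialization of \<open>S\<close> along a line\<close>

lemma coeff_mult_1: "coeff (p * q) 1 = coeff p 0 * coeff q 1 + coeff p 1 * coeff q 0"
  by (simp add: coeff_mult atMost_Suc add.commute)

lemma coeff_mult_0': "coeff (p * q) 0 = coeff p 0 * coeff q 0"
  by (simp add: coeff_mult)

definition dP :: "complex ^ 'n::{finite,linorder} \<Rightarrow> ('n::{finite,linorder}, complex) mpoly fract poly \<Rightarrow> ('n, complex) mpoly fract poly" where
  "dP w H = map_poly (dK w) H"

lemma coeff_dP [simp]: "coeff (dP w H) n = dK w (coeff H n)"
  by (simp add: dP_def coeff_map_poly)

lemma dP_add: "dP w (G + H) = dP w G + dP w H"
  by (rule poly_eqI) (simp add: dK_add)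

lemma dP_minus: "dP w (- H) = - dP w H"
  by (rule poly_eqI) (simp add: dK_minus)

lemma dP_mult: "dP w (G * H) = dP w G * H + G * dP w H"
  by (rule poly_eqI) (simp add: coeff_mult dK_sum dK_mult sum.distrib)

lemma dP_const [simp]: "dP w [:x:] = [:dK w x:]"
  by (rule poly_eqI) (simp add: coeff_pCons split: nat.split)

lemma dP_line [simp]: "dP w [:kc a, kc b:] = 0"
  by (rule poly_eqI) (simp add: coeff_pCons split: nat.split)

lemma dP_line1 [simp]: "dP w [:kc a, 1:] = 0"
  using dP_line[of w a 1] by (simp only: kc_simps)

lemma dP_0 [simp]: "dP w 0 = 0"
  by (rule poly_eqI) simp

lemma dP_sum: "dP w (sum g A) = (\<Sum>a\<in>A. dP w (g a))"
  by (induction A rule: infinite_finite_induct) (simp_all add: dP_add)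

lemma dP_commute: "dP v (dP w H) = dP w (dP v H)"
  by (rule poly_eqI) (simp add: dK_commute)

lemma dP_dir_add: "dP (v + w) H = dP v H + dP w H"
  by (rule poly_eqI) (simp add: dK_dir_add)

lemma dP_dir_scale: "dP (t *s w) H = [:kc t:] * dP w H"
  by (rule poly_eqI) (simp add: dK_dir_scale)

locale arr_sigma = arr \<alpha> \<phi> F
  for \<alpha> :: "'d::finite \<Rightarrow> complex ^ 'n::{finite,linorder}" and \<phi> :: "'d \<Rightarrow> 'r::finite"
    and F :: "'r \<Rightarrow> ('n, complex) mpoly" +
  fixes \<sigma> :: "complex ^ 'r"
begin

abbreviation s_at :: "'d \<Rightarrow> ('n, complex) mpoly fract poly" where
  "s_at m \<equiv> [:kc (\<sigma> $ \<phi> m), 1:]"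

text \<open>The substitution \<open>s_k = \<sigma> $ k + t\<close> with one \<open>t\<close> for all
  \<open>k\<close>: the outer polynomial variable is \<open>t\<close>, and
  \<open>[:kc (\<sigma> $ k), 1:]\<close> stands for \<open>\<sigma> $ k + t\<close>.\<close>

definition Dm :: "('n, 'r) FS \<Rightarrow> ('n, complex) mpoly fract poly" where
  "Dm = subst_poly (\<lambda>c. [:c:]) (\<lambda>k. [:kc (\<sigma> $ k), 1:])"

lemma is_hom_Dm: "is_hom Dm"
  unfolding Dm_def by (intro is_hom_subst is_hom_pconst)

lemmas Dm_simps = is_homD[OF is_hom_Dm]

lemma Dm_Const [simp]: "Dm (Const x) = [:x:]"
  by (simp add: Dm_def is_hom_pconst)

lemma Dm_Var [simp]: "Dm (Var k) = [:kc (\<sigma> $ k), 1:]"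
  by (simp add: Dm_def is_hom_pconst)

lemma Dm_emb_x [simp]: "Dm (emb_x p) = [:kp p:]"
  by (simp add: emb_x_kp)

text \<open>Orders zero and one in \<open>t\<close> are those that enter the argument; both stay
  complex constants, and the first is the value of \<open>b\<close> at
  \<open>\<sigma>\<close>.\<close>

lemma Dm_emb_S: "coeff (Dm (emb_S b)) 0 = kc (ev \<sigma> b) \<and> (\<exists>c. coeff (Dm (emb_S b)) 1 = kc c)"
proof (induction b rule: mpoly_induct)
  case (Const c)
  then show ?case by (auto simp: kc_def intro: exI[of _ 0])
next
  case (Var i)
  then show ?case by (auto intro: exI[of _ 1] simp: kc_simps)
next
  case (add p q)
  then show ?case by (auto simp: emb_S_simps Dm_simps ev_simps kc_simps) (metis kc_simps(3))
next
  case (mult p q)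
  then show ?case
    by (auto simp: emb_S_simps Dm_simps ev_simps kc_simps coeff_mult_1 coeff_mult_0' simp del: One_nat_def)
      (metis kc_simps(3,4))
qed

definition Om :: "(complex, 'n) vec \<Rightarrow> ('n, complex) mpoly fract poly" where
  "Om w = (\<Sum>m\<in>UNIV. [:kc (bil (\<alpha> m) w) / kp (L m):] * s_at m)"

definition nab :: "(complex, 'n) vec \<Rightarrow> ('n, complex) mpoly fract poly \<Rightarrow> ('n, complex) mpoly fract poly" where
  "nab w H = dP w H + H * Om w"

lemma Dm_OmF: "Dm (OmF w) = Om w"
  by (simp add: OmF_def Om_def Dm_simps)

lemma Dm_map_pderiv: "Dm (Poly_Mapping.map (pderiv_fract i) h) = dP (axis i 1) (Dm h)"
  by (induction h rule: mpoly_induct)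
    (simp_all add: map_pderiv_fract_add map_pderiv_fract_mult map_pderiv_fract_Const Dm_simps dP_add
      dP_mult dK_axis)

lemma Dm_partial: "Dm (partial_FS F i h) = nab (axis i 1) (Dm h)"
  by (simp add: partial_FS_OmF nab_def Dm_simps Dm_map_pderiv Dm_OmF)

text \<open>Confines the image of a generator to a submodule: closure of \<open>Z\<close> under the
  specialized generators of the algebra and under sums is enough, composition being absorbed by the
  induction over arbitrary \<open>h\<close>.\<close>

lemma weyl_transfer:
  assumes "P \<in> weyl_action F" "Dm h \<in> Z"
    and Z: "\<And>G c. G \<in> Z \<Longrightarrow> [:kc c:] * G \<in> Z" "\<And>G i. G \<in> Z \<Longrightarrow> [:kp (Var i):] * G \<in> Z"
      "\<And>G k. G \<in> Z \<Longrightarrow> [:kc (\<sigma> $ k), 1:] * G \<in> Z" "\<And>G i. G \<in> Z \<Longrightarrow> nab (axis i 1) G \<in> Z"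
      "\<And>G H. G \<in> Z \<Longrightarrow> H \<in> Z \<Longrightarrow> G + H \<in> Z"
  shows "Dm (P h) \<in> Z"
  using assms(1,2)
proof (induction arbitrary: h)
  case (scalar c)
  then show ?case using Z(1)[of "Dm h" c] by (simp add: Dm_simps kc_def)
next
  case (mult_x i)
  then show ?case using Z(2)[of "Dm h" i] by (simp add: Dm_simps)
next
  case (mult_s k)
  then show ?case using Z(3)[of "Dm h" k] by (simp add: Dm_simps)
next
  case (partial i)
  then show ?case using Z(4)[of "Dm h" i] by (simp add: Dm_partial)
qed (auto simp: Dm_simps intro: Z(5))

lemma Om_dir_add: "Om (v + w) = Om v + Om w"
  by (simp add: Om_def kc_simps add_divide_distrib sum.distrib algebra_simps flip: sum.distrib)

lemma Om_dir_scale: "Om (t *s w) = [:kc t:] * Om w"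
  by (simp add: Om_def kc_simps sum_distrib_left mult_ac)

lemma nab_dir_add: "nab (v + w) H = nab v H + nab w H"
  by (simp add: nab_def dP_dir_add Om_dir_add algebra_simps)

lemma nab_dir_scale: "nab (t *s w) H = [:kc t:] * nab w H"
  by (simp add: nab_def dP_dir_scale Om_dir_scale algebra_simps del: mult_pCons_left mult_pCons_right)

lemma nab_add: "nab w (G + H) = nab w G + nab w H"
  by (simp add: nab_def dP_add algebra_simps)

lemma nab_minus: "nab w (- H) = - nab w H"
  by (simp add: nab_def dP_minus algebra_simps)

lemma nab_diff: "nab w (G - H) = nab w G - nab w H"
  using nab_add[of w G "- H"] by (simp add: nab_minus)

lemma nab_mult: "nab w (G * H) = dP w G * H + G * nab w H"
  by (simp add: nab_def dP_mult algebra_simps)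

lemma nab_0 [simp]: "nab w 0 = 0"
  by (simp add: nab_def)

text \<open>Each logarithmic form \<open>d l / l\<close> is closed, and so is their combination
  \<open>Om\<close>. This flatness makes the twisted derivatives commute.\<close>

lemma dP_Om: "dP v (Om w) = dP w (Om v)"
proof -
  have "dK v (kc (bil a w) / kp (lf a)) = dK w (kc (bil a v) / kp (lf a))" for a
    by (simp add: divide_inverse dK_mult dK_inverse mult_ac flip: kc_def)
  then show ?thesis
    by (simp add: Om_def dP_sum dP_mult del: mult_pCons_left mult_pCons_right)
qed

lemma nab_commute: "nab v (nab w H) = nab w (nab v H)"
  unfolding nab_def dP_add dP_mult dP_Om[of v w] dP_commute[of v w] by (simp add: algebra_simps)

end

section \<open>A dimension count for first-order operators on polynomials in one variable\<close>

lemma coeff_mult_top: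
  fixes p q :: "'a::comm_ring_1 poly"
  assumes "degree p \<le> m" "degree q \<le> n"
  shows "coeff (p * q) (m + n) = coeff p m * coeff q n"
proof -
  have "coeff (p * q) (m + n) = (\<Sum>i\<le>m + n. coeff p i * coeff q (m + n - i))"
    by (rule coeff_mult)
  also have "\<dots> = (\<Sum>i\<in>{m}. coeff p i * coeff q (m + n - i))"
  proof (rule sum.mono_neutral_right)
    show "\<forall>i\<in>{..m + n} - {m}. coeff p i * coeff q (m + n - i) = 0"
    proof
      fix i assume "i \<in> {..m + n} - {m}"
      then have "i > m \<or> m + n - i > n" by auto
      then show "coeff p i * coeff q (m + n - i) = 0"
        using assms by (auto simp: coeff_eq_0)
    qed
  qed auto
  finally show ?thesis by simp
qed

lemma prod_linear_top:
  fixes p :: "'i \<Rightarrow> complex poly"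
  assumes "\<And>i. i \<in> A \<Longrightarrow> degree (p i) \<le> 1"
  shows "degree (\<Prod>i\<in>A. p i) \<le> card A \<and> coeff (\<Prod>i\<in>A. p i) (card A) = (\<Prod>i\<in>A. coeff (p i) 1)"
  using assms
proof (induction A rule: infinite_finite_induct)
  case (insert x A)
  have 1: "degree (p x) \<le> 1" using insert(4) by simp
  from insert have 2: "degree (\<Prod>i\<in>A. p i) \<le> card A"
    and 3: "coeff (\<Prod>i\<in>A. p i) (card A) = (\<Prod>i\<in>A. coeff (p i) 1)" by auto
  have "degree (p x * (\<Prod>i\<in>A. p i)) \<le> 1 + card A"
    using degree_mult_le[of "p x" "\<Prod>i\<in>A. p i"] 1 2 by linarith
  then show ?case
    using coeff_mult_top[OF 1 2] insert(1,2) 3 by simp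
qed auto

text \<open>With \<open>l i = b i + a i t\<close>, \<open>Q\<close> the product of the
  \<open>l i\<close> and \<open>w\<close> the product of the powers \<open>l i ^ \<beta> i\<close>,
  this is \<open>(R Q w)' / w\<close> with all denominators cleared.\<close>

definition log_op :: "'i set \<Rightarrow> ('i \<Rightarrow> complex) \<Rightarrow> ('i \<Rightarrow> complex) \<Rightarrow> ('i \<Rightarrow> complex) \<Rightarrow> complex poly \<Rightarrow> complex poly" where
  "log_op T a b \<beta> R = pderiv (R * (\<Prod>i\<in>T. [:b i, a i:])) +
     R * (\<Sum>i\<in>T. [:\<beta> i * a i:] * (\<Prod>k\<in>T - {i}. [:b k, a k:]))"

lemma log_op_add: "log_op T a b \<beta> (R + R') = log_op T a b \<beta> R + log_op T a b \<beta> R'"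
  by (simp add: log_op_def distrib_right pderiv_add)

lemma log_op_smult: "log_op T a b \<beta> (smult c R) = smult c (log_op T a b \<beta> R)"
  by (simp add: log_op_def pderiv_smult smult_add_right)

lemma log_op_sum: "log_op T a b \<beta> (sum g A) = (\<Sum>x\<in>A. log_op T a b \<beta> (g x))"
  by (induction A rule: infinite_finite_induct) (simp_all add: log_op_add, simp_all add: log_op_def)

text \<open>In the top degree the derivative contributes the degree of \<open>R Q\<close> and each
  logarithmic term its exponent. The resulting sum can vanish for one value of
  \<open>degree R\<close> at most.\<close>

lemma log_op_coeff:
  assumes "finite T" "T \<noteq> {}"
  shows "coeff (log_op T a b \<beta> R) (degree R + card T - 1) =
    (of_nat (degree R + card T) + (\<Sum>i\<in>T. \<beta> i)) * lead_coeff R * (\<Prod>i\<in>T. a i)"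
proof -
  define q where "q = card T - 1"
  have q: "card T = Suc q"
    using assms by (simp add: q_def card_gt_0_iff)
  have lin: "degree [:b i, a i:] \<le> 1" for i by simp
  have top: "degree (\<Prod>i\<in>A. [:b i, a i:]) \<le> card A"
    "coeff (\<Prod>i\<in>A. [:b i, a i:]) (card A) = (\<Prod>i\<in>A. a i)" for A
    using prod_linear_top[of A "\<lambda>i. [:b i, a i:]"] lin by simp_all
  have 1: "coeff (pderiv (R * (\<Prod>i\<in>T. [:b i, a i:]))) (degree R + q) =
      of_nat (degree R + card T) * lead_coeff R * (\<Prod>i\<in>T. a i)"
    using coeff_mult_top[OF order.refl top(1), of R T] top(2)[of T] by (simp add: coeff_pderiv q)
  have summand: "degree ([:\<beta> i * a i:] * (\<Prod>k\<in>T - {i}. [:b k, a k:])) \<le> q \<and>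
      coeff ([:\<beta> i * a i:] * (\<Prod>k\<in>T - {i}. [:b k, a k:])) q = \<beta> i * (\<Prod>i\<in>T. a i)" if "i \<in> T" for i
  proof -
    have "card (T - {i}) = q" using that q assms by simp
    moreover have "(\<Prod>i\<in>T. a i) = a i * (\<Prod>k\<in>T - {i}. a k)"
      using that assms by (simp add: prod.remove)
    ultimately show ?thesis
      using top[of "T - {i}"] degree_smult_le[of "\<beta> i * a i" "\<Prod>k\<in>T - {i}. [:b k, a k:]"]
      by auto
  qed
  have 2: "degree (\<Sum>i\<in>T. [:\<beta> i * a i:] * (\<Prod>k\<in>T - {i}. [:b k, a k:])) \<le> q"
    using summand by (intro degree_sum_le assms) auto
  have "coeff (\<Sum>i\<in>T. [:\<beta> i * a i:] * (\<Prod>k\<in>T - {i}. [:b k, a k:])) q =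
      (\<Sum>i\<in>T. \<beta> i * (\<Prod>i\<in>T. a i))"
    unfolding coeff_sum using summand by (intro sum.cong) auto
  then have "coeff (R * (\<Sum>i\<in>T. [:\<beta> i * a i:] * (\<Prod>k\<in>T - {i}. [:b k, a k:]))) (degree R + q) =
      lead_coeff R * ((\<Sum>i\<in>T. \<beta> i) * (\<Prod>i\<in>T. a i))"
    using coeff_mult_top[OF order.refl 2, of R] by (simp add: sum_distrib_right)
  with 1 show ?thesis
    unfolding log_op_def coeff_add q by (simp add: algebra_simps)
qed

text \<open>If \<open>\<Sum>\<beta> = -2 - j\<close>, then \<open>log_op\<close> cannot cancel leading terms beyond degree \<open>j + 2 - card T\<close>, so the
  displayed decompositions would generate a space of dimension \<open>j + 1\<close> from too few elements.\<close>

lemma log_op_dimension: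
  fixes g :: "complex poly"
  assumes T: "finite T" "card T \<ge> 3" and a: "\<And>i. i \<in> T \<Longrightarrow> a i \<noteq> 0"
    and \<beta>: "(\<Sum>i\<in>T. \<beta> i) = - 2 - of_nat j"
    and n: "degree g = n" "n \<ge> 1" and j: "j + 4 \<le> n + card T"
    and dec: "\<And>i. i \<le> j \<Longrightarrow> \<exists>k R. (k = 0 \<or> degree k + n \<le> j) \<and> monom 1 i = g * k + log_op T a b \<beta> R"
  shows False
proof -
  interpret vs: vector_space "smult :: complex \<Rightarrow> complex poly \<Rightarrow> complex poly"
    by standard (simp_all add: smult_add_left smult_add_right)
  \<comment> \<open>The generators that the degree bounds admit: \<open>k\<close> has degree at most
    \<open>j - n\<close> and \<open>R\<close> at most \<open>j + 2 - card T\<close>. Natural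
    subtraction empties a family whose bound is negative.\<close>
  define G where "G = (\<lambda>i. g * monom 1 i) ` {..<j + 1 - n} \<union> (\<lambda>i. log_op T a b \<beta> (monom 1 i)) ` {..<j + 3 - card T}"
  have monoms: "p = (\<Sum>i\<le>m. smult (coeff p i) (monom 1 i))" if "degree p \<le> m" for p :: "complex poly" and m
    using poly_as_sum_of_monoms'[OF that] by (simp add: smult_monom)
  have "monom 1 i \<in> vs.span G" if i: "i \<le> j" for i
  proof -
    obtain k R where k: "k = 0 \<or> degree k + n \<le> j" and eq: "monom 1 i = g * k + log_op T a b \<beta> R"
      using dec[OF i] by blast
    have "g * k \<in> vs.span G"
    proof (cases "k = 0")
      case False
      have "g * k = (\<Sum>i\<le>degree k. smult (coeff k i) (g * monom 1 i))"
        by (subst monoms[of k "degree k"]) (simp_all add: sum_distrib_left)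
      also have "\<dots> \<in> vs.span G"
        using k False by (intro vs.span_sum vs.span_scale vs.span_base) (auto simp: G_def)
      finally show ?thesis .
    qed (simp add: vs.span_zero)
    moreover have "log_op T a b \<beta> R \<in> vs.span G"
    proof (cases "R = 0")
      case True
      then show ?thesis by (simp add: log_op_def vs.span_zero)
    next
      case False
      \<comment> \<open>A larger degree would place the top coefficient above degree
        \<open>j\<close>, where it must vanish; but its scalar factor is zero only if
        \<open>degree R + card T = j + 2\<close>.\<close>
      have "degree R + card T \<le> j + 2"
      proof (rule ccontr)
        assume *: "\<not> ?thesis"
        have "degree (g * k) \<le> j"
          using k degree_mult_le[of g k] n by auto
        then have "degree (monom 1 i - g * k) \<le> j"
          using i by (intro degree_diff_le) (auto simp: degree_monom_eq)
        then have "degree (log_op T a b \<beta> R) \<le> j"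
          by (simp add: eq)
        then have "coeff (log_op T a b \<beta> R) (degree R + card T - 1) = 0"
          using * by (intro coeff_eq_0) linarith
        moreover have "T \<noteq> {}" using T by auto
        ultimately have "of_nat (degree R + card T) + (\<Sum>i\<in>T. \<beta> i) = 0"
          using T a False log_op_coeff[of T a b \<beta> R] by simp
        then have "of_nat (degree R + card T) = (of_nat (j + 2) :: complex)"
          by (simp add: \<beta> algebra_simps)
        then show False
          using * unfolding of_nat_eq_iff by simp
      qed
      have "log_op T a b \<beta> R = (\<Sum>i\<le>degree R. smult (coeff R i) (log_op T a b \<beta> (monom 1 i)))"
        by (subst monoms[of R "degree R"]) (simp_all add: log_op_sum log_op_smult)
      also have "\<dots> \<in> vs.span G"
        using \<open>degree R + card T \<le> j + 2\<close>
        by (intro vs.span_sum vs.span_scale vs.span_base) (auto simp: G_def)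
      finally show ?thesis .
    qed
    ultimately show ?thesis
      unfolding eq by (rule vs.span_add)
  qed
  then have sub: "monom 1 ` {..j} \<subseteq> vs.span G"
    by auto
  have inj: "inj_on (monom (1::complex)) {..j}"
    by (auto simp: inj_on_def monom_eq_iff')
  have "vs.independent (monom 1 ` {..j})"
  proof (rule vs.independent_if_scalars_zero)
    fix h :: "complex poly \<Rightarrow> complex" and x :: "complex poly"
    assume h: "(\<Sum>x\<in>monom 1 ` {..j}. smult (h x) x) = 0" and "x \<in> monom 1 ` {..j}"
    then obtain i where i: "i \<le> j" "x = monom 1 i" by auto
    have "0 = coeff (\<Sum>k\<le>j. smult (h (monom 1 k)) (monom 1 k)) i"
      using h unfolding sum.reindex[OF inj] by simp
    also have "\<dots> = (\<Sum>k\<le>j. if k = i then h (monom 1 k) else 0)"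
      unfolding coeff_sum by (intro sum.cong) auto
    also have "\<dots> = h x" using i by simp
    finally show "h x = 0" by simp
  qed simp
  moreover have finG: "finite G"
    by (simp add: G_def)
  ultimately have "card (monom (1::complex) ` {..j}) \<le> card G"
    using vs.independent_span_bound[OF finG _ sub] by blast
  also have "card G \<le> (j + 1 - n) + (j + 3 - card T)"
    unfolding G_def
    by (rule order.trans[OF card_Un_le], rule add_mono; rule order.trans[OF card_image_le]) auto
  finally have "j + 1 \<le> (j + 1 - n) + (j + 3 - card T)"
    by (simp add: card_image[OF inj])
  \<comment> \<open>If one of the two natural differences is truncated at zero,
    \<open>card T \<ge> 3\<close> or \<open>n \<ge> 1\<close> bounds the other by
    \<open>j\<close>.\<close>
  with j n T show False
    by linarith
qed

section \<open>The order of a rational function along a hyperplane\<close>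

lemma kc_of_int: "kc (of_int z) = of_int z"
proof (induction z rule: int_induct[of _ 0])
  case (step1 i)
  then show ?case by (simp add: kc_simps)
next
  case (step2 i)
  then show ?case by (simp add: kc_simps)
qed (simp add: kc_simps)

lemma kc_of_nat: "kc (of_nat z) = of_nat z"
  using kc_of_int[of "int z"] by simp

lemma dK_power_int:
  assumes "x \<noteq> 0"
  shows "dK w (x powi n) = of_int n * x powi (n - 1) * dK w x"
proof (induction n rule: int_induct[of _ 0])
  case (step1 i)
  have "x powi (i + 1) = x powi i * x" "x powi i = x powi (i - 1) * x"
    using assms power_int_add_1[of x i] power_int_add_1[of x "i - 1"] by auto
  then show ?case
    using step1 by (simp add: dK_mult algebra_simps)
next
  case (step2 i)
  have "x powi (i - 1) = x powi i * inverse x" "x powi (i - 1 - 1) = x powi (i - 1) * inverse x"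
    using assms by (simp_all add: power_int_diff power2_eq_square divide_inverse)
  then show ?case
    using step2 by (simp add: dK_mult dK_inverse algebra_simps power2_eq_square)
qed (simp)

text \<open>The valuation at the prime \<open>lf a\<close>, stated as a lower bound: zero then needs
  no infinite value, and negative \<open>k\<close> admits poles.\<close>

definition ord_ge :: "complex ^ 'n::{finite,linorder} \<Rightarrow> int \<Rightarrow> ('n, complex) mpoly fract \<Rightarrow> bool" where
  "ord_ge a k x \<longleftrightarrow> (\<exists>p q. \<not> lf a dvd q \<and> x = kp (lf a) powi k * (kp p / kp q))"

lemma ord_geI: "\<not> lf a dvd q \<Longrightarrow> x = kp (lf a) powi k * (kp p / kp q) \<Longrightarrow> ord_ge a k x"
  unfolding ord_ge_def by blast

lemma ord_ge_0_cases:
  assumes "ord_ge a k x"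
  obtains u where "x = kp (lf a) powi k * u" "ord_ge a 0 u"
  using assms unfolding ord_ge_def by fastforce

lemma not_lf_dvd_1: "a \<noteq> 0 \<Longrightarrow> \<not> lf a dvd 1"
  using lf_not_Const[of a 1] by simp

lemma ord_ge_kp: "a \<noteq> 0 \<Longrightarrow> ord_ge a 0 (kp p)"
  by (rule ord_geI[of a 1]) (simp_all add: not_lf_dvd_1 kp_simps)

lemma ord_ge_zero: "a \<noteq> 0 \<Longrightarrow> ord_ge a k 0"
  by (rule ord_geI[of a 1 _ _ 0]) (simp_all add: not_lf_dvd_1 kp_simps)

lemma ord_ge_mult:
  assumes a: "a \<noteq> 0" and "ord_ge a k x" "ord_ge a k' y"
  shows "ord_ge a (k + k') (x * y)"
proof -
  obtain p q where x: "\<not> lf a dvd q" "x = kp (lf a) powi k * (kp p / kp q)"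
    using assms by (auto simp: ord_ge_def)
  obtain p' q' where y: "\<not> lf a dvd q'" "y = kp (lf a) powi k' * (kp p' / kp q')"
    using assms by (auto simp: ord_ge_def)
  have "\<not> lf a dvd q * q'"
    using lf_prime[OF a] x y by blast
  moreover have "x * y = kp (lf a) powi (k + k') * (kp (p * p') / kp (q * q'))"
    using a by (simp add: x y power_int_add kp_simps)
  ultimately show ?thesis by (rule ord_geI)
qed

lemma ord_ge_pow: "a \<noteq> 0 \<Longrightarrow> ord_ge a k (kp (lf a) powi k)"
  by (rule ord_geI[of a 1 _ _ 1]) (simp_all add: not_lf_dvd_1 kp_simps)

lemma ord_ge_mono:
  assumes a: "a \<noteq> 0" and "ord_ge a k x" "k' \<le> k"
  shows "ord_ge a k' x"
proof -
  obtain u where u: "x = kp (lf a) powi k * u" "ord_ge a 0 u"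
    using assms(2) by (rule ord_ge_0_cases)
  obtain m where m: "k = k' + int m"
    using assms(3) by (metis zle_iff_zadd)
  have "x = kp (lf a) powi k' * (kp (lf a ^ m) * u)"
    using a by (simp add: u(1) m power_int_add kp_simps)
  moreover have "ord_ge a (k' + (0 + 0)) (kp (lf a) powi k' * (kp (lf a ^ m) * u))"
    using a u by (intro ord_ge_mult ord_ge_pow ord_ge_kp) auto
  ultimately show ?thesis by simp
qed

lemma ord_ge_add:
  assumes a: "a \<noteq> 0" and "ord_ge a k x" "ord_ge a k y"
  shows "ord_ge a k (x + y)"
proof -
  obtain p q where x: "\<not> lf a dvd q" "x = kp (lf a) powi k * (kp p / kp q)"
    using assms by (auto simp: ord_ge_def)
  obtain p' q' where y: "\<not> lf a dvd q'" "y = kp (lf a) powi k * (kp p' / kp q')"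
    using assms by (auto simp: ord_ge_def)
  have "\<not> lf a dvd q * q'"
    using lf_prime[OF a] x y by blast
  moreover have "q \<noteq> 0" "q' \<noteq> 0" using x y by auto
  then have "x + y = kp (lf a) powi k * (kp (p * q' + p' * q) / kp (q * q'))"
    by (simp add: x y kp_simps field_simps)
  ultimately show ?thesis by (rule ord_geI)
qed

lemma ord_ge_minus: "a \<noteq> 0 \<Longrightarrow> ord_ge a k x \<Longrightarrow> ord_ge a k (- x)"
  using ord_ge_mult[of a 0 "kp (- 1)" k x] ord_ge_kp[of a "- 1"] by (simp add: kp_simps)

lemma ord_ge_diff: "a \<noteq> 0 \<Longrightarrow> ord_ge a k x \<Longrightarrow> ord_ge a k y \<Longrightarrow> ord_ge a k (x - y)"
  using ord_ge_add[of a k x "- y"] ord_ge_minus[of a k y] by simp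

lemma ord_ge_sum: "a \<noteq> 0 \<Longrightarrow> (\<And>i. i \<in> A \<Longrightarrow> ord_ge a k (g i)) \<Longrightarrow> ord_ge a k (sum g A)"
  by (induction A rule: infinite_finite_induct) (simp_all add: ord_ge_zero ord_ge_add)

lemma ord_ge_inverse: "a \<noteq> 0 \<Longrightarrow> \<not> lf a dvd q \<Longrightarrow> ord_ge a 0 (inverse (kp q))"
  by (rule ord_geI[of a q _ _ 1]) (simp_all add: kp_simps divide_inverse)

lemma ord_ge_kp_mult: "a \<noteq> 0 \<Longrightarrow> ord_ge a k x \<Longrightarrow> ord_ge a k (kp p * x)"
  using ord_ge_mult[OF _ ord_ge_kp, of a k x p] by simp

lemma ord_ge_kc_mult: "a \<noteq> 0 \<Longrightarrow> ord_ge a k x \<Longrightarrow> ord_ge a k (kc c * x)"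
  unfolding kc_def by (rule ord_ge_kp_mult)

lemma ord_ge_dK:
  assumes a: "a \<noteq> 0" and "ord_ge a 0 x"
  shows "ord_ge a 0 (dK w x)"
proof -
  obtain p q where x: "\<not> lf a dvd q" "x = kp p * inverse (kp q)"
    using assms by (auto simp: ord_ge_def divide_inverse)
  have "ord_ge a (0 + 0) (kp (dpoly w p) * inverse (kp q))"
    "ord_ge a (0 + (0 + (0 + 0))) (kp p * (kp (dpoly w q) * (inverse (kp q) * inverse (kp q))))"
    using a x(1) by (intro ord_ge_mult ord_ge_kp ord_ge_inverse; simp)+
  then show ?thesis
    using a by (simp add: x(2) dK_mult dK_inverse ord_ge_diff mult_ac)
qed

text \<open>Let the order of \<open>x\<close> be at least \<open>k\<close>.  The derivative of \<open>x\<close> twisted by an exponent \<open>\<kappa>\<close> has leading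
  coefficient \<open>k + \<kappa>\<close> times that of \<open>x\<close>.\<close>

lemma twisted_expand:
  assumes a: "a \<noteq> 0" and x: "ord_ge a k x" and r: "ord_ge a 0 r"
  shows "\<exists>y. ord_ge a k y \<and>
    dK w x + x * (kc \<kappa> * kc (bil a w) / kp (lf a) + r) =
      kc ((of_int k + \<kappa>) * bil a w) * (x * inverse (kp (lf a))) + y"
proof -
  obtain u where u: "x = kp (lf a) powi k * u" "ord_ge a 0 u"
    using x by (rule ord_ge_0_cases)
  let ?y = "kp (lf a) powi k * (dK w u + u * r)"
  have "ord_ge a (k + 0) ?y"
    using a u r ord_ge_mult[OF a u(2) r] by (intro ord_ge_mult ord_ge_pow ord_ge_add ord_ge_dK) auto
  moreover have "dK w x = of_int k * kc (bil a w) * (x * inverse (kp (lf a))) + kp (lf a) powi k * dK w u"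
    using a by (simp add: u dK_mult dK_power_int power_int_diff kc_def field_simps)
  then have "dK w x + x * (kc \<kappa> * kc (bil a w) / kp (lf a) + r) =
      kc ((of_int k + \<kappa>) * bil a w) * (x * inverse (kp (lf a))) + ?y"
    by (simp add: kc_simps kc_of_int divide_inverse algebra_simps u(1))
  ultimately show ?thesis by auto
qed

text \<open>Twisted differentiation costs one order, with leading factor
  \<open>k + \<kappa>\<close>. If the derivative nevertheless has order \<open>k\<close> and this
  factor is nonzero, the leading term of \<open>x\<close> itself is absent.\<close>

lemma twisted_raise:
  fixes a :: "complex ^ 'n::{finite,linorder}"
  assumes a: "a \<noteq> 0" and x: "ord_ge a k x" and r: "ord_ge a 0 r"
    and D: "ord_ge a k (dK w x + x * (kc \<kappa> * kc (bil a w) / kp (lf a) + r))"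
    and nz: "of_int k + \<kappa> \<noteq> 0" "bil a w \<noteq> 0"
  shows "ord_ge a (k + 1) x"
proof -
  let ?c = "(of_int k + \<kappa>) * bil a w" and ?l = "kp (lf a)"
  obtain y where y: "ord_ge a k y" and eq: "dK w x + x * (kc \<kappa> * kc (bil a w) / kp (lf a) + r) =
      kc ?c * (x * inverse ?l) + y"
    using twisted_expand[OF a x r] by blast
  have "ord_ge a k (kc ?c * (x * inverse ?l))"
    using ord_ge_diff[OF a D y] unfolding eq by simp
  then have "ord_ge a (k + 1) (kc ?c * (x * inverse ?l) * (kc (1 / ?c) * ?l powi 1))"
    by (rule ord_ge_mult[OF a _ ord_ge_kc_mult[OF a ord_ge_pow[OF a]]])
  have "kc ?c * kc (1 / ?c) = (1 :: ('n, complex) mpoly fract)"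
    using nz by (simp flip: kc_simps(4)) (simp add: kc_simps)
  moreover have "kc ?c * (x * inverse ?l) * (kc (1 / ?c) * ?l powi 1) = (kc ?c * kc (1 / ?c)) * (x * (inverse ?l * ?l))"
    by (simp only: power_int_1_right mult_ac)
  ultimately have eq1: "kc ?c * (x * inverse ?l) * (kc (1 / ?c) * ?l powi 1) = x"
    using a by simp
  show ?thesis
    using \<open>ord_ge a (k + 1) _\<close> unfolding eq1 .
qed

lemma twisted_raise_to:
  assumes a: "a \<noteq> 0" and x: "ord_ge a k x" and r: "ord_ge a 0 r"
    and D: "ord_ge a (k' - 1) (dK w x + x * (kc \<kappa> * kc (bil a w) / kp (lf a) + r))"
    and nz: "\<And>z. k \<le> z \<Longrightarrow> z < k' \<Longrightarrow> of_int z + \<kappa> \<noteq> 0" "bil a w \<noteq> 0"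
  shows "ord_ge a k' x"
proof (cases "k \<le> k'")
  case True
  have "z \<le> k' \<longrightarrow> ord_ge a z x" if "k \<le> z" for z
    using that
  proof (induction z rule: int_ge_induct)
    case (step z)
    then show ?case
      using twisted_raise[OF a _ r ord_ge_mono[OF a D, of z]] nz by auto
  qed (use x in simp)
  with True show ?thesis by blast
next
  case False
  with ord_ge_mono[OF a x, of k'] show ?thesis by simp
qed

text \<open>At the resonant order \<open>k = - \<kappa>\<close> the polar term cancels and
  differentiation costs nothing. Hence order at least \<open>k\<close> is a condition stable under
  the operators, which is the source of every invariant submodule below.\<close>

lemma twisted_keep:
  assumes a: "a \<noteq> 0" and x: "ord_ge a k x" and r: "ord_ge a 0 r" and "of_int k + \<kappa> = 0"
  shows "ord_ge a k (dK w x + x * (kc \<kappa> * kc (bil a w) / kp (lf a) + r))"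
  using twisted_expand[OF a x r, of w \<kappa>] assms(4) by (auto simp: kc_simps)

lemma lf_power_dvd_mult:
  fixes p q :: "('n::{finite,linorder}, complex) mpoly"
  assumes a: "a \<noteq> 0" and "lf a ^ n dvd p * q" "\<not> lf a dvd q"
  shows "lf a ^ n dvd p"
  using assms(2)
proof (induction n arbitrary: p)
  case (Suc n)
  from Suc(2) have "lf a dvd p * q"
    by (metis dvd_mult_left power_Suc)
  then obtain p' where p': "p = lf a * p'"
    using lf_prime[OF a] assms(3) by blast
  then have "lf a ^ n dvd p' * q"
    using Suc(2) a by (simp add: mult.assoc)
  then show ?case
    using Suc(1)[of p'] by (simp add: p')
qed simp

lemma ord_ge_kp_iff:
  assumes a: "a \<noteq> 0"
  shows "ord_ge a (int n) (kp p) \<longleftrightarrow> lf a ^ n dvd p"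
proof
  assume "ord_ge a (int n) (kp p)"
  then obtain s q where q: "\<not> lf a dvd q" "kp p = kp (lf a) ^ n * (kp s / kp q)"
    by (auto simp: ord_ge_def)
  then have "kp (p * q) = kp (lf a ^ n * s)"
    by (auto simp: kp_simps field_simps)
  then have "lf a ^ n dvd p * q" by simp
  then show "lf a ^ n dvd p"
    using lf_power_dvd_mult[OF a _ q(1)] by blast
next
  assume "lf a ^ n dvd p"
  then obtain s where "p = lf a ^ n * s" ..
  then show "ord_ge a (int n) (kp p)"
    using ord_ge_mult[OF a ord_ge_pow[OF a, of "int n"] ord_ge_kp[OF a, of s]] by (simp add: kp_simps)
qed

section \<open>Grouping parallel factors\<close>

text \<open>\<open>rp\<close> selects, for every factor, a representative of the factors with the same hyperplane.\<close>

locale arr_lines = arr \<alpha> \<phi> F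
  for \<alpha> :: "'d::finite \<Rightarrow> complex ^ 'n::{finite,linorder}" and \<phi> :: "'d \<Rightarrow> 'r::finite"
    and F :: "'r \<Rightarrow> ('n, complex) mpoly" +
  fixes rp :: "'d \<Rightarrow> 'd" and cf :: "'d \<Rightarrow> complex"
  assumes \<alpha>_rp: "\<And>m. \<alpha> m = cf m *s \<alpha> (rp m)" and rp_rp: "\<And>m. rp (rp m) = rp m"
    and not_parallel: "\<And>m m'. rp m \<noteq> rp m' \<Longrightarrow> \<not> L (rp m) dvd L (rp m')"
begin

abbreviation "T \<equiv> range rp"

abbreviation "mult_in A i \<equiv> card {m \<in> A. rp m = i}"

lemma cf_nz: "cf m \<noteq> 0"
  using \<alpha>_rp[of m] \<alpha>_nz[of m] by auto

lemma L_rp: "L m = Const (cf m) * L (rp m)"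
  by (simp only: lf_scale[symmetric] \<alpha>_rp[symmetric])

lemma rp_T: "i \<in> T \<Longrightarrow> rp i = i"
  by (auto simp: rp_rp)

lemma not_parallel_T: "i \<in> T \<Longrightarrow> k \<in> T \<Longrightarrow> i \<noteq> k \<Longrightarrow> \<not> L i dvd L k"
  by (metis not_parallel rp_T)

lemma not_dvd_rp: "i \<in> T \<Longrightarrow> rp m \<noteq> i \<Longrightarrow> \<not> L i dvd L m"
  using not_parallel_T[of i "rp m"] lf_prime[OF \<alpha>_nz, of i "Const (cf m)" "L (rp m)"]
    lf_not_Const[OF \<alpha>_nz, of i "cf m"] cf_nz[of m] by (auto simp: L_rp[of m])

text \<open>Proportional forms have the same logarithmic derivative, so exponents along one
  hyperplane simply add up.\<close>

lemma log_term_rp: "kc (bil (\<alpha> m) w) / kp (L m) = kc (bil (\<alpha> (rp m)) w) / kp (L (rp m))"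
  unfolding L_rp[of m] using cf_nz[of m] \<alpha>_nz
  by (subst (1) \<alpha>_rp) (simp add: kp_simps kc_simps flip: kc_def)

lemma sum_lines: "(\<Sum>m\<in>A. h (rp m) * x m) = (\<Sum>i\<in>T. h i * (\<Sum>m | m \<in> A \<and> rp m = i. x m))"
  for h x :: "'d \<Rightarrow> 'e::comm_ring_1"
proof -
  have "(\<Sum>m\<in>A. h (rp m) * x m) = (\<Sum>i\<in>T. \<Sum>m | m \<in> A \<and> rp m = i. h (rp m) * x m)"
    by (subst sum.group) auto
  also have "\<dots> = (\<Sum>i\<in>T. h i * (\<Sum>m | m \<in> A \<and> rp m = i. x m))"
    unfolding sum_distrib_left by (intro sum.cong) auto
  finally show ?thesis .
qed

lemma sum_log_terms:
  "(\<Sum>m\<in>A. kc (bil (\<alpha> m) w) / kp (L m) * kc (x m)) =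
    (\<Sum>i\<in>T. kc (bil (\<alpha> i) w) / kp (L i) * kc (\<Sum>m | m \<in> A \<and> rp m = i. x m))"
proof -
  have "(\<Sum>m\<in>A. kc (bil (\<alpha> m) w) / kp (L m) * kc (x m)) =
      (\<Sum>m\<in>A. kc (bil (\<alpha> (rp m)) w) / kp (L (rp m)) * kc (x m))"
    by (intro sum.cong refl arg_cong2[where f = "(*)"] log_term_rp)
  then show ?thesis
    using sum_lines[of "\<lambda>i. kc (bil (\<alpha> i) w) / kp (L i)" "\<lambda>m. kc (x m)" A] by (simp add: kc_simps)
qed

lemma prod_lines: "(\<Prod>m\<in>A. L m) = Const (\<Prod>m\<in>A. cf m) * (\<Prod>i\<in>T. L i ^ mult_in A i)"
proof -
  have "(\<Prod>m\<in>A. L (rp m)) = (\<Prod>i\<in>T. \<Prod>m | m \<in> A \<and> rp m = i. L (rp m))"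
    by (subst prod.group) auto
  also have "\<dots> = (\<Prod>i\<in>T. L i ^ mult_in A i)"
  proof (rule prod.cong)
    fix i
    have "(\<Prod>m | m \<in> A \<and> rp m = i. L (rp m)) = (\<Prod>m | m \<in> A \<and> rp m = i. L i)"
      by (intro prod.cong) auto
    then show "(\<Prod>m | m \<in> A \<and> rp m = i. L (rp m)) = L i ^ mult_in A i"
      by simp
  qed simp
  finally show ?thesis
    by (subst L_rp) (simp add: prod.distrib is_homD[OF is_hom_Const])
qed

lemma card_lines: "(\<Sum>i\<in>T. mult_in A i) = card A"
  using sum_lines[of "\<lambda>_. 1 :: int" "\<lambda>_. 1" A] by (simp flip: of_nat_sum)

lemma ord_ge_prod_L:
  assumes "i \<in> T"
  shows "ord_ge (\<alpha> i) (int (mult_in A i)) (kp (\<Prod>m\<in>A. L m))"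
  unfolding ord_ge_kp_iff[OF \<alpha>_nz] prod_lines
  using assms by (intro dvd_mult dvd_prodI) auto

lemma mult_in_exact:
  assumes "i \<in> T" "L i ^ n dvd Const c * (\<Prod>m\<in>A. L m)" "c \<noteq> 0"
  shows "n \<le> mult_in A i"
proof (rule ccontr)
  assume n: "\<not> ?thesis"
  let ?R = "Const (c * (\<Prod>m\<in>A. cf m)) * (\<Prod>k\<in>T - {i}. L k ^ mult_in A k)"
  have eq: "Const c * (\<Prod>m\<in>A. L m) = L i ^ mult_in A i * ?R"
    using assms(1) unfolding prod_lines by (simp add: prod.remove[of T i] Const_mult)
  have nd: "\<not> L i dvd ?R"
  proof
    assume "L i dvd ?R"
    moreover have "\<not> L i dvd Const (c * (\<Prod>m\<in>A. cf m))"
      using assms(3) cf_nz by (simp add: lf_not_Const[OF \<alpha>_nz])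
    ultimately have "L i dvd (\<Prod>k\<in>T - {i}. L k ^ mult_in A k)"
      using lf_prime[OF \<alpha>_nz] by blast
    then obtain k where "k \<in> T - {i}" "L i dvd L k ^ mult_in A k"
      using lf_dvd_prod[OF \<alpha>_nz[of i], of "T - {i}" "\<lambda>k. L k ^ mult_in A k"] by fastforce
    then show False
      using not_parallel_T[of i k] assms(1) lf_dvd_power[OF \<alpha>_nz] by blast
  qed
  have "L i ^ n dvd L i ^ mult_in A i"
    by (rule lf_power_dvd_mult[OF \<alpha>_nz _ nd]) (use assms(2) in \<open>simp only: eq\<close>)
  moreover have "L i ^ n = L i ^ mult_in A i * L i ^ (n - mult_in A i)"
    using n by (simp flip: power_add)
  ultimately have "L i ^ mult_in A i * L i ^ (n - mult_in A i) dvd L i ^ mult_in A i * 1"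
    by (simp only: mult_1_right)
  then have "L i ^ (n - mult_in A i) dvd 1"
    unfolding dvd_mult_cancel_left using L_nz[of i] by simp
  moreover have "L i dvd L i ^ (n - mult_in A i)"
    using n by (intro dvd_power) simp
  ultimately show False
    using not_lf_dvd_1[OF \<alpha>_nz] dvd_trans by blast
qed

text \<open>Isolates the residue along the line \<open>i\<close>; the terms of all other lines are
  regular there because those lines are not parallel to it.\<close>

lemma log_sum_split:
  assumes "i \<in> T"
  shows "\<exists>r. ord_ge (\<alpha> i) 0 r \<and> (\<Sum>m\<in>A. kc (bil (\<alpha> m) w) / kp (L m) * kc (x m)) =
    kc (\<Sum>m | m \<in> A \<and> rp m = i. x m) * kc (bil (\<alpha> i) w) / kp (L i) + r"
proof -
  let ?t = "\<lambda>i. kc (bil (\<alpha> i) w) / kp (L i) * kc (\<Sum>m | m \<in> A \<and> rp m = i. x m)"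
  have "ord_ge (\<alpha> i) 0 (?t k)" if "k \<in> T" "k \<noteq> i" for k
    using ord_ge_mult[OF \<alpha>_nz[of i] ord_ge_kp[OF \<alpha>_nz] ord_ge_inverse[OF \<alpha>_nz not_parallel_T[OF assms that(1)]],
      of "Const (bil (\<alpha> k) w * (\<Sum>m | m \<in> A \<and> rp m = k. x m))"] that
    by (simp add: divide_inverse kc_simps mult_ac flip: kc_def)
  then have "ord_ge (\<alpha> i) 0 (\<Sum>k\<in>T - {i}. ?t k)"
    by (intro ord_ge_sum \<alpha>_nz) auto
  moreover have "(\<Sum>k\<in>T. ?t k) = kc (\<Sum>m | m \<in> A \<and> rp m = i. x m) * kc (bil (\<alpha> i) w) / kp (L i) + (\<Sum>k\<in>T - {i}. ?t k)"
    using assms by (subst sum.remove[of T i]) (simp_all add: mult_ac)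
  ultimately show ?thesis
    by (subst sum_log_terms) blast
qed

lemma lines_dvd:
  assumes "A \<subseteq> T" "\<And>i. i \<in> A \<Longrightarrow> L i ^ n i dvd p"
  shows "(\<Prod>i\<in>A. L i ^ n i) dvd p"
proof -
  have "finite A" by simp
  then show ?thesis
    using assms
  proof (induction A arbitrary: p rule: finite_induct)
    case (insert i A)
    then obtain s where s: "p = L i ^ n i * s"
      by (metis dvdE insertI1)
    have "L k ^ n k dvd s" if k: "k \<in> A" for k
    proof (rule lf_power_dvd_mult[OF \<alpha>_nz])
      show "L k ^ n k dvd s * L i ^ n i"
        using insert(5)[of k] k by (simp add: s mult.commute)
      have "\<not> L k dvd L i"
        using insert k by (intro not_parallel_T) auto
      then show "\<not> L k dvd L i ^ n i"
        using lf_dvd_power[OF \<alpha>_nz] by blast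
    qed
    then have "(\<Prod>i\<in>A. L i ^ n i) dvd s"
      using insert by auto
    with insert(1,2) show ?case
      by (simp add: s)
  qed simp
qed

end

locale lines_sigma = arr_lines \<alpha> \<phi> F rp cf + arr_sigma \<alpha> \<phi> F \<sigma>
  for \<alpha> :: "'d::finite \<Rightarrow> complex ^ 'n::{finite,linorder}" and \<phi> :: "'d \<Rightarrow> 'r::finite"
    and F :: "'r \<Rightarrow> ('n, complex) mpoly" and rp :: "'d \<Rightarrow> 'd" and cf :: "'d \<Rightarrow> complex"
    and \<sigma> :: "(complex, 'r) vec"
begin

text \<open>The exponent of F^\<sigma> along the hyperplane of \<open>i\<close>, all parallel
  factors taken together.\<close>

definition \<kappa> :: "'d \<Rightarrow> complex" where
  "\<kappa> i = (\<Sum>m | rp m = i. \<sigma> $ \<phi> m)"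

lemma coeff_Om:
  "coeff (Om w) 0 = (\<Sum>m\<in>UNIV. kc (bil (\<alpha> m) w) / kp (L m) * kc (\<sigma> $ \<phi> m))"
  "coeff (Om w) (Suc 0) = (\<Sum>m\<in>UNIV. kc (bil (\<alpha> m) w) / kp (L m) * kc 1)"
  by (simp_all add: Om_def coeff_sum kc_simps mult.commute)

lemma coeff_nab:
  "coeff (nab w H) 0 = dK w (coeff H 0) + coeff H 0 * coeff (Om w) 0"
  "coeff (nab w H) (Suc 0) = dK w (coeff H (Suc 0)) + coeff H (Suc 0) * coeff (Om w) 0 + coeff H 0 * coeff (Om w) (Suc 0)"
  using coeff_mult_1[of H "Om w"] by (simp_all add: nab_def coeff_mult_0')

lemma Om_split:
  assumes "i \<in> T"
  obtains r where "ord_ge (\<alpha> i) 0 r"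
    "coeff (Om w) 0 = kc (\<kappa> i) * kc (bil (\<alpha> i) w) / kp (L i) + r"
  using log_sum_split[OF assms, where A = UNIV and x = "\<lambda>m. \<sigma> $ \<phi> m" and w = w]
  by (auto simp: coeff_Om \<kappa>_def)

lemma Om_split_1:
  assumes "i \<in> T"
  obtains r where "ord_ge (\<alpha> i) 0 r"
    "coeff (Om w) (Suc 0) = kc (of_nat (mult_in UNIV i)) * kc (bil (\<alpha> i) w) / kp (L i) + r"
  using log_sum_split[OF assms, where A = UNIV and x = "\<lambda>m. 1" and w = w]
  by (auto simp: coeff_Om)

end

section \<open>The center of an arrangement of rank two: necessity\<close>

text \<open>Essential coordinates \<open>a\<^sub>u\<close>, \<open>a\<^sub>v\<close> with dual
  directions \<open>e\<^sub>u\<close>, \<open>e\<^sub>v\<close>; the remaining coordinates are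
  parameters. By \<open>transversal\<close> the direction \<open>e\<^sub>u\<close> leaves every
  line, so that differentiation along \<open>e\<^sub>u\<close> alone detects the order along each of
  them.\<close>

locale arr_plane = arr_lines \<alpha> \<phi> F rp cf
  for \<alpha> :: "'d::finite \<Rightarrow> complex ^ 'n::{finite,linorder}" and \<phi> :: "'d \<Rightarrow> 'r::finite"
    and F :: "'r \<Rightarrow> ('n, complex) mpoly" and rp :: "'d \<Rightarrow> 'd" and cf :: "'d \<Rightarrow> complex" +
  fixes a\<^sub>u a\<^sub>v e\<^sub>u e\<^sub>v :: "(complex, 'n) vec"
  assumes dual [simp]: "bil a\<^sub>u e\<^sub>u = 1" "bil a\<^sub>u e\<^sub>v = 0" "bil a\<^sub>v e\<^sub>u = 0" "bil a\<^sub>v e\<^sub>v = 1"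
    and \<alpha>_plane: "\<And>m. \<alpha> m = bil (\<alpha> m) e\<^sub>u *s a\<^sub>u + bil (\<alpha> m) e\<^sub>v *s a\<^sub>v"
    and transversal: "\<And>m. bil (\<alpha> m) e\<^sub>u \<noteq> 0"
begin

abbreviation "u \<equiv> lf a\<^sub>u"

abbreviation "v \<equiv> lf a\<^sub>v"

lemma L_plane: "L m = Const (bil (\<alpha> m) e\<^sub>u) * u + Const (bil (\<alpha> m) e\<^sub>v) * v"
  by (simp only: lf_scale[symmetric] lf_add[symmetric] \<alpha>_plane[symmetric])

lemma \<alpha>_bil_0: "bil a\<^sub>u w = 0 \<Longrightarrow> bil a\<^sub>v w = 0 \<Longrightarrow> bil (\<alpha> m) w = 0"
  by (subst \<alpha>_plane) simp

text \<open>Polynomials that are homogeneous in \<open>u\<close> and \<open>v\<close>, with coefficients in the remaining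
  coordinates.\<close>

inductive HP :: "nat \<Rightarrow> ('n, complex) mpoly \<Rightarrow> bool" where
  HP_const: "HP 0 (Const c)"
| HP_add: "HP M p \<Longrightarrow> HP M q \<Longrightarrow> HP M (p + q)"
| HP_u: "HP M p \<Longrightarrow> HP (Suc M) (u * p)"
| HP_v: "HP M p \<Longrightarrow> HP (Suc M) (v * p)"
| HP_xi: "HP M p \<Longrightarrow> bil \<xi> e\<^sub>u = 0 \<Longrightarrow> bil \<xi> e\<^sub>v = 0 \<Longrightarrow> HP M (lf \<xi> * p)"

lemma HP_zero: "HP M 0"
proof (induction M)
  case 0
  then show ?case using HP_const[of 0] by simp
next
  case (Suc M)
  then show ?case using HP_u[of M 0] by simp
qed

lemma HP_dpoly:
  assumes "HP M p" "w = e\<^sub>u \<or> w = e\<^sub>v"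
  shows "if M = 0 then dpoly w p = 0 else HP (M - 1) (dpoly w p)"
  using assms
proof (induction rule: HP.induct)
  case (HP_add M p q)
  then show ?case by (auto simp: dpoly_add intro: HP.HP_add)
next
  case (HP_u M p)
  have "HP M (Const c * p)" if "c = 0 \<or> c = 1" for c :: complex
    using that HP_u HP_zero by auto
  moreover have "HP M (u * dpoly w p)"
    by (cases M) (use HP_u HP.HP_u[of "M - 1" "dpoly w p"] in \<open>simp_all add: HP_zero\<close>)
  moreover have "bil a\<^sub>u w = 0 \<or> bil a\<^sub>u w = 1" using HP_u by auto
  ultimately show ?case
    by (auto simp: dpoly_mult intro: HP.HP_add)
next
  case (HP_v M p)
  have "HP M (Const c * p)" if "c = 0 \<or> c = 1" for c :: complex
    using that HP_v HP_zero by auto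
  moreover have "HP M (v * dpoly w p)"
    by (cases M) (use HP_v HP.HP_v[of "M - 1" "dpoly w p"] in \<open>simp_all add: HP_zero\<close>)
  moreover have "bil a\<^sub>v w = 0 \<or> bil a\<^sub>v w = 1" using HP_v by auto
  ultimately show ?case
    by (auto simp: dpoly_mult intro: HP.HP_add)
next
  case (HP_xi M p \<xi>)
  then have "bil \<xi> w = 0" by auto
  with HP_xi show ?case
    by (auto simp: dpoly_mult intro: HP.HP_xi)
qed simp

lemma HP_on_line: "HP M p \<Longrightarrow> degree (on_line e\<^sub>v e\<^sub>u p) \<le> M"
proof (induction rule: HP.induct)
  case (HP_u M p)
  then show ?case
    using degree_mult_le[of "[:0, 1:]" "on_line e\<^sub>v e\<^sub>u p"] by (simp add: on_line_simps)
qed (auto simp: on_line_simps intro: degree_add_le)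

lemma HP_monom: "HP (i + k) (u ^ i * v ^ k)"
proof -
  have 1: "HP k (v ^ k)"
    by (induction k) (use HP_const[of 1] in \<open>auto intro: HP_v\<close>)
  show ?thesis
    by (induction i) (use 1 in \<open>auto simp: mult.assoc intro: HP_u\<close>)
qed

text \<open>Multiplication by a coordinate is a sum of operators homogeneous for the degree in
  \<open>u\<close> and \<open>v\<close>; \<open>direction_split\<close> does the same for the
  derivations. Thus the generators of the Weyl algebra respect the grading \<open>Y\<close>
  piecewise.\<close>

lemma coordinate_split:
  "\<exists>\<xi>. bil \<xi> e\<^sub>u = 0 \<and> bil \<xi> e\<^sub>v = 0 \<and> Var i = Const (e\<^sub>u $ i) * u + (Const (e\<^sub>v $ i) * v + lf \<xi>)"
proof -
  let ?\<xi> = "axis i 1 - e\<^sub>u $ i *s a\<^sub>u - e\<^sub>v $ i *s a\<^sub>v"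
  have "Var i = lf (e\<^sub>u $ i *s a\<^sub>u + (e\<^sub>v $ i *s a\<^sub>v + ?\<xi>))"
    by (simp add: lf_axis)
  also have "\<dots> = Const (e\<^sub>u $ i) * u + (Const (e\<^sub>v $ i) * v + lf ?\<xi>)"
    by (simp only: lf_add lf_scale)
  finally show ?thesis
    by (intro exI[of _ ?\<xi>]) simp
qed

lemma direction_split:
  "\<exists>w. bil a\<^sub>u w = 0 \<and> bil a\<^sub>v w = 0 \<and> axis i 1 = a\<^sub>u $ i *s e\<^sub>u + (a\<^sub>v $ i *s e\<^sub>v + w)"
  by (intro exI[of _ "axis i 1 - a\<^sub>u $ i *s e\<^sub>u - a\<^sub>v $ i *s e\<^sub>v"]) simp

end

locale center = arr_plane \<alpha> \<phi> F rp cf a\<^sub>u a\<^sub>v e\<^sub>u e\<^sub>v + lines_sigma \<alpha> \<phi> F rp cf \<sigma>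
  for \<alpha> :: "'d::finite \<Rightarrow> complex ^ 'n::{finite,linorder}" and \<phi> :: "'d \<Rightarrow> 'r::finite"
    and F :: "'r \<Rightarrow> ('n, complex) mpoly" and rp :: "'d \<Rightarrow> 'd" and cf :: "'d \<Rightarrow> complex"
    and a\<^sub>u a\<^sub>v e\<^sub>u e\<^sub>v :: "(complex, 'n) vec" and \<sigma> :: "(complex, 'r) vec"
begin

definition S_sum :: "('n, complex) mpoly fract poly" where
  "S_sum = (\<Sum>m\<in>UNIV. s_at m)"

lemma coeff_S_sum [simp]:
  "coeff S_sum 0 = kc (\<Sum>m\<in>UNIV. \<sigma> $ \<phi> m)" "coeff S_sum (Suc 0) = kc (of_nat CARD('d))"
  by (simp_all add: S_sum_def coeff_sum kc_simps kc_of_nat)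

lemma dP_S_sum [simp]: "dP w S_sum = 0"
  by (simp add: S_sum_def dP_sum)

lemma dP_kc [simp]: "dP w [:kc c:] = 0"
  by simp

text \<open>Graded pieces, for the degree in \<open>u\<close> and \<open>v\<close>, of the module generated by \<open>f F\<^sup>S\<close>, with \<open>S\<close>
  specialized to \<open>\<sigma> + t (1, \<dots>, 1)\<close>.\<close>

inductive Y :: "int \<Rightarrow> ('n, complex) mpoly fract poly \<Rightarrow> bool" where
  Y_base: "Y (int CARD('d)) [:kp f:]"
| Y_zero: "Y N 0"
| Y_add: "Y N G \<Longrightarrow> Y N H \<Longrightarrow> Y N (G + H)"
| Y_const: "Y N H \<Longrightarrow> Y N ([:kc c:] * H)"
| Y_s: "Y N H \<Longrightarrow> Y N ([:kc (\<sigma> $ k), 1:] * H)"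
| Y_u: "Y N H \<Longrightarrow> Y (N + 1) ([:kp u:] * H)"
| Y_v: "Y N H \<Longrightarrow> Y (N + 1) ([:kp v:] * H)"
| Y_xi: "Y N H \<Longrightarrow> bil \<xi> e\<^sub>u = 0 \<Longrightarrow> bil \<xi> e\<^sub>v = 0 \<Longrightarrow> Y N ([:kp (lf \<xi>):] * H)"
| Y_du: "Y N H \<Longrightarrow> Y (N - 1) (nab e\<^sub>u H)"
| Y_dv: "Y N H \<Longrightarrow> Y (N - 1) (nab e\<^sub>v H)"

lemma nab_const_mult: "nab w ([:x:] * H) = [:dK w x:] * H + [:x:] * nab w H"
  by (simp only: nab_mult dP_const)

lemma nab_kp_mult: "nab w ([:kp (lf a):] * H) = [:kc (bil a w):] * H + [:kp (lf a):] * nab w H"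
  by (simp only: nab_const_mult dK_kp dpoly_lf kc_def)

lemma nab_kc_mult: "nab w ([:kc c:] * H) = [:kc c:] * nab w H"
  by (simp only: nab_const_mult dK_kc) simp

lemma nab_s_mult: "nab w ([:kc c, 1:] * H) = [:kc c, 1:] * nab w H"
  by (simp only: nab_mult dP_line1) simp

lemma nab_prod_L: "nab w [:kp (\<Prod>m\<in>A. L m):] =
    [:kp (\<Prod>m\<in>A. L m):] * ([:\<Sum>m\<in>A. kc (bil (\<alpha> m) w) / kp (L m):] + Om w)"
proof -
  have "dK w (kp (\<Prod>m\<in>A. L m)) = kp (\<Prod>m\<in>A. L m) * (\<Sum>m\<in>A. kc (bil (\<alpha> m) w) / kp (L m))"
    unfolding kp_simps by (subst dK_log_prod) (simp_all add: \<alpha>_nz kc_def)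
  then show ?thesis
    by (simp add: nab_def algebra_simps)
qed

lemma Om_0:
  assumes "bil a\<^sub>u w = 0" "bil a\<^sub>v w = 0" shows "Om w = 0"
  using \<alpha>_bil_0[OF assms] by (simp add: Om_def kc_simps)

text \<open>A derivation along which \<open>u\<close> and \<open>v\<close> are constant kills the
  generator, and passing a multiplier it produces only constants; so closure under it follows from
  the rules of \<open>Y\<close>.\<close>

lemma Y_kernel:
  assumes "Y N H" "bil a\<^sub>u w = 0" "bil a\<^sub>v w = 0"
  shows "Y N (nab w H)"
  using assms
proof (induction rule: Y.induct)
  case Y_base
  then show ?case
    by (simp only: nab_prod_L \<alpha>_bil_0 Om_0) (simp add: kc_simps Y_zero)
next
  case (Y_xi N H \<xi>)
  then show ?case
    unfolding nab_kp_mult by (intro Y.Y_add Y.Y_const Y.Y_xi) auto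
next
  case (Y_u N H)
  then show ?case
    using Y.Y_u[of N "nab w H"] unfolding nab_kp_mult by (simp add: kc_simps)
next
  case (Y_v N H)
  then show ?case
    using Y.Y_v[of N "nab w H"] unfolding nab_kp_mult by (simp add: kc_simps)
next
  case (Y_s N H k)
  then show ?case unfolding nab_s_mult by (intro Y.Y_s) auto
next
  case (Y_const N H c)
  then show ?case unfolding nab_kc_mult by (intro Y.Y_const) auto
next
  case (Y_du N H)
  then show ?case unfolding nab_commute[of w] by (intro Y.Y_du) auto
next
  case (Y_dv N H)
  then show ?case unfolding nab_commute[of w] by (intro Y.Y_dv) auto
qed (auto simp: nab_add intro: Y.intros)

section \<open>The Euler operator and homogeneous components\<close>

definition Euler :: "('n, complex) mpoly fract poly \<Rightarrow> ('n, complex) mpoly fract poly" where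
  "Euler H = [:kp u:] * nab e\<^sub>u H + [:kp v:] * nab e\<^sub>v H"

lemma Euler_add: "Euler (G + H) = Euler G + Euler H"
  by (simp add: Euler_def nab_add algebra_simps)

lemma Euler_mult_const:
  "dP e\<^sub>u G = 0 \<Longrightarrow> dP e\<^sub>v G = 0 \<Longrightarrow> Euler (G * H) = G * Euler H"
  by (simp add: Euler_def nab_mult algebra_simps del: mult_pCons_left mult_pCons_right)

lemma Euler_log_term: "kp u * (kc (bil (\<alpha> m) e\<^sub>u) / kp (L m)) + kp v * (kc (bil (\<alpha> m) e\<^sub>v) / kp (L m)) = 1"
proof -
  have "kp u * kc (bil (\<alpha> m) e\<^sub>u) + kp v * kc (bil (\<alpha> m) e\<^sub>v) = kp (L m)"
    using arg_cong[OF L_plane[of m], of kp] by (simp add: kp_simps kc_def mult.commute)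
  then show ?thesis
    using \<alpha>_nz[of m] by (simp add: add_divide_distrib[symmetric])
qed

lemma Euler_Om: "[:kp u:] * Om e\<^sub>u + [:kp v:] * Om e\<^sub>v = S_sum"
proof -
  have *: "[:kp u:] * ([:x:] * s) + [:kp v:] * ([:y:] * s) = [:kp u * x + kp v * y:] * s" for x y s
    by (simp add: smult_add_left mult.commute)
  show ?thesis
    unfolding Om_def S_sum_def sum_distrib_left sum.distrib[symmetric] * Euler_log_term
    by simp
qed

lemma Euler_prod_L: "Euler [:kp (\<Prod>m\<in>A. L m):] = ([:kc (of_nat (card A)):] + S_sum) * [:kp (\<Prod>m\<in>A. L m):]"
proof -
  let ?p = "[:kp (\<Prod>m\<in>A. L m):]"
  let ?l = "\<lambda>w. \<Sum>m\<in>A. kc (bil (\<alpha> m) w) / kp (L m)"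
  have "kp u * ?l e\<^sub>u + kp v * ?l e\<^sub>v = (\<Sum>m\<in>A. 1)"
    unfolding sum_distrib_left sum.distrib[symmetric] Euler_log_term ..
  then have "[:kp u:] * [:?l e\<^sub>u:] + [:kp v:] * [:?l e\<^sub>v:] = [:kc (of_nat (card A)):]"
    by (simp add: kc_of_nat mult.commute)
  moreover have "Euler ?p = ?p * (([:kp u:] * [:?l e\<^sub>u:] + [:kp v:] * [:?l e\<^sub>v:]) + ([:kp u:] * Om e\<^sub>u + [:kp v:] * Om e\<^sub>v))"
    unfolding Euler_def nab_prod_L by (simp only: algebra_simps)
  ultimately show ?thesis
    unfolding Euler_Om by (simp only: mult.commute)
qed

text \<open>\<open>N + S_sum\<close> is the degree of \<open>H F^S\<close> in \<open>u\<close> and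
  \<open>v\<close>. The grading thus becomes an eigenvalue, by which homogeneous components can be
  recognized.\<close>

lemma Y_Euler:
  assumes "Y N H"
  shows "Euler H = ([:kc (of_int N):] + S_sum) * H"
  using assms
proof (induction rule: Y.induct)
  case Y_base
  then show ?case using Euler_prod_L[of UNIV] by simp
next
  case (Y_zero N)
  then show ?case by (simp add: Euler_def)
next
  case (Y_add N G H)
  then show ?case by (simp add: Euler_add distrib_left)
next
  case (Y_const N H c)
  then show ?case
    by (subst Euler_mult_const) (simp_all add: mult_ac del: mult_pCons_left mult_pCons_right)
next
  case (Y_s N H k)
  then show ?case
    by (subst Euler_mult_const) (simp_all add: mult_ac del: mult_pCons_left mult_pCons_right)
next
  case (Y_u N H)
  have "Euler ([:kp u:] * H) = [:kp u:] * Euler H + [:kp u:] * H"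
    unfolding Euler_def nab_kp_mult by (simp add: kc_simps algebra_simps del: mult_pCons_left mult_pCons_right)
  then show ?case
    unfolding Y_u(2) by (simp add: kc_simps algebra_simps smult_add_left)
next
  case (Y_v N H)
  have "Euler ([:kp v:] * H) = [:kp v:] * Euler H + [:kp v:] * H"
    unfolding Euler_def nab_kp_mult by (simp add: kc_simps algebra_simps del: mult_pCons_left mult_pCons_right)
  then show ?case
    unfolding Y_v(2) by (simp add: kc_simps algebra_simps smult_add_left)
next
  case (Y_xi N H \<xi>)
  have "Euler ([:kp (lf \<xi>):] * H) = [:kp (lf \<xi>):] * Euler H"
    using Y_xi.hyps unfolding Euler_def nab_kp_mult by (simp add: kc_simps algebra_simps del: mult_pCons_left mult_pCons_right)
  then show ?case
    unfolding Y_xi.IH by (simp only: mult_ac)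
next
  case (Y_du N H)
  have "nab e\<^sub>u (Euler H) = nab e\<^sub>u H + Euler (nab e\<^sub>u H)"
    unfolding Euler_def nab_add nab_kp_mult nab_commute[of e\<^sub>v e\<^sub>u]
    by (simp add: kc_simps algebra_simps del: mult_pCons_left mult_pCons_right)
  moreover have "nab e\<^sub>u (([:kc (of_int N):] + S_sum) * H) = ([:kc (of_int N):] + S_sum) * nab e\<^sub>u H"
    by (simp only: nab_mult dP_add dP_S_sum dP_kc) simp
  ultimately have "Euler (nab e\<^sub>u H) = ([:kc (of_int N):] + S_sum) * nab e\<^sub>u H - [:kc 1:] * nab e\<^sub>u H"
    unfolding Y_du(2) by (simp add: kc_simps algebra_simps)
  also have "\<dots> = ([:kc (of_int N) - kc 1:] + S_sum) * nab e\<^sub>u H"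
    by (simp add: algebra_simps smult_diff_left)
  finally show ?case
    by (simp add: kc_simps)
next
  case (Y_dv N H)
  have "nab e\<^sub>v (Euler H) = nab e\<^sub>v H + Euler (nab e\<^sub>v H)"
    unfolding Euler_def nab_add nab_kp_mult nab_commute[of e\<^sub>u e\<^sub>v]
    by (simp add: kc_simps algebra_simps del: mult_pCons_left mult_pCons_right)
  moreover have "nab e\<^sub>v (([:kc (of_int N):] + S_sum) * H) = ([:kc (of_int N):] + S_sum) * nab e\<^sub>v H"
    by (simp only: nab_mult dP_add dP_S_sum dP_kc) simp
  ultimately have "Euler (nab e\<^sub>v H) = ([:kc (of_int N):] + S_sum) * nab e\<^sub>v H - [:kc 1:] * nab e\<^sub>v H"
    unfolding Y_dv(2) by (simp add: kc_simps algebra_simps)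
  also have "\<dots> = ([:kc (of_int N) - kc 1:] + S_sum) * nab e\<^sub>v H"
    by (simp add: algebra_simps smult_diff_left)
  finally show ?case
    by (simp add: kc_simps)
qed

text \<open>The eigenvalues differ by nonzero integers. Applying \<open>Euler\<close> minus the
  eigenvalue of \<open>M\<close> removes the term at \<open>M\<close> and multiplies the one at
  \<open>N\<close> by \<open>N - M\<close>.\<close>

lemma eigen_independent:
  assumes "finite A" "\<And>N. N \<in> A \<Longrightarrow> Euler (y N) = ([:kc (of_int N):] + S_sum) * y N" "(\<Sum>N\<in>A. y N) = 0"
  shows "\<forall>N\<in>A. y N = 0"
  using assms
proof (induction A arbitrary: y rule: finite_induct)
  case (insert M A)
  define y' where "y' = (\<lambda>N. [:kc (of_int (N - M)):] * y N)"
  have Euler_0: "Euler 0 = 0" by (simp add: Euler_def)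
  have Euler_sum: "Euler (sum g B) = (\<Sum>x\<in>B. Euler (g x))" for g :: "int \<Rightarrow> _" and B
    by (induction B rule: infinite_finite_induct) (simp_all add: Euler_add Euler_0)
  have "0 = Euler (\<Sum>N\<in>insert M A. y N) - ([:kc (of_int M):] + S_sum) * (\<Sum>N\<in>insert M A. y N)"
    using insert(5) by (simp add: Euler_0)
  also have "\<dots> = (\<Sum>N\<in>insert M A. ([:kc (of_int N):] + S_sum) * y N - ([:kc (of_int M):] + S_sum) * y N)"
    unfolding Euler_sum sum_distrib_left sum_subtractf[symmetric] using insert(4) by (intro sum.cong) auto
  also have "\<dots> = (\<Sum>N\<in>insert M A. y' N)"
    by (intro sum.cong) (simp_all add: y'_def kc_simps algebra_simps smult_diff_left)
  also have "\<dots> = (\<Sum>N\<in>A. y' N)"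
    using insert(1,2) by (simp add: y'_def kc_simps)
  finally have "(\<Sum>N\<in>A. y' N) = 0" by simp
  moreover have "Euler (y' N) = ([:kc (of_int N):] + S_sum) * y' N" if "N \<in> A" for N
    unfolding y'_def using insert(4)[of N] that
    by (subst Euler_mult_const) (simp_all add: mult_ac del: mult_pCons_left mult_pCons_right)
  ultimately have "\<forall>N\<in>A. y' N = 0"
    using insert(3) by blast
  then have "\<forall>N\<in>A. y N = 0"
    using insert(2) unfolding y'_def by (auto simp: kc_of_int)
  then show ?case
    using insert by simp
qed simp

inductive Y_span :: "('n, complex) mpoly fract poly \<Rightarrow> bool" where
  "Y_span 0"
| "Y N H \<Longrightarrow> Y_span G \<Longrightarrow> Y_span (H + G)"

lemma Y_span_add: "Y_span G \<Longrightarrow> Y_span H \<Longrightarrow> Y_span (G + H)"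
  by (induction rule: Y_span.induct) (auto simp: add.assoc intro: Y_span.intros)

lemma Y_in_span: "Y N H \<Longrightarrow> Y_span H"
  using Y_span.intros(2)[OF _ Y_span.intros(1)] by fastforce

lemma Y_span_op:
  assumes "Y_span G" "\<And>H N. Y N H \<Longrightarrow> Y_span (op H)" "\<And>G H. op (G + H) = op G + op H"
  shows "Y_span (op G)"
  using assms(1)
proof (induction rule: Y_span.induct)
  case 1
  then show ?case using assms(2)[OF Y_zero] .
qed (simp add: assms(2,3) Y_span_add)

lemma Y_span_weyl:
  assumes "P \<in> weyl_action F" "Y_span (Dm h)"
  shows "Y_span (Dm (P h))"
proof -
  have "Dm (P h) \<in> Collect Y_span"
  proof (rule weyl_transfer[OF assms(1)])
    show "Dm h \<in> Collect Y_span" using assms(2) by simp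
    fix G H c i k
    assume "G \<in> Collect Y_span" then have G: "Y_span G" by simp
    note op = Y_span_op[OF G, of "\<lambda>H. _ * H", OF _ distrib_left]
    show "[:kc c:] * G \<in> Collect Y_span"
      using op Y_in_span[OF Y_const] by blast
    show "[:kc (\<sigma> $ k), 1:] * G \<in> Collect Y_span"
      using op Y_in_span[OF Y_s] by blast
    have "Y_span ([:kp (Var i):] * H)" if "Y N H" for N H
    proof -
      obtain \<xi> where \<xi>: "bil \<xi> e\<^sub>u = 0" "bil \<xi> e\<^sub>v = 0"
        "Var i = Const (e\<^sub>u $ i) * u + (Const (e\<^sub>v $ i) * v + lf \<xi>)"
        using coordinate_split by blast
      have "[:kp (Var i):] * H = [:kc (e\<^sub>u $ i):] * ([:kp u:] * H) +
          ([:kc (e\<^sub>v $ i):] * ([:kp v:] * H) + [:kp (lf \<xi>):] * H)"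
        unfolding \<xi>(3) kc_def by (simp add: kp_simps smult_add_left mult.commute)
      also have "Y_span \<dots>"
        by (intro Y_span_add Y_in_span[OF Y_const[OF Y_u[OF that]]] Y_in_span[OF Y_const[OF Y_v[OF that]]]
            Y_in_span[OF Y_xi[OF that \<xi>(1,2)]])
      finally show ?thesis .
    qed
    then show "[:kp (Var i):] * G \<in> Collect Y_span"
      using op by blast
    have "Y_span (nab (axis i 1) H)" if "Y N H" for N H
    proof -
      obtain w where w: "bil a\<^sub>u w = 0" "bil a\<^sub>v w = 0" "axis i 1 = a\<^sub>u $ i *s e\<^sub>u + (a\<^sub>v $ i *s e\<^sub>v + w)"
        using direction_split by blast
      show ?thesis
        unfolding w(3) nab_dir_add nab_dir_scale
        by (intro Y_span_add Y_in_span[OF Y_const[OF Y_du[OF that]]] Y_in_span[OF Y_const[OF Y_dv[OF that]]]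
            Y_in_span[OF Y_kernel[OF that w(1,2)]])
    qed
    then show "nab (axis i 1) G \<in> Collect Y_span"
      using Y_span_op[where op = "nab (axis i 1)", OF G _ nab_add] by blast
    assume "H \<in> Collect Y_span"
    then show "G + H \<in> Collect Y_span"
      using G Y_span_add by simp
  qed
  then show ?thesis by simp
qed

lemma Y_span_components:
  assumes "Y_span G"
  shows "\<exists>A y. finite A \<and> (\<forall>N. Y N (y N)) \<and> G = (\<Sum>N\<in>A. y N)"
  using assms
proof (induction rule: Y_span.induct)
  case 1
  then show ?case by (intro exI[of _ "{}"] exI[of _ "\<lambda>_. 0"]) (simp add: Y_zero)
next
  case (2 N H G)
  then obtain A y where A: "finite A" "\<And>N. Y N (y N)" "G = (\<Sum>N\<in>A. y N)" by auto
  define z where "z = (\<lambda>M. (if M \<in> A then y M else 0) + (if M = N then H else 0))"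
  have "Y M (z M)" for M
    unfolding z_def using A 2 by (intro Y_add) (auto intro: Y_zero)
  moreover have "(\<Sum>M\<in>insert N A. z M) = (\<Sum>M\<in>insert N A. if M \<in> A then y M else 0) + (\<Sum>M\<in>insert N A. if M = N then H else 0)"
    by (simp only: z_def sum.distrib)
  moreover have "(\<Sum>M\<in>insert N A. if M \<in> A then y M else 0) = G"
    unfolding A(3) using A(1) by (intro sum.mono_neutral_cong_right) auto
  moreover have "(\<Sum>M\<in>insert N A. if M = N then H else 0) = H"
    using A(1) by simp
  ultimately show ?case
    using A(1) by (intro exI[of _ "insert N A"] exI[of _ z]) (auto simp: add.commute)
qed

text \<open>Since \<open>b f' F^S\<close> is homogeneous, this places it in a single graded piece
  once it is known to lie in the module. Subtracting \<open>G\<close> in degree \<open>N\<close>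
  from its components gives a vanishing sum of eigenvectors.\<close>

lemma Y_span_eigen:
  assumes "Y_span G" "Euler G = ([:kc (of_int N):] + S_sum) * G"
  shows "Y N G"
proof -
  obtain A y where A: "finite A" "\<And>N. Y N (y N)" "G = (\<Sum>N\<in>A. y N)"
    using Y_span_components[OF assms(1)] by blast
  define z where "z = (\<lambda>M. (if M \<in> A then y M else 0) - (if M = N then G else 0))"
  have E: "Euler (z M) = ([:kc (of_int M):] + S_sum) * z M" for M
  proof -
    have E0: "Euler 0 = 0" by (simp add: Euler_def)
    have "Euler (- G) = - Euler G"
      using Euler_add[of G "- G"] E0 by (simp add: eq_neg_iff_add_eq_0 add.commute)
    moreover note E0
    moreover have "Euler (y M) = ([:kc (of_int M):] + S_sum) * y M"
      using Y_Euler[OF A(2)] .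
    ultimately show ?thesis
      using assms(2) Euler_add[of "y M" "- G"]
      by (auto simp: z_def algebra_simps simp del: mult_pCons_left mult_pCons_right)
  qed
  have "(\<Sum>M\<in>insert N A. z M) = (\<Sum>M\<in>insert N A. if M \<in> A then y M else 0) - (\<Sum>M\<in>insert N A. if M = N then G else 0)"
    by (simp only: z_def sum_subtractf)
  moreover have "(\<Sum>M\<in>insert N A. if M \<in> A then y M else 0) = G"
    unfolding A(3) using A(1) by (intro sum.mono_neutral_cong_right) auto
  moreover have "(\<Sum>M\<in>insert N A. if M = N then G else 0) = G"
    using A(1) by simp
  ultimately have "(\<Sum>M\<in>insert N A. z M) = 0" by simp
  then have "z N = 0"
    using eigen_independent[of "insert N A" z] E A(1) by blast
  then have "G = (if N \<in> A then y N else 0)"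
    by (simp add: z_def)
  then show ?thesis
    using A(2) Y_zero by (metis (full_types))
qed

lemma Y_HP:
  assumes "HP M p" "Y N H" "N' = N + int M"
  shows "Y N' ([:kp p:] * H)"
proof -
  have "Y (N + int M) ([:kp p:] * H)"
    using assms(1,2)
  proof (induction rule: HP.induct)
    case (HP_const c)
    then show ?case using Y_const[of N H c] by (simp add: kc_def)
  next
    case (HP_add M p q)
    then show ?case using Y_add[of "N + int M" "[:kp p:] * H" "[:kp q:] * H"]
      by (simp add: kp_simps smult_add_left)
  next
    case (HP_u M p)
    then show ?case using Y_u[of "N + int M" "[:kp p:] * H"] by (simp add: kp_simps algebra_simps)
  next
    case (HP_v M p)
    then show ?case using Y_v[of "N + int M" "[:kp p:] * H"] by (simp add: kp_simps algebra_simps)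
  next
    case (HP_xi M p \<xi>)
    then show ?case using Y_xi[of "N + int M" "[:kp p:] * H" \<xi>] by (simp add: kp_simps mult.commute)
  qed
  with assms(3) show ?thesis by simp
qed

lemma Y_minus: "Y N H \<Longrightarrow> Y N (- H)"
  using Y_const[of N H "- 1"] by (simp add: kc_simps)

end

section \<open>Regularity and poles along the lines\<close>

context center
begin

text \<open>Where \<open>f F\<^sup>\<sigma>\<close> has a nonnegative integral exponent along a line, the elements of the module
  acquire no pole at order zero in \<open>t\<close>.\<close>

lemma Y_regular:
  assumes "Y N H" "i \<in> T" "\<kappa> i = - of_int \<nu>" "\<nu> \<le> int (mult_in UNIV i)"
  shows "ord_ge (\<alpha> i) \<nu> (coeff H 0)"
proof -
  have nab: "ord_ge (\<alpha> i) \<nu> (coeff (nab w H) 0)" if "ord_ge (\<alpha> i) \<nu> (coeff H 0)" for w H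
  proof -
    obtain r where r: "ord_ge (\<alpha> i) 0 r" "coeff (Om w) 0 = kc (\<kappa> i) * kc (bil (\<alpha> i) w) / kp (L i) + r"
      using Om_split[OF assms(2)] .
    show ?thesis
      unfolding coeff_nab r(2) using assms(3) by (intro twisted_keep \<alpha>_nz that r(1)) simp
  qed
  show ?thesis
    using assms(1)
  proof (induction rule: Y.induct)
    case Y_base
    then show ?case
      using ord_ge_mono[OF \<alpha>_nz ord_ge_prod_L[OF assms(2), of UNIV] assms(4)] by simp
  qed (simp_all add: ord_ge_zero \<alpha>_nz ord_ge_add ord_ge_kc_mult ord_ge_kp_mult nab)
qed

lemma kc_in_localization: "kc c \<in> localization f"
  unfolding kc_def kp_def by (rule localization_Fract_1)

lemma log_term_in_localization: "kc b / kp (L m) \<in> localization f"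
proof -
  have "f = L m * (\<Prod>k\<in>UNIV - {m}. L k)"
    by (simp add: prod.remove[of UNIV m])
  then have "kc b / kp (L m) = Fract (Const b * (\<Prod>k\<in>UNIV - {m}. L k)) (f ^ 1)"
    using \<alpha>_nz by (simp add: Fract_kp kp_simps kc_def field_simps)
  then show ?thesis
    unfolding localization_def by blast
qed

text \<open>Confines the poles to the lines. Through \<open>localization_ord\<close> it supplies the
  finite starting order from which \<open>primitive_vanishes\<close> improves.\<close>

lemma Y_localization:
  assumes "Y N H" shows "coeff H n \<in> localization f"
proof -
  have nab: "coeff (nab w H) n \<in> localization f" if "\<And>n. coeff H n \<in> localization f" for w H n
  proof -
    have "coeff (Om w) k \<in> localization f" for k
      unfolding Om_def coeff_sum mult_pCons_left mult_zero_left pCons_0_0 add_0_right coeff_smult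
      by (intro localization_sum f_nz localization_mult log_term_in_localization)
        (auto simp: coeff_pCons kc_in_localization localization_0 localization_1 split: nat.split)
    then show ?thesis
      unfolding nab_def coeff_add coeff_dP dK_def coeff_mult
      by (intro localization_add localization_sum localization_mult localization_pderiv f_nz
          kc_in_localization that)
  qed
  show ?thesis
    using assms
  proof (induction arbitrary: n rule: Y.induct)
    case Y_base
    then show ?case
      by (auto simp: coeff_pCons kp_def localization_Fract_1 localization_0 split: nat.split)
  next
    case (Y_s N H k)
    have "[:kc (\<sigma> $ k), 1:] * H = [:kc (\<sigma> $ k):] * H + pCons 0 H"
      by simp
    then show ?case
      using Y_s by (cases n) (auto intro!: localization_add localization_mult f_nz kc_in_localization)
  next
    case (Y_add N G H)
    then show ?case by (simp add: localization_add[OF f_nz])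
  next
    case (Y_const N H c)
    then show ?case by (simp add: localization_mult kc_in_localization)
  qed (simp_all add: localization_0 localization_mult kp_def localization_Fract_1 nab)
qed

lemma ord_inverse_L: "i \<in> T \<Longrightarrow> ord_ge (\<alpha> i) (- 1) (inverse (kp (L m)))"
proof (cases "rp m = i")
  case True
  then have "L m = Const (cf m) * L i"
    using L_rp[of m] by simp
  then have "inverse (kp (L m)) = inverse (kp (Const (cf m))) * (kp (L i) powi (- 1))"
    by (simp add: kp_simps)
  moreover assume "i \<in> T"
  have "\<not> L i dvd Const (cf m)"
    using lf_not_Const \<alpha>_nz cf_nz by blast
  then have "ord_ge (\<alpha> i) (0 + - 1) (inverse (kp (Const (cf m))) * (kp (L i) powi (- 1)))"
    by (intro ord_ge_mult ord_ge_inverse ord_ge_pow \<alpha>_nz)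
  ultimately show ?thesis by simp
next
  case False
  moreover assume "i \<in> T"
  ultimately have "ord_ge (\<alpha> i) 0 (inverse (kp (L m)))"
    by (intro ord_ge_inverse \<alpha>_nz not_dvd_rp)
  then show ?thesis
    by (rule ord_ge_mono[OF \<alpha>_nz]) simp
qed

lemma localization_ord:
  assumes "i \<in> T" "x \<in> localization f"
  shows "\<exists>z. ord_ge (\<alpha> i) z x"
proof -
  obtain p k where x: "x = Fract p (f ^ k)"
    using assms by (auto simp: localization_def)
  have "\<exists>z. ord_ge (\<alpha> i) z (\<Prod>m\<in>A. inverse (kp (L m)))" for A
  proof (induction A rule: infinite_finite_induct)
    case (insert m A)
    then show ?case
      using ord_ge_mult[OF \<alpha>_nz ord_inverse_L[OF assms(1)]] by auto
  qed (use ord_ge_kp[OF \<alpha>_nz, of i 1] in \<open>auto simp: kp_simps\<close>)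
  then obtain z where z: "ord_ge (\<alpha> i) z (inverse (kp f))"
    by (auto simp: kp_simps prod_inversef[symmetric] comp_def)
  have "\<exists>z'. ord_ge (\<alpha> i) z' (inverse (kp f) ^ k)"
  proof (induction k)
    case 0
    then show ?case using ord_ge_kp[OF \<alpha>_nz, of i 1] by (auto simp: kp_simps)
  next
    case (Suc k)
    then show ?case using ord_ge_mult[OF \<alpha>_nz z] by auto
  qed
  then obtain z' where z': "ord_ge (\<alpha> i) z' (inverse (kp f) ^ k)" by blast
  have "x = kp p * inverse (kp f) ^ k"
    by (simp add: x Fract_kp kp_simps divide_inverse power_inverse)
  with ord_ge_kp_mult[OF \<alpha>_nz z'] show ?thesis by metis
qed

end

text \<open>The hypothesis \<open>\<sigma>_sum\<close> says that \<sigma> is a zero of the center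
  factor with index \<open>j\<close>, that is, f' F^\<sigma> has degree -2 - j in \<open>u\<close>
  and \<open>v\<close>; \<open>n\<close> is the degree of \<open>g\<close>.\<close>

locale center_factor = center \<alpha> \<phi> F rp cf a\<^sub>u a\<^sub>v e\<^sub>u e\<^sub>v \<sigma>
  for \<alpha> :: "'d::finite \<Rightarrow> complex ^ 'n::{finite,linorder}" and \<phi> :: "'d \<Rightarrow> 'r::finite"
    and F :: "'r \<Rightarrow> ('n, complex) mpoly" and rp :: "'d \<Rightarrow> 'd" and cf :: "'d \<Rightarrow> complex"
    and a\<^sub>u a\<^sub>v e\<^sub>u e\<^sub>v :: "(complex, 'n) vec" and \<sigma> :: "(complex, 'r) vec" +
  fixes M' :: "'d set" and c' :: complex and f' g :: "('n, complex) mpoly" and j n :: nat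
  assumes f'_eq: "f' = Const c' * (\<Prod>m\<in>M'. L m)" and c'_nz: "c' \<noteq> 0" and g_eq: "f = g * f'"
    and n_def: "n = card (- M')"
    and \<sigma>_sum: "(\<Sum>m\<in>UNIV. \<sigma> $ \<phi> m) = - of_nat (2 + card M' + j)"
begin

lemma card_split: "n + card M' = CARD('d)"
  using card_Un_disjoint[of "- M'" M'] by (simp add: n_def Compl_partition2)

definition small :: "('n, complex) mpoly fract poly \<Rightarrow> bool" where
  "small k \<longleftrightarrow> (\<exists>k0 k1. coeff k 0 = kp k0 \<and> coeff k (Suc 0) = kp k1 \<and>
     (on_line e\<^sub>v e\<^sub>u k0 = 0 \<or> degree (on_line e\<^sub>v e\<^sub>u k0) + n \<le> j))"

lemma small_0: "small 0"
  unfolding small_def by (intro exI[of _ 0]) (simp add: kp_simps on_line_simps)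

lemma small_add: "small G \<Longrightarrow> small H \<Longrightarrow> small (G + H)"
proof -
  assume "small G" "small H"
  then obtain g0 g1 h0 h1 where *: "coeff G 0 = kp g0" "coeff G (Suc 0) = kp g1"
    "coeff H 0 = kp h0" "coeff H (Suc 0) = kp h1"
    and deg: "on_line e\<^sub>v e\<^sub>u g0 = 0 \<or> degree (on_line e\<^sub>v e\<^sub>u g0) + n \<le> j"
      "on_line e\<^sub>v e\<^sub>u h0 = 0 \<or> degree (on_line e\<^sub>v e\<^sub>u h0) + n \<le> j"
    by (auto simp: small_def)
  have "on_line e\<^sub>v e\<^sub>u (g0 + h0) = 0 \<or> degree (on_line e\<^sub>v e\<^sub>u (g0 + h0)) + n \<le> j"
    using deg degree_add_le_max[of "on_line e\<^sub>v e\<^sub>u g0" "on_line e\<^sub>v e\<^sub>u h0"] by (auto simp: on_line_simps)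
  then show ?thesis
    unfolding small_def by (intro exI[of _ "g0 + h0"] exI[of _ "g1 + h1"]) (simp add: * kp_simps)
qed

lemma small_line_mult:
  assumes "small G" shows "small ([:kc a, kc b:] * G)"
proof -
  obtain g0 g1 where *: "coeff G 0 = kp g0" "coeff G (Suc 0) = kp g1"
    and deg: "on_line e\<^sub>v e\<^sub>u g0 = 0 \<or> degree (on_line e\<^sub>v e\<^sub>u g0) + n \<le> j"
    using assms by (auto simp: small_def)
  have "on_line e\<^sub>v e\<^sub>u (Const a * g0) = smult a (on_line e\<^sub>v e\<^sub>u g0)"
    by (simp add: on_line_simps)
  then have "on_line e\<^sub>v e\<^sub>u (Const a * g0) = 0 \<or> degree (on_line e\<^sub>v e\<^sub>u (Const a * g0)) + n \<le> j"
    using deg degree_smult_le[of a "on_line e\<^sub>v e\<^sub>u g0"] by auto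
  then show ?thesis
    unfolding small_def
    by (intro exI[of _ "Const a * g0"] exI[of _ "Const a * g1 + Const b * g0"])
      (simp add: * kp_simps kc_def)
qed

text \<open>By \<open>p \<nabla>H = \<nabla>(p H) - (\<partial>p) H\<close> every derivation is
  moved from \<open>f F^S\<close> onto \<open>p\<close>, leaving total derivatives. The sum of the
  two degrees is preserved on the way, so when the generator is reached the remaining cofactor has
  degree \<open>j - n\<close>.\<close>

lemma integrate_by_parts:
  assumes "Y N H" "HP M p" "int M + N = int (j + card M')"
  shows "\<exists>k a b. small k \<and> Y (int (j + card M') + 1) a \<and> Y (int (j + card M') + 1) b \<and>
    [:kp p:] * H = k * [:kp f:] + nab e\<^sub>u a + nab e\<^sub>v b"
  using assms
proof (induction arbitrary: M p rule: Y.induct)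
  case Y_base
  then have "M + n = j"
    using card_split by linarith
  then have "small [:kp p:]"
    unfolding small_def using HP_on_line[OF Y_base(1)] by (intro exI[of _ p] exI[of _ 0]) (simp add: kp_simps)
  then show ?case
    by (intro exI[of _ "[:kp p:]"] exI[of _ 0]) (simp add: Y_zero)
next
  case (Y_zero N)
  then show ?case
    by (intro exI[of _ 0]) (simp add: Y.Y_zero small_0)
next
  case (Y_add N G H)
  from Y_add.IH(1)[OF Y_add.prems] obtain k a b where
    1: "small k" "Y (int (j + card M') + 1) a" "Y (int (j + card M') + 1) b"
      "[:kp p:] * G = k * [:kp f:] + nab e\<^sub>u a + nab e\<^sub>v b" by blast
  from Y_add.IH(2)[OF Y_add.prems] obtain k' a' b' where
    2: "small k'" "Y (int (j + card M') + 1) a'" "Y (int (j + card M') + 1) b'"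
      "[:kp p:] * H = k' * [:kp f:] + nab e\<^sub>u a' + nab e\<^sub>v b'" by blast
  have "[:kp p:] * (G + H) = (k + k') * [:kp f:] + nab e\<^sub>u (a + a') + nab e\<^sub>v (b + b')"
    unfolding distrib_left 1(4) 2(4) nab_add by (simp only: distrib_right ac_simps)
  with 1 2 show ?case
    by (blast intro: small_add Y.Y_add)
next
  case (Y_const N H c)
  then obtain k a b where
    1: "small k" "Y (int (j + card M') + 1) a" "Y (int (j + card M') + 1) b"
      "[:kp p:] * H = k * [:kp f:] + nab e\<^sub>u a + nab e\<^sub>v b" by blast
  have "[:kp p:] * ([:kc c:] * H) = [:kc c:] * ([:kp p:] * H)"
    by (simp only: mult_ac)
  also have "\<dots> = ([:kc c:] * k) * [:kp f:] + nab e\<^sub>u ([:kc c:] * a) + nab e\<^sub>v ([:kc c:] * b)"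
    unfolding 1(4) nab_kc_mult by (simp only: distrib_left mult.assoc)
  finally show ?case
    using small_line_mult[OF 1(1), of c 0] Y.Y_const[OF 1(2), of c] Y.Y_const[OF 1(3), of c]
    unfolding kc_simps pCons_0_0 by blast
next
  case (Y_s N H r)
  then obtain k a b where
    1: "small k" "Y (int (j + card M') + 1) a" "Y (int (j + card M') + 1) b"
      "[:kp p:] * H = k * [:kp f:] + nab e\<^sub>u a + nab e\<^sub>v b" by blast
  let ?s = "[:kc (\<sigma> $ r), 1:]"
  have "[:kp p:] * (?s * H) = ?s * ([:kp p:] * H)"
    by (simp only: mult_ac)
  also have "\<dots> = (?s * k) * [:kp f:] + nab e\<^sub>u (?s * a) + nab e\<^sub>v (?s * b)"
    unfolding 1(4) nab_s_mult by (simp only: distrib_left mult.assoc)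
  finally show ?case
    using small_line_mult[OF 1(1), of "\<sigma> $ r" 1] Y.Y_s[OF 1(2), of r] Y.Y_s[OF 1(3), of r]
    unfolding kc_simps by blast
next
  case (Y_u N H)
  have "[:kp p:] * ([:kp u:] * H) = [:kp (u * p):] * H"
    by (simp add: kp_simps mult.commute)
  then show ?case
    using Y_u.IH[OF HP_u[OF Y_u.prems(1)]] Y_u.prems(2) by simp
next
  case (Y_v N H)
  have "[:kp p:] * ([:kp v:] * H) = [:kp (v * p):] * H"
    by (simp add: kp_simps mult.commute)
  then show ?case
    using Y_v.IH[OF HP_v[OF Y_v.prems(1)]] Y_v.prems(2) by simp
next
  case (Y_xi N H \<xi>)
  have "[:kp p:] * ([:kp (lf \<xi>):] * H) = [:kp (lf \<xi> * p):] * H"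
    by (simp add: kp_simps mult.commute)
  then show ?case
    using Y_xi.IH[OF HP_xi[OF Y_xi.prems(1) Y_xi.hyps(2,3)]] Y_xi.prems(2) by simp
next
  case (Y_du N H)
  have "\<exists>k a b. small k \<and> Y (int (j + card M') + 1) a \<and> Y (int (j + card M') + 1) b \<and>
    [:kp (dpoly e\<^sub>u p):] * H = k * [:kp f:] + nab e\<^sub>u a + nab e\<^sub>v b"
  \<comment> \<open>Degree zero is separate because \<open>M - 1\<close> would be truncated; the
    derivative of \<open>p\<close> is zero there.\<close>
  proof (cases "M = 0")
    case True
    then have "dpoly e\<^sub>u p = 0" using HP_dpoly[OF Y_du.prems(1)] by simp
    then show ?thesis
      by (intro exI[of _ 0]) (simp add: Y_zero small_0 kp_simps)
  next
    case False
    then have "HP (M - 1) (dpoly e\<^sub>u p)" using HP_dpoly[OF Y_du.prems(1)] by simp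
    then show ?thesis
      using Y_du.prems(2) False by (intro Y_du.IH) auto
  qed
  then obtain k a b where
    1: "small k" "Y (int (j + card M') + 1) a" "Y (int (j + card M') + 1) b"
      "[:kp (dpoly e\<^sub>u p):] * H = k * [:kp f:] + nab e\<^sub>u a + nab e\<^sub>v b" by blast
  have "[:kp p:] * nab e\<^sub>u H = (- k) * [:kp f:] + nab e\<^sub>u ([:kp p:] * H - a) + nab e\<^sub>v (- b)"
    using 1(4) unfolding nab_diff nab_minus nab_const_mult dK_kp by (simp add: algebra_simps)
  moreover have "Y (int (j + card M') + 1) ([:kp p:] * H + - a)"
    using Y_du.prems(2) by (intro Y_add Y_minus 1(2) Y_HP[OF Y_du.prems(1) Y_du.hyps]) simp
  moreover have "small (- k)"
    using small_line_mult[OF 1(1), of "- 1" 0] by (simp add: kc_simps)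
  ultimately show ?case
    using Y_minus[OF 1(3)] by (metis diff_conv_add_uminus)
next
  case (Y_dv N H)
  have "\<exists>k a b. small k \<and> Y (int (j + card M') + 1) a \<and> Y (int (j + card M') + 1) b \<and>
    [:kp (dpoly e\<^sub>v p):] * H = k * [:kp f:] + nab e\<^sub>u a + nab e\<^sub>v b"
  proof (cases "M = 0")
    case True
    then have "dpoly e\<^sub>v p = 0" using HP_dpoly[OF Y_dv.prems(1)] by simp
    then show ?thesis
      by (intro exI[of _ 0]) (simp add: Y_zero small_0 kp_simps)
  next
    case False
    then have "HP (M - 1) (dpoly e\<^sub>v p)" using HP_dpoly[OF Y_dv.prems(1)] by simp
    then show ?thesis
      using Y_dv.prems(2) False by (intro Y_dv.IH) auto
  qed
  then obtain k a b where
    1: "small k" "Y (int (j + card M') + 1) a" "Y (int (j + card M') + 1) b"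
      "[:kp (dpoly e\<^sub>v p):] * H = k * [:kp f:] + nab e\<^sub>u a + nab e\<^sub>v b" by blast
  have "[:kp p:] * nab e\<^sub>v H = (- k) * [:kp f:] + nab e\<^sub>u (- a) + nab e\<^sub>v ([:kp p:] * H - b)"
    using 1(4) unfolding nab_diff nab_minus nab_const_mult dK_kp by (simp add: algebra_simps)
  moreover have "Y (int (j + card M') + 1) ([:kp p:] * H + - b)"
    using Y_dv.prems(2) by (intro Y_add Y_minus 1(3) Y_HP[OF Y_dv.prems(1) Y_dv.hyps]) simp
  moreover have "small (- k)"
    using small_line_mult[OF 1(1), of "- 1" 0] by (simp add: kc_simps)
  ultimately show ?case
    using Y_minus[OF 1(2)] by (metis diff_conv_add_uminus)
qed

text \<open>A primitive \<open>c\<close> of a form that is regular relative to \<open>f' F\<^sup>S\<close> vanishes along every line: the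
  only obstruction is a nonzero constant term where the exponent is a nonnegative integer, and there
  the equation at first order in \<open>t\<close> would force a logarithm.\<close>

lemma primitive_vanishes:
  assumes i: "i \<in> T"
    and c: "c0 \<in> localization f" "c1 \<in> localization f"
    and E0: "dK e\<^sub>u c0 + c0 * coeff (Om e\<^sub>u) 0 = h0"
    and E1: "dK e\<^sub>u c1 + c1 * coeff (Om e\<^sub>u) 0 + c0 * coeff (Om e\<^sub>u) (Suc 0) = h1"
    and h0: "ord_ge (\<alpha> i) (int (mult_in M' i)) h0"
    and reg: "\<And>\<nu>. \<kappa> i = - of_int \<nu> \<Longrightarrow> \<nu> \<le> int (mult_in M' i) \<Longrightarrow>
      ord_ge (\<alpha> i) \<nu> c0 \<and> ord_ge (\<alpha> i) \<nu> h1"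
  shows "ord_ge (\<alpha> i) (int (mult_in M' i) + 1) c0"
proof -
  note a = \<alpha>_nz[of i]
  note tr = transversal[of i]
  let ?l = "kp (L i)" and ?t = "bil (\<alpha> i) e\<^sub>u" and ?m = "int (mult_in M' i)"
  obtain r where r: "ord_ge (\<alpha> i) 0 r" "coeff (Om e\<^sub>u) 0 = kc (\<kappa> i) * kc ?t / ?l + r"
    using Om_split[OF i] .
  obtain r1 where r1: "ord_ge (\<alpha> i) 0 r1"
    "coeff (Om e\<^sub>u) (Suc 0) = kc (of_nat (mult_in UNIV i)) * kc ?t / ?l + r1"
    using Om_split_1[OF i] .
  note E0 = E0[unfolded r(2)] and E1 = E1[unfolded r(2)]
  have D0: "ord_ge (\<alpha> i) ((?m + 1) - 1) (dK e\<^sub>u c0 + c0 * (kc (\<kappa> i) * kc ?t / ?l + r))"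
    using h0 unfolding E0 by simp
  show ?thesis
  proof (cases "\<exists>\<nu>. \<kappa> i = - of_int \<nu> \<and> \<nu> \<le> ?m")
    \<comment> \<open>No resonant order up to that of the right side: the order of \<open>c0\<close>
      rises from an arbitrary starting value.\<close>
    case False
    obtain z where z: "ord_ge (\<alpha> i) z c0"
      using localization_ord[OF i c(1)] by blast
    have "of_int y + \<kappa> i \<noteq> 0" if "y < ?m + 1" for y
      using False that by (auto simp: add_eq_0_iff)
    then show ?thesis
      using twisted_raise_to[OF a z r(1) D0 _ tr] by blast
  next
    case True
    then obtain \<nu> where \<nu>: "\<kappa> i = - of_int \<nu>" "\<nu> \<le> ?m" by blast
    then have reg: "ord_ge (\<alpha> i) \<nu> c0" "ord_ge (\<alpha> i) \<nu> h1"
      using reg by auto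
    have nz: "of_int y + \<kappa> i \<noteq> 0" if "y \<noteq> \<nu>" for y
      using that \<nu> by simp
    define c where "c = of_nat (mult_in UNIV i) * ?t"
    have "{m \<in> UNIV. rp m = i} \<noteq> {}"
      using i by auto
    then have "c \<noteq> 0"
      using tr by (simp add: c_def)
    have Om1: "c0 * coeff (Om e\<^sub>u) (Suc 0) = kc c * (c0 * inverse ?l) + c0 * r1"
      by (simp add: r1(2) c_def kc_simps algebra_simps divide_inverse)
    have "ord_ge (\<alpha> i) (\<nu> + - 1) (c0 * inverse ?l)"
      using ord_ge_mult[OF a reg(1) ord_ge_pow[OF a, of "- 1"]] by simp
    then have "ord_ge (\<alpha> i) (\<nu> - 1) (c0 * coeff (Om e\<^sub>u) (Suc 0))"
      unfolding Om1 using ord_ge_mono[OF a ord_ge_mult[OF a reg(1) r1(1)]]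
      by (intro ord_ge_add a ord_ge_kc_mult) auto
    then have "ord_ge (\<alpha> i) (\<nu> - 1) (h1 - c0 * coeff (Om e\<^sub>u) (Suc 0))"
      using ord_ge_mono[OF a reg(2)] by (intro ord_ge_diff a) auto
    then have D1: "ord_ge (\<alpha> i) (\<nu> - 1) (dK e\<^sub>u c1 + c1 * (kc (\<kappa> i) * kc ?t / ?l + r))"
      using E1 by (simp add: eq_diff_eq[symmetric])
    obtain z where z: "ord_ge (\<alpha> i) z c1"
      using localization_ord[OF i c(2)] by blast
    \<comment> \<open>At first order in \<open>t\<close> the source has order at least
      \<open>\<nu> - 1\<close> and no order below \<open>\<nu>\<close> is resonant, so
      \<open>c1\<close> reaches order \<open>\<nu>\<close>. There its derivative has no polar term,
      hence the polar term of \<open>c0 * coeff (Om e\<^sub>u) (Suc 0)\<close> must vanish as well.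
      Its residue \<open>c\<close> is the nonzero multiplicity times the slope, so \<open>c0\<close>
      passes the resonant order and can then be raised to the end.\<close>
    have c1: "ord_ge (\<alpha> i) \<nu> c1"
      by (rule twisted_raise_to[OF a z r(1) D1 _ tr]) (use nz in auto)
    have "ord_ge (\<alpha> i) \<nu> (dK e\<^sub>u c1 + c1 * (kc (\<kappa> i) * kc ?t / ?l + r))"
      using \<nu> by (intro twisted_keep[OF a c1 r(1)]) simp
    then have "ord_ge (\<alpha> i) \<nu> (h1 - (dK e\<^sub>u c1 + c1 * (kc (\<kappa> i) * kc ?t / ?l + r)))"
      using reg(2) by (intro ord_ge_diff a)
    moreover have "h1 - (dK e\<^sub>u c1 + c1 * (kc (\<kappa> i) * kc ?t / ?l + r)) = c0 * coeff (Om e\<^sub>u) (Suc 0)"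
      unfolding E1[symmetric] by simp
    ultimately have "ord_ge (\<alpha> i) \<nu> (c0 * coeff (Om e\<^sub>u) (Suc 0))"
      by (simp only:)
    then have "ord_ge (\<alpha> i) \<nu> (c0 * coeff (Om e\<^sub>u) (Suc 0) - c0 * r1)"
      using ord_ge_mult[OF a reg(1) r1(1)] by (intro ord_ge_diff a) auto
    then have "ord_ge (\<alpha> i) (\<nu> + 1) (kc c * (c0 * inverse ?l) * (kc (1 / c) * ?l powi 1))"
      unfolding Om1 by (intro ord_ge_mult[OF a _ ord_ge_kc_mult[OF a ord_ge_pow[OF a]]]) simp
    moreover have "kc c * (c0 * inverse ?l) * (kc (1 / c) * ?l powi 1) =
        kc (c * (1 / c)) * (c0 * (inverse ?l * ?l))"
      by (simp only: kc_simps power_int_1_right mult_ac)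
    then have "kc c * (c0 * inverse ?l) * (kc (1 / c) * ?l powi 1) = c0"
      using \<open>c \<noteq> 0\<close> a by (simp add: kc_simps)
    ultimately have "ord_ge (\<alpha> i) (\<nu> + 1) c0"
      by (simp only:)
    then show ?thesis
      by (rule twisted_raise_to[OF a _ r(1) D0 _ tr]) (use nz in auto)
  qed
qed

text \<open>All poles lie along the lines, so the prescribed orders cancel the denominator
  completely. The order in excess of that of \<open>f'\<close> contributes each line once.\<close>

lemma polynomial_primitive:
  assumes "x \<in> localization f" "\<And>i. i \<in> T \<Longrightarrow> ord_ge (\<alpha> i) (int (mult_in M' i) + 1) x"
  shows "\<exists>R. x = kp (R * (\<Prod>i\<in>T. L i) * f')"
proof -
  obtain p k where x: "x = Fract p (f ^ k)"
    using assms by (auto simp: localization_def)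
  have p: "kp p = x * kp (f ^ k)"
    using f_nz by (simp add: x Fract_kp)
  have "L i ^ (k * mult_in UNIV i + mult_in M' i + 1) dvd p" if i: "i \<in> T" for i
  proof -
    have "L i ^ mult_in UNIV i dvd f"
      using ord_ge_prod_L[OF i, of UNIV] by (simp add: ord_ge_kp_iff \<alpha>_nz)
    then have "L i ^ (k * mult_in UNIV i) dvd f ^ k"
      unfolding mult.commute[of k] power_mult by (rule dvd_power_same)
    then have "ord_ge (\<alpha> i) (int (k * mult_in UNIV i)) (kp (f ^ k))"
      unfolding ord_ge_kp_iff[OF \<alpha>_nz] .
    then have "ord_ge (\<alpha> i) (int (mult_in M' i) + 1 + int (k * mult_in UNIV i)) (kp p)"
      unfolding p by (rule ord_ge_mult[OF \<alpha>_nz assms(2)[OF i]])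
    then have "ord_ge (\<alpha> i) (int (k * mult_in UNIV i + mult_in M' i + 1)) (kp p)"
      by (simp add: algebra_simps)
    then show ?thesis
      unfolding ord_ge_kp_iff[OF \<alpha>_nz] .
  qed
  then have "(\<Prod>i\<in>T. L i ^ (k * mult_in UNIV i + mult_in M' i + 1)) dvd p"
    by (intro lines_dvd) auto
  moreover have "(\<Prod>i\<in>T. L i ^ (k * mult_in UNIV i + mult_in M' i + 1)) =
      (\<Prod>i\<in>T. L i ^ mult_in UNIV i) ^ k * (\<Prod>i\<in>T. L i ^ mult_in M' i) * (\<Prod>i\<in>T. L i)"
  proof -
    have "L i ^ (k * mult_in UNIV i + mult_in M' i + 1) = (L i ^ mult_in UNIV i) ^ k * L i ^ mult_in M' i * L i" for i
      unfolding power_add mult.commute[of k] power_mult by simp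
    then show ?thesis
      by (simp only: prod.distrib prod_power_distrib)
  qed
  ultimately have "(\<Prod>i\<in>T. L i ^ mult_in UNIV i) ^ k * (\<Prod>i\<in>T. L i ^ mult_in M' i) * (\<Prod>i\<in>T. L i) dvd p"
    by (simp only:)
  then obtain s where s: "p = (\<Prod>i\<in>T. L i ^ mult_in UNIV i) ^ k * (\<Prod>i\<in>T. L i ^ mult_in M' i) * (\<Prod>i\<in>T. L i) * s"
    by (elim dvdE)
  define C where "C = (\<Prod>m\<in>UNIV. cf m) ^ k * (c' * (\<Prod>m\<in>M'. cf m))"
  have C: "Const C * Const (1 / C) = 1"
    using c'_nz cf_nz by (simp add: C_def Const_mult[symmetric] del: Const_mult)
  have "f ^ k * f' = Const C * ((\<Prod>i\<in>T. L i ^ mult_in UNIV i) ^ k * (\<Prod>i\<in>T. L i ^ mult_in M' i))"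
    unfolding f'_eq prod_lines by (simp add: C_def Const_mult is_homD[OF is_hom_Const] power_mult_distrib mult_ac)
  then have "f ^ k * f' * Const (1 / C) * (\<Prod>i\<in>T. L i) * s = p * (Const C * Const (1 / C))"
    by (simp only: s mult_ac)
  then have "kp p = kp (Const (1 / C) * s * (\<Prod>i\<in>T. L i) * f') * kp (f ^ k)"
    unfolding C kp_simps(4)[symmetric] by (simp add: mult_ac)
  then show ?thesis
    using f_nz unfolding x Fract_kp by (intro exI[of _ "Const (1 / C) * s"]) (simp add: field_simps)
qed

lemma dP_emb_S: "dP w (Dm (emb_S b)) = 0"
proof (induction b rule: mpoly_induct)
  case (Const c)
  then show ?case by (simp flip: kc_def)
qed (simp_all add: emb_S_simps Dm_simps dP_add dP_mult)

text \<open>The exponents of f' F^\<sigma> along the lines add up to its degree; this is the value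
  of the sum of the \<open>\<beta> i\<close> in \<open>log_op_dimension\<close>.\<close>

lemma sum_kappa: "(\<Sum>i\<in>T. \<kappa> i + of_nat (mult_in M' i)) = - 2 - of_nat j"
proof -
  have "(\<Sum>i\<in>T. \<kappa> i) = (\<Sum>m\<in>UNIV. \<sigma> $ \<phi> m)"
    using sum_lines[of "\<lambda>_. 1" "\<lambda>m. \<sigma> $ \<phi> m" UNIV] by (simp add: \<kappa>_def)
  then show ?thesis
    using card_lines[of M'] by (simp add: sum.distrib \<sigma>_sum flip: of_nat_sum)
qed

text \<open>The 1-form \<open>(a dv - b' du) F^S\<close> has differential \<open>G F^S du dv\<close>
  and degree zero at \<open>t = 0\<close>. By Cartan's formula its contraction with the Euler field,
  which is \<open>- c\<close>, has differential minus the contraction of \<open>G F^S du dv\<close>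
  at order zero. Comparing the \<open>du\<close> components and dividing by \<open>f'\<close> gives
  the relation.\<close>

lemma center_relation:
  assumes P: "P \<in> weyl_action F" "emb_S b * emb_x f' = P (emb_x f)" and p: "HP j p"
  shows "\<exists>k R. (on_line e\<^sub>v e\<^sub>u k = 0 \<or> degree (on_line e\<^sub>v e\<^sub>u k) + n \<le> j) \<and>
    dpoly e\<^sub>u (R * (\<Prod>i\<in>T. L i)) + R * (\<Sum>i\<in>T. Const ((\<kappa> i + of_nat (mult_in M' i)) * bil (\<alpha> i) e\<^sub>u) * (\<Prod>k\<in>T - {i}. L k)) =
      - v * (Const (ev \<sigma> b) * p - k * g)"
proof -
  define B where "B = Dm (emb_S b)"
  obtain b1 where B: "coeff B 0 = kc (ev \<sigma> b)" "coeff B (Suc 0) = kc b1"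
    using Dm_emb_S[of b] by (auto simp: B_def)
  define X where "X = B * [:kp f':]"
  have X: "X = Dm (P (emb_x f))"
    by (simp add: X_def B_def Dm_simps P(2)[symmetric] del: mult_pCons_right)
  have "Y_span X"
    unfolding X by (rule Y_span_weyl[OF P(1)]) (use Y_in_span[OF Y_base] in simp)
  moreover have "Euler X = ([:kc (of_int (int (card M'))):] + S_sum) * X"
  proof -
    have "X = (B * [:kc c':]) * [:kp (\<Prod>m\<in>M'. L m):]"
      by (simp add: X_def f'_eq kp_simps kc_def mult.commute)
    moreover have "dP w (B * [:kc c':]) = 0" for w
      unfolding dP_mult by (simp add: B_def dP_emb_S)
    then have "Euler ((B * [:kc c':]) * [:kp (\<Prod>m\<in>M'. L m):]) = (B * [:kc c':]) * Euler [:kp (\<Prod>m\<in>M'. L m):]"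
      by (intro Euler_mult_const)
    ultimately show ?thesis
      unfolding Euler_prod_L by (simp only: mult_ac of_int_of_nat_eq)
  qed
  ultimately have "Y (int (card M')) X"
    by (rule Y_span_eigen)
  then obtain k a b' where k: "small k" and a: "Y (int (j + card M') + 1) a" and b': "Y (int (j + card M') + 1) b'"
    and eq: "[:kp p:] * X = k * [:kp f:] + nab e\<^sub>u a + nab e\<^sub>v b'"
    using integrate_by_parts[OF _ p, of "int (card M')" X] by auto
  obtain k0 k1 where k01: "coeff k 0 = kp k0" "coeff k (Suc 0) = kp k1"
    and deg: "on_line e\<^sub>v e\<^sub>u k0 = 0 \<or> degree (on_line e\<^sub>v e\<^sub>u k0) + n \<le> j"
    using k by (auto simp: small_def)
  define G where "G = nab e\<^sub>u a + nab e\<^sub>v b'"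
  have G: "G = [:kp p:] * X - k * [:kp f:]"
    by (simp only: eq G_def) simp
  define x0 where "x0 = Const (ev \<sigma> b) * p - k0 * g"
  define x1 where "x1 = Const b1 * p - k1 * g"
  have f: "kp f = kp g * kp f'"
    by (simp only: g_eq kp_simps)
  have G01: "coeff G 0 = kp f' * kp x0" "coeff G (Suc 0) = kp f' * kp x1"
    unfolding G X_def x0_def x1_def f using B k01 by (simp_all add: kp_simps kc_def algebra_simps)
  define c where "c = [:kp u:] * b' - [:kp v:] * a"
  define E where "E = [:kc (of_int (int (j + card M') + 1)):] + S_sum"
  have Eb': "[:kp u:] * nab e\<^sub>u b' + [:kp v:] * nab e\<^sub>v b' = E * b'"
    using Y_Euler[OF b'] unfolding Euler_def E_def .
  have "nab e\<^sub>u c = b' + [:kp u:] * nab e\<^sub>u b' - [:kp v:] * nab e\<^sub>u a"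
    unfolding c_def nab_diff nab_kp_mult by (simp add: kc_simps)
  also have "\<dots> = b' + (E * b' - [:kp v:] * nab e\<^sub>v b') - [:kp v:] * nab e\<^sub>u a"
    unfolding Eb'[symmetric] by simp
  also have "\<dots> = (1 + E) * b' - [:kp v:] * G"
    unfolding G_def by (simp only: algebra_simps mult_1_left)
  finally have nab_c: "nab e\<^sub>u c = (1 + E) * b' - [:kp v:] * G" .
  \<comment> \<open>The degree of b' F^\<sigma> is -1, so \<open>1 + E\<close> starts at order one
    in \<open>t\<close>, with the number of factors as coefficient. Thus \<open>b'\<close> drops out
    at order zero and enters \<open>h1\<close> by its constant term.\<close>
  have "1 + (of_int (int (j + card M') + 1) + (\<Sum>m\<in>UNIV. \<sigma> $ \<phi> m)) = 0"
    by (simp add: \<sigma>_sum)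
  then have "kc 1 + (kc (of_int (int (j + card M') + 1)) + kc (\<Sum>m\<in>UNIV. \<sigma> $ \<phi> m)) = kc 0"
    unfolding kc_simps(3)[symmetric] by simp
  then have E01: "coeff (1 + E) 0 = 0" "coeff (1 + E) (Suc 0) = kc (of_nat CARD('d))"
    by (simp_all add: E_def kc_simps)
  define h0 where "h0 = - kp v * (kp f' * kp x0)"
  define h1 where "h1 = kc (of_nat CARD('d)) * coeff b' 0 - kp v * (kp f' * kp x1)"
  have nab_c0: "dK e\<^sub>u (coeff c 0) + coeff c 0 * coeff (Om e\<^sub>u) 0 = h0"
    using arg_cong[OF nab_c, of "\<lambda>q. coeff q 0"] unfolding coeff_nab
    by (simp only: coeff_diff coeff_mult_0' E01 G01 coeff_pCons_0) (simp add: h0_def)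
  have "coeff ([:kp v:] * G) (Suc 0) = kp v * (kp f' * kp x1)"
    by (simp add: G01)
  then have nab_c1: "dK e\<^sub>u (coeff c (Suc 0)) + coeff c (Suc 0) * coeff (Om e\<^sub>u) 0 + coeff c 0 * coeff (Om e\<^sub>u) (Suc 0) = h1"
    using arg_cong[OF nab_c, of "\<lambda>q. coeff q (Suc 0)"] coeff_mult_1[of "1 + E" b'] unfolding coeff_nab
    by (simp only: coeff_diff E01 One_nat_def h1_def) simp
  have loc: "coeff c r \<in> localization f" for r
  proof -
    have "coeff c r = kp u * coeff b' r + kp (- v) * coeff a r"
      by (simp add: c_def kp_simps)
    then show ?thesis
      by (simp add: localization_add[OF f_nz] localization_mult Y_localization[OF a] Y_localization[OF b']
          kp_def localization_Fract_1 del: minus_fract)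
  qed
  have f'_ord: "ord_ge (\<alpha> i) (int (mult_in M' i)) (kp f')" if "i \<in> T" for i
    unfolding f'_eq kp_simps(4) by (intro ord_ge_kp_mult \<alpha>_nz ord_ge_prod_L that)
  have "ord_ge (\<alpha> i) (int (mult_in M' i) + 1) (coeff c 0)" if i: "i \<in> T" for i
  proof (rule primitive_vanishes[OF i loc loc nab_c0 nab_c1])
    have "h0 = kp (- v * x0) * kp f'" by (simp add: h0_def kp_simps)
    then show "ord_ge (\<alpha> i) (int (mult_in M' i)) h0"
      using ord_ge_kp_mult[OF \<alpha>_nz f'_ord[OF i]] by metis
    fix \<nu> assume \<nu>: "\<kappa> i = - of_int \<nu>" "\<nu> \<le> int (mult_in M' i)"
    have "mult_in M' i \<le> mult_in UNIV i"
      by (intro card_mono) auto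
    then have \<nu>': "\<nu> \<le> int (mult_in UNIV i)"
      using \<nu>(2) by linarith
    note ab = Y_regular[OF a i \<nu>(1) \<nu>'] Y_regular[OF b' i \<nu>(1) \<nu>']
    have "ord_ge (\<alpha> i) \<nu> (kp u * coeff b' 0 - kp v * coeff a 0)"
      by (intro ord_ge_diff ord_ge_kp_mult \<alpha>_nz ab)
    moreover have "kp v * (kp f' * kp x1) = kp (v * x1) * kp f'"
      by (simp add: kp_simps)
    then have "ord_ge (\<alpha> i) \<nu> h1"
      unfolding h1_def using ord_ge_mono[OF \<alpha>_nz f'_ord[OF i] \<nu>(2)]
      by (simp only:) (intro ord_ge_diff ord_ge_kp_mult ord_ge_kc_mult \<alpha>_nz ab)
    ultimately show "ord_ge (\<alpha> i) \<nu> (coeff c 0) \<and> ord_ge (\<alpha> i) \<nu> h1"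
      by (simp add: c_def)
  qed
  then obtain R where R: "coeff c 0 = kp (R * (\<Prod>i\<in>T. L i) * f')"
    using polynomial_primitive[OF loc] by blast
  define Q where "Q = (\<Prod>i\<in>T. L i)"
  define t where "t = (\<lambda>i. kc (bil (\<alpha> i) e\<^sub>u) / kp (L i))"
  have dlog_f': "dK e\<^sub>u (kp f') = kp f' * (\<Sum>m\<in>M'. kc (bil (\<alpha> m) e\<^sub>u) / kp (L m) * kc 1)"
  proof -
    have "dK e\<^sub>u (kp (\<Prod>m\<in>M'. L m)) = kp (\<Prod>m\<in>M'. L m) * (\<Sum>m\<in>M'. kc (bil (\<alpha> m) e\<^sub>u) / kp (L m))"
      unfolding kp_simps by (subst dK_log_prod) (simp_all add: \<alpha>_nz kc_def)
    then show ?thesis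
      unfolding f'_eq kp_simps(4) dK_mult by (simp add: kp_simps kc_simps)
  qed
  \<comment> \<open>Dividing by \<open>f'\<close> shifts the exponent of each line by its
    multiplicity in \<open>f'\<close>.\<close>
  have "(\<Sum>m\<in>M'. kc (bil (\<alpha> m) e\<^sub>u) / kp (L m) * kc 1) + coeff (Om e\<^sub>u) 0 =
      (\<Sum>i\<in>T. t i * kc (\<kappa> i + of_nat (mult_in M' i)))"
    unfolding coeff_Om by (subst (1 2) sum_log_terms)
      (simp add: t_def \<kappa>_def kc_simps distrib_left sum.distrib add.commute)
  moreover have "kp (R * Q) * (t i * kc x) = kp (R * (Const (x * bil (\<alpha> i) e\<^sub>u) * (\<Prod>k\<in>T - {i}. L k)))"
    if "i \<in> T" for i x
  proof -
    have *: "kp Q * t i = kp (Const (bil (\<alpha> i) e\<^sub>u) * (\<Prod>k\<in>T - {i}. L k))"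
      using that \<alpha>_nz[of i] by (simp add: Q_def prod.remove[of T i] t_def kp_simps kc_def)
    have "kp (R * Q) * (t i * kc x) = kp R * (kp Q * t i) * kp (Const x)"
      by (simp only: kp_simps(4) kc_def mult_ac)
    then show ?thesis
      unfolding * by (simp only: kp_simps(4)[symmetric] Const_mult mult_ac)
  qed
  then have "kp (R * Q) * (\<Sum>i\<in>T. t i * kc (\<kappa> i + of_nat (mult_in M' i))) =
      kp (R * (\<Sum>i\<in>T. Const ((\<kappa> i + of_nat (mult_in M' i)) * bil (\<alpha> i) e\<^sub>u) * (\<Prod>k\<in>T - {i}. L k)))"
    unfolding sum_distrib_left kp_simps(8) by (intro sum.cong refl) blast
  ultimately have "dK e\<^sub>u (kp (R * Q)) * kp f' + kp f' * kp (R * (\<Sum>i\<in>T. Const ((\<kappa> i + of_nat (mult_in M' i)) * bil (\<alpha> i) e\<^sub>u) * (\<Prod>k\<in>T - {i}. L k))) =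
     dK e\<^sub>u (kp (R * Q)) * kp f' + kp f' * (kp (R * Q) * ((\<Sum>m\<in>M'. kc (bil (\<alpha> m) e\<^sub>u) / kp (L m) * kc 1) + coeff (Om e\<^sub>u) 0))"
    by (simp only:)
  also have "\<dots> = dK e\<^sub>u (coeff c 0) + coeff c 0 * coeff (Om e\<^sub>u) 0"
    unfolding R Q_def[symmetric] kp_simps(4)[of _ f'] dK_mult dlog_f' by (simp add: algebra_simps)
  also have "\<dots> = - kp v * (kp f' * kp x0)"
    unfolding nab_c0 h0_def ..
  finally have "kp f' * kp (dpoly e\<^sub>u (R * Q) + R * (\<Sum>i\<in>T. Const ((\<kappa> i + of_nat (mult_in M' i)) * bil (\<alpha> i) e\<^sub>u) * (\<Prod>k\<in>T - {i}. L k))) =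
      kp f' * kp (- v * x0)"
    unfolding dK_kp
    by (simp only: kp_simps(3,4,5) distrib_left mult_minus_left mult_minus_right mult_ac)
  moreover have "f' \<noteq> 0"
    using f_nz unfolding g_eq by simp
  ultimately have "dpoly e\<^sub>u (R * Q) + R * (\<Sum>i\<in>T. Const ((\<kappa> i + of_nat (mult_in M' i)) * bil (\<alpha> i) e\<^sub>u) * (\<Prod>k\<in>T - {i}. L k)) = - v * x0"
    by simp
  with deg show ?thesis
    unfolding Q_def x0_def by blast
qed

text \<open>If \<open>b\<close> were nonzero at \<sigma>, one could divide by its value. On
  \<open>u = t\<close>, \<open>v = 1\<close> the forms \<open>u ^ i * v ^ (j - i)\<close> become the
  monomials of degree at most \<open>j\<close>, and \<open>center_relation\<close> becomes the
  decomposition that \<open>log_op_dimension\<close> excludes.\<close>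

theorem center_vanishes:
  assumes P: "P \<in> weyl_action F" "emb_S b * emb_x f' = P (emb_x f)"
    and "card T \<ge> 3" "n \<ge> 1" "j + 4 \<le> n + card T"
  shows "ev \<sigma> b = 0"
proof (rule ccontr)
  assume B: "ev \<sigma> b \<noteq> 0"
  let ?o = "on_line e\<^sub>v e\<^sub>u"
  let ?a = "\<lambda>i. bil (\<alpha> i) e\<^sub>u" and ?b = "\<lambda>i. bil (\<alpha> i) e\<^sub>v" and ?\<beta> = "\<lambda>i. \<kappa> i + of_nat (mult_in M' i)"
  have "f' \<noteq> 0"
    using f_nz unfolding g_eq by simp
  have "f = (\<Prod>m\<in>- M'. L m) * (\<Prod>m\<in>M'. L m)"
    by (subst prod.union_disjoint[symmetric]) (auto simp: Compl_partition2)
  moreover have "Const (1 / c') * (\<Prod>m\<in>- M'. L m) * f' =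
      (Const (1 / c') * Const c') * ((\<Prod>m\<in>- M'. L m) * (\<Prod>m\<in>M'. L m))"
    unfolding f'_eq by (simp only: mult_ac)
  moreover have "Const (1 / c') * Const c' = (1 :: ('n, complex) mpoly)"
    using c'_nz by (simp flip: Const_mult)
  ultimately have "g * f' = Const (1 / c') * (\<Prod>m\<in>- M'. L m) * f'"
    unfolding g_eq[symmetric] by (simp only: mult_1_left)
  then have g: "g = Const (1 / c') * (\<Prod>m\<in>- M'. L m)"
    using \<open>f' \<noteq> 0\<close> by simp
  \<comment> \<open>Transversality of \<open>e\<^sub>u\<close> gives every restricted form a nonzero
    leading coefficient, so the degree of \<open>g\<close> does not drop.\<close>
  define q where "q = (\<Prod>m\<in>- M'. [:?b m, ?a m:])"
  have q: "degree q \<le> n" "coeff q n \<noteq> 0"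
    using prod_linear_top[of "- M'" "\<lambda>m. [:?b m, ?a m:]"] transversal by (simp_all add: q_def n_def)
  have "?o g = smult (1 / c') q"
    by (simp add: g on_line_simps q_def)
  then have deg_g: "degree (?o g) = n"
    using q c'_nz le_degree[of q n] by simp
  have dec: "\<exists>k R. (k = 0 \<or> degree k + n \<le> j) \<and> monom 1 i = ?o g * k + log_op T ?a ?b ?\<beta> R" if i: "i \<le> j" for i
  proof -
    have "HP j (u ^ i * v ^ (j - i))"
      using HP_monom[of i "j - i"] i by simp
    then obtain k R where k: "?o k = 0 \<or> degree (?o k) + n \<le> j" and eq:
      "dpoly e\<^sub>u (R * (\<Prod>i\<in>T. L i)) + R * (\<Sum>i\<in>T. Const (?\<beta> i * ?a i) * (\<Prod>k\<in>T - {i}. L k)) =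
        - v * (Const (ev \<sigma> b) * (u ^ i * v ^ (j - i)) - k * g)"
      using center_relation[OF P] by blast
    have "?o (u ^ i * v ^ (j - i)) = monom 1 i"
      by (simp add: on_line_simps monom_altdef flip: one_pCons)
    moreover have "?o (- v) = - 1"
      by (simp add: on_line_simps one_pCons)
    moreover have "log_op T ?a ?b ?\<beta> (?o R) = ?o (dpoly e\<^sub>u (R * (\<Prod>i\<in>T. L i)) +
        R * (\<Sum>i\<in>T. Const (?\<beta> i * ?a i) * (\<Prod>k\<in>T - {i}. L k)))"
      unfolding log_op_def on_line_simps(3) pderiv_on_line[symmetric] by (simp add: on_line_simps)
    ultimately have "log_op T ?a ?b ?\<beta> (?o R) = ?o k * ?o g - smult (ev \<sigma> b) (monom 1 i)"
      unfolding eq by (simp add: on_line_simps)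
    then have "monom 1 i = smult (1 / ev \<sigma> b) (?o k * ?o g) - smult (1 / ev \<sigma> b) (log_op T ?a ?b ?\<beta> (?o R))"
      using B by (simp add: smult_diff_right)
    then have "monom 1 i = ?o g * smult (1 / ev \<sigma> b) (?o k) + log_op T ?a ?b ?\<beta> (smult (- 1 / ev \<sigma> b) (?o R))"
      unfolding log_op_smult by (simp add: mult.commute)
    moreover have "smult (1 / ev \<sigma> b) (?o k) = 0 \<or> degree (smult (1 / ev \<sigma> b) (?o k)) + n \<le> j"
      using k B by simp
    ultimately show ?thesis by blast
  qed
  show False
    by (rule log_op_dimension[OF _ assms(3) transversal sum_kappa deg_g assms(4,5) dec]) simp_all
qed

end

section \<open>The hyperplanes: necessity\<close>

context lines_sigma
begin

text \<open>The order condition is stable because \<open>k\<close> is the resonant order of the line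
  \<open>i\<close>. The bounds on \<open>k\<close> put \<open>f\<close> inside the submodule and
  \<open>f'\<close> outside it.\<close>

theorem line_vanishes:
  assumes P: "P \<in> weyl_action F" "emb_S b * emb_x f' = P (emb_x f)"
    and f': "f' = Const c' * (\<Prod>m\<in>M'. L m)" "c' \<noteq> 0"
    and i: "i \<in> T" "\<kappa> i = - of_nat k" "mult_in M' i < k" "k \<le> mult_in UNIV i"
  shows "ev \<sigma> b = 0"
proof (rule ccontr)
  assume B: "ev \<sigma> b \<noteq> 0"
  have nab: "ord_ge (\<alpha> i) (int k) (coeff (nab w H) 0)" if "ord_ge (\<alpha> i) (int k) (coeff H 0)" for w H
  proof -
    obtain r where r: "ord_ge (\<alpha> i) 0 r" "coeff (Om w) 0 = kc (\<kappa> i) * kc (bil (\<alpha> i) w) / kp (L i) + r"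
      using Om_split[OF i(1)] .
    show ?thesis
      unfolding coeff_nab r(2) using i(2) by (intro twisted_keep \<alpha>_nz that r(1)) simp
  qed
  have "Dm (P (emb_x f)) \<in> {H. ord_ge (\<alpha> i) (int k) (coeff H 0)}"
  proof (rule weyl_transfer[OF P(1)])
    have "ord_ge (\<alpha> i) (int k) (kp f)"
      using i(4) by (intro ord_ge_mono[OF \<alpha>_nz ord_ge_prod_L[OF i(1), of UNIV]]) simp
    then show "Dm (emb_x f) \<in> {H. ord_ge (\<alpha> i) (int k) (coeff H 0)}"
      by simp
  qed (simp_all add: ord_ge_add \<alpha>_nz ord_ge_kc_mult ord_ge_kp_mult nab)
  moreover have "coeff (Dm (P (emb_x f))) 0 = kc (ev \<sigma> b) * kp f'"
    unfolding P(2)[symmetric] using Dm_emb_S[of b] by (simp add: Dm_simps mult.commute)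
  ultimately have "ord_ge (\<alpha> i) (int k) (kc (1 / ev \<sigma> b) * (kc (ev \<sigma> b) * kp f'))"
    using ord_ge_kc_mult[OF \<alpha>_nz] by simp
  moreover have "kc (1 / ev \<sigma> b) * (kc (ev \<sigma> b) * kp f') = kp f'"
    using B by (simp add: mult.assoc[symmetric] kc_simps(4)[symmetric]) (simp add: kc_simps)
  ultimately have "ord_ge (\<alpha> i) (int k) (kp f')"
    by (simp only:)
  then have "L i ^ k dvd f'"
    by (simp add: ord_ge_kp_iff \<alpha>_nz)
  then show False
    using mult_in_exact[OF i(1), of k c' M'] f' i(3) by simp
qed

end

section \<open>Sufficiency\<close>

context arr_lines
begin

section \<open>The module generated by \<open>f F^S\<close> and the hyperplane factors\<close>

definition U :: "('n, 'r) FS set" where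
  "U = {P (emb_x f) | P. P \<in> weyl_action F}"

lemma U_base: "emb_x f \<in> U"
proof -
  have "emb_x f = (\<lambda>h. emb_x (Const 1) * h) (emb_x f)"
    by (simp add: emb_x_simps)
  with weyl_action.scalar[of 1 F] show ?thesis
    unfolding U_def by blast
qed

lemma U_add: "h \<in> U \<Longrightarrow> h' \<in> U \<Longrightarrow> h + h' \<in> U"
proof -
  assume "h \<in> U" "h' \<in> U"
  then obtain P Q where "P \<in> weyl_action F" "h = P (emb_x f)" "Q \<in> weyl_action F" "h' = Q (emb_x f)"
    by (auto simp: U_def)
  then show ?thesis
    unfolding U_def using weyl_action.add[of P F Q] by (auto intro!: exI[of _ "\<lambda>h. P h + Q h"])
qed

lemma U_comp: "P \<in> weyl_action F \<Longrightarrow> h \<in> U \<Longrightarrow> P h \<in> U"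
proof -
  assume P: "P \<in> weyl_action F" and "h \<in> U"
  then obtain Q where "Q \<in> weyl_action F" "h = Q (emb_x f)"
    by (auto simp: U_def)
  then show ?thesis
    unfolding U_def using weyl_action.comp[OF P, of Q] by (auto intro!: exI[of _ "\<lambda>h. P (Q h)"])
qed

lemma U_emb_x: "h \<in> U \<Longrightarrow> emb_x p * h \<in> U"
proof (induction p arbitrary: h rule: mpoly_induct)
  case (Const c)
  then show ?case using U_comp[OF weyl_action.scalar] by blast
next
  case (Var i)
  then show ?case using U_comp[OF weyl_action.mult_x] by blast
qed (simp_all add: emb_x_simps distrib_right U_add mult.assoc)

lemma U_emb_S: "h \<in> U \<Longrightarrow> emb_S p * h \<in> U"
proof (induction p arbitrary: h rule: mpoly_induct)
  case (Const c)
  then show ?case by (simp add: U_emb_x)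
next
  case (Var i)
  then show ?case using U_comp[OF weyl_action.mult_s] by blast
qed (simp_all add: emb_S_simps distrib_right U_add mult.assoc)

lemma U_zero: "0 \<in> U"
  using U_emb_x[OF U_base, of 0] by (simp add: emb_x_simps)

lemma U_sum: "(\<And>x. x \<in> A \<Longrightarrow> g x \<in> U) \<Longrightarrow> sum g A \<in> U"
  by (induction A rule: infinite_finite_induct) (auto simp: U_zero U_add)

lemma U_diff: "h \<in> U \<Longrightarrow> h' \<in> U \<Longrightarrow> h - h' \<in> U"
  using U_add[of h "emb_x (- 1) * h'"] U_emb_x[of h' "- 1"] by (simp add: emb_x_simps)

lemma U_nabF: "h \<in> U \<Longrightarrow> nabF F w h \<in> U"
  unfolding nabF_def by (intro U_sum U_emb_x U_comp[OF weyl_action.partial])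

definition s_line :: "'d \<Rightarrow> ('r, complex) mpoly" where
  "s_line i = (\<Sum>m | rp m = i. Var (\<phi> m))"

text \<open>For each line one factor per multiplicity still missing from \<open>A\<close>. The shift
  in \<open>Suc j\<close> is the codimension of a hyperplane; adjoining an index to \<open>A\<close>
  removes the lowest remaining factor of its line.\<close>

definition b_lines :: "'d set \<Rightarrow> ('r, complex) mpoly" where
  "b_lines A = (\<Prod>i\<in>T. \<Prod>j\<in>{mult_in A i..<mult_in UNIV i}. s_line i + of_nat (Suc j))"

lemma b_lines_UNIV: "b_lines UNIV = 1"
  by (simp add: b_lines_def)

lemma b_lines_insert:
  assumes "m \<notin> A"
  shows "b_lines A = (s_line (rp m) + of_nat (Suc (mult_in A (rp m)))) * b_lines (insert m A)"
proof -
  let ?g = "\<lambda>A i. \<Prod>j\<in>{mult_in A i..<mult_in UNIV i}. s_line i + of_nat (Suc j)"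
  have eq: "{k \<in> insert m A. rp k = i} = (if i = rp m then insert m {k \<in> A. rp k = i} else {k \<in> A. rp k = i})" for i
    by auto
  have 1: "mult_in (insert m A) (rp m) = Suc (mult_in A (rp m))"
    using assms unfolding eq by simp
  have 2: "mult_in (insert m A) i = mult_in A i" if "i \<noteq> rp m" for i
    using that unfolding eq by simp
  have "mult_in (insert m A) (rp m) \<le> mult_in UNIV (rp m)"
    by (intro card_mono) auto
  then have "?g A (rp m) = (s_line (rp m) + of_nat (Suc (mult_in A (rp m)))) * ?g (insert m A) (rp m)"
    unfolding 1 by (intro prod.atLeast_Suc_lessThan) simp
  moreover have 3: "?g A i = ?g (insert m A) i" if "i \<in> T - {rp m}" for i
    using that by (subst 2) auto
  have "(\<Prod>i\<in>T - {rp m}. ?g A i) = (\<Prod>i\<in>T - {rp m}. ?g (insert m A) i)"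
    by (rule prod.cong[OF refl 3])
  ultimately show ?thesis
    unfolding b_lines_def by (simp add: prod.remove[of T "rp m"] mult.assoc)
qed

lemma OmF_lines: "OmF w = (\<Sum>i\<in>T. Const (kc (bil (\<alpha> i) w) / kp (L i)) * emb_S (s_line i))"
proof -
  have "OmF w = (\<Sum>m\<in>UNIV. Const (kc (bil (\<alpha> (rp m)) w) / kp (L (rp m))) * Var (\<phi> m))"
    unfolding OmF_def by (intro sum.cong refl arg_cong2[where f = "(*)"] arg_cong[where f = Const] log_term_rp)
  also have "\<dots> = (\<Sum>i\<in>T. Const (kc (bil (\<alpha> i) w) / kp (L i)) * (\<Sum>m | m \<in> UNIV \<and> rp m = i. Var (\<phi> m)))"
    by (rule sum_lines)
  finally show ?thesis
    by (simp add: s_line_def emb_S_simps)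
qed

lemma emb_S_of_nat: "emb_S (of_nat k) = of_nat k"
  by (simp add: emb_S_Const[of "of_nat k", unfolded Const_of_nat] emb_x_simps)
    (induction k; simp add: emb_x_simps)

lemma nabF_prod_L: "nabF F w (emb_x (\<Prod>m\<in>A. L m)) =
    emb_x (\<Prod>m\<in>A. L m) * (\<Sum>i\<in>T. Const (kc (bil (\<alpha> i) w) / kp (L i)) * emb_S (s_line i + of_nat (mult_in A i)))"
proof -
  have n: "Const (kc (of_nat k)) = (of_nat k :: ('n, 'r) FS)" for k
    by (simp add: kc_of_nat Const_of_nat)
  have "dK w (kp (\<Prod>m\<in>A. L m)) = kp (\<Prod>m\<in>A. L m) * (\<Sum>m\<in>A. kc (bil (\<alpha> m) w) / kp (L m) * kc 1)"
    unfolding kp_simps by (subst dK_log_prod) (simp_all add: \<alpha>_nz kc_def kp_simps)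
  also have "(\<Sum>m\<in>A. kc (bil (\<alpha> m) w) / kp (L m) * kc 1) = (\<Sum>i\<in>T. kc (bil (\<alpha> i) w) / kp (L i) * kc (of_nat (mult_in A i)))"
    by (subst sum_log_terms) simp
  finally have d: "dK w (kp (\<Prod>m\<in>A. L m)) =
      kp (\<Prod>m\<in>A. L m) * (\<Sum>i\<in>T. kc (bil (\<alpha> i) w) / kp (L i) * kc (of_nat (mult_in A i)))" .
  show ?thesis
    unfolding emb_x_kp nabF_Const1 OmF_lines d
    by (simp only: Const_mult Const_sum n emb_S_simps(3) emb_S_of_nat distrib_left sum.distrib add.commute)
qed

text \<open>Leibniz rule along a \<open>w\<close> normalized on the line \<open>i\<close>. The line
  \<open>i\<close> produces the Bernstein-Sato factor; any other line that \<open>w\<close> crosses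
  produces a pole, which the multiplier \<open>y\<close> cancels, with \<open>z k\<close> for the
  quotient of \<open>y\<close> by \<open>L k\<close>. All remainders keep the new factor
  \<open>L i\<close>.\<close>

lemma line_step:
  assumes i: "i \<in> T" and w: "bil (\<alpha> i) w = 1"
    and z: "\<And>k. k \<in> T - {i} \<Longrightarrow> bil (\<alpha> k) w = 0 \<or> y = L k * z k"
  shows "nabF F w (emb_x (y * (L i * (\<Prod>m\<in>A. L m)))) =
    emb_S (s_line i + of_nat (Suc (mult_in A i))) * emb_x (y * (\<Prod>m\<in>A. L m)) +
    emb_x (dpoly w y * (L i * (\<Prod>m\<in>A. L m))) +
    (\<Sum>k\<in>T - {i}. emb_S (s_line k + of_nat (mult_in A k)) *
       emb_x (Const (bil (\<alpha> k) w) * z k * (L i * (\<Prod>m\<in>A. L m))))"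
proof -
  let ?P = "\<Prod>m\<in>A. L m" and ?s = "\<lambda>k. emb_S (s_line k + of_nat (mult_in A k))"
  let ?t = "\<lambda>k. Const (kc (bil (\<alpha> k) w) / kp (L k)) :: ('n, 'r) FS"
  have other: "emb_x (y * L i) * (emb_x ?P * (?t k * ?s k)) = ?s k * emb_x (Const (bil (\<alpha> k) w) * z k * (L i * ?P))"
    if "k \<in> T - {i}" for k
  proof (cases "bil (\<alpha> k) w = 0")
    case True
    then show ?thesis by (simp add: kc_simps emb_x_simps)
  next
    case False
    then have "emb_x y * ?t k = emb_x (Const (bil (\<alpha> k) w) * z k)"
      using z[OF that] \<alpha>_nz[of k] by (simp add: emb_x_kp kp_simps kc_def flip: Const_mult)
    moreover have "emb_x (y * L i) * (emb_x ?P * (?t k * ?s k)) = (emb_x y * ?t k) * (?s k * emb_x (L i * ?P))"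
      by (simp only: emb_x_simps(4) mult_ac)
    ultimately show ?thesis
      by (simp only: emb_x_simps(4) mult_ac)
  qed
  have same: "emb_x (y * L i) * (emb_x ?P * (?t i * ?s i)) = ?s i * emb_x (y * ?P)"
  proof -
    have "emb_x (L i) * ?t i = 1"
      using \<alpha>_nz[of i] by (simp add: w emb_x_kp kc_simps flip: Const_mult)
    moreover have "emb_x (y * L i) * (emb_x ?P * (?t i * ?s i)) = (emb_x (L i) * ?t i) * (?s i * emb_x (y * ?P))"
      by (simp only: emb_x_simps(4) mult_ac)
    ultimately show ?thesis by simp
  qed
  have "nabF F w (emb_x (y * (L i * ?P))) = nabF F w (emb_x (y * L i) * emb_x ?P)"
    by (simp only: emb_x_simps(4) mult.assoc)
  also have "\<dots> = emb_x (dpoly w (y * L i)) * emb_x ?P + emb_x (y * L i) * (emb_x ?P * (\<Sum>k\<in>T. ?t k * ?s k))"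
    by (simp only: nabF_emb_x nabF_prod_L)
  also have "(\<Sum>k\<in>T. ?t k * ?s k) = ?t i * ?s i + (\<Sum>k\<in>T - {i}. ?t k * ?s k)"
    using i by (simp add: sum.remove)
  also have "emb_x (y * L i) * (emb_x ?P * (?t i * ?s i + (\<Sum>k\<in>T - {i}. ?t k * ?s k))) =
      ?s i * emb_x (y * ?P) + (\<Sum>k\<in>T - {i}. ?s k * emb_x (Const (bil (\<alpha> k) w) * z k * (L i * ?P)))"
    unfolding distrib_left same sum_distrib_left using other by (intro arg_cong2[where f = "(+)"] sum.cong refl)
  also have "emb_x (dpoly w (y * L i)) * emb_x ?P = emb_x (dpoly w y * (L i * ?P)) + emb_x (y * ?P)"
    by (simp add: dpoly_mult w emb_x_simps distrib_right mult.assoc)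
  also have "?s i * emb_x (y * ?P) = emb_S (s_line i + of_nat (Suc (mult_in A i))) * emb_x (y * ?P) - emb_x (y * ?P)"
    by (simp add: emb_S_simps algebra_simps)
  finally show ?thesis
    by (simp add: algebra_simps)
qed

lemma line_step_U:
  assumes i: "i \<in> T" and w: "bil (\<alpha> i) w = 1"
    and z: "\<And>k. k \<in> T - {i} \<Longrightarrow> bil (\<alpha> k) w = 0 \<or> y = L k * z k"
    and U: "emb_S B * emb_x (y * (L i * (\<Prod>m\<in>A. L m))) \<in> U"
      "emb_S B * emb_x (dpoly w y * (L i * (\<Prod>m\<in>A. L m))) \<in> U"
      "\<And>k. k \<in> T - {i} \<Longrightarrow> bil (\<alpha> k) w \<noteq> 0 \<Longrightarrow> emb_S B * emb_x (z k * (L i * (\<Prod>m\<in>A. L m))) \<in> U"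
  shows "emb_S ((s_line i + of_nat (Suc (mult_in A i))) * B) * emb_x (y * (\<Prod>m\<in>A. L m)) \<in> U"
proof -
  let ?P = "\<Prod>m\<in>A. L m" and ?s = "\<lambda>k. emb_S (s_line k + of_nat (mult_in A k))"
  let ?X = "\<lambda>k. ?s k * emb_x (Const (bil (\<alpha> k) w) * z k * (L i * ?P))"
  have X: "emb_S B * ?X k \<in> U" if "k \<in> T - {i}" for k
  proof (cases "bil (\<alpha> k) w = 0")
    case False
    have "emb_S B * ?X k = ?s k * (emb_x (Const (bil (\<alpha> k) w)) * (emb_S B * emb_x (z k * (L i * ?P))))"
      by (simp only: emb_x_simps(4) mult_ac)
    then show ?thesis
      using U_emb_S[OF U_emb_x[OF U(3)[OF that False]]] by simp
  qed (simp add: U_zero emb_x_simps)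
  have "nabF F w (emb_S B * emb_x (y * (L i * ?P))) - emb_S B * emb_x (dpoly w y * (L i * ?P)) -
      (\<Sum>k\<in>T - {i}. emb_S B * ?X k) \<in> U"
    by (intro U_diff U_nabF U(1,2) U_sum X)
  also have "nabF F w (emb_S B * emb_x (y * (L i * ?P))) - emb_S B * emb_x (dpoly w y * (L i * ?P)) -
      (\<Sum>k\<in>T - {i}. emb_S B * ?X k) = emb_S B * (emb_S (s_line i + of_nat (Suc (mult_in A i))) * emb_x (y * ?P))"
    unfolding nabF_emb_S line_step[OF i w z, simplified] sum_distrib_left[symmetric] by (simp add: algebra_simps)
  also have "\<dots> = emb_S ((s_line i + of_nat (Suc (mult_in A i))) * B) * emb_x (y * ?P)"
    by (simp only: emb_S_simps(4) mult_ac)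
  finally show ?thesis .
qed

lemma dual_direction:
  assumes "i \<in> T" "k \<in> T" "i \<noteq> k"
  shows "\<exists>w. bil (\<alpha> i) w = 1 \<and> bil (\<alpha> k) w = 0"
proof -
  obtain x where "bil (\<alpha> k) x = 0" "bil (\<alpha> i) x \<noteq> 0"
    using not_parallel_T[OF assms(2,1)] assms(3) by (auto simp: lf_dvd_iff \<alpha>_nz)
  then show ?thesis
    by (intro exI[of _ "(1 / bil (\<alpha> i) x) *s x"]) simp
qed

lemma insert_L: "m \<notin> A \<Longrightarrow> (\<Prod>k\<in>insert m A. L k) = Const (cf m) * (L (rp m) * (\<Prod>k\<in>A. L k))"
  by (simp add: L_rp[of m])

lemma U_insert:
  assumes "m \<notin> A" "emb_S B * emb_x (q * (\<Prod>k\<in>insert m A. L k)) \<in> U"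
  shows "emb_S B * emb_x (q * (L (rp m) * (\<Prod>k\<in>A. L k))) \<in> U"
proof -
  have "Const (1 / cf m) * Const (cf m) = (1 :: ('n, complex) mpoly)"
    using cf_nz[of m] by (simp flip: Const_mult)
  moreover have "Const (1 / cf m) * (q * (\<Prod>k\<in>insert m A. L k)) =
      (Const (1 / cf m) * Const (cf m)) * (q * (L (rp m) * (\<Prod>k\<in>A. L k)))"
    unfolding insert_L[OF assms(1)] by (simp only: mult_ac)
  ultimately have "q * (L (rp m) * (\<Prod>k\<in>A. L k)) = Const (1 / cf m) * (q * (\<Prod>k\<in>insert m A. L k))"
    by (simp only: mult_1_left)
  then have "emb_S B * emb_x (q * (L (rp m) * (\<Prod>k\<in>A. L k))) =
      emb_x (Const (1 / cf m)) * (emb_S B * emb_x (q * (\<Prod>k\<in>insert m A. L k)))"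
    by (simp only: emb_x_simps(4) mult_ac)
  then show ?thesis
    using U_emb_x[OF assms(2)] by simp
qed

text \<open>With at most two lines there is a derivation that differentiates one line and annihilates the other.\<close>

theorem b_lines_two:
  assumes "card T \<le> 2"
  shows "emb_S (b_lines A) * emb_x (\<Prod>m\<in>A. L m) \<in> U"
proof (induction "card (- A)" arbitrary: A)
  case 0
  then have "A = UNIV" by auto
  then show ?case
    using U_base by (simp add: b_lines_UNIV emb_S_simps)
next
  case (Suc n)
  then obtain m where m: "m \<notin> A"
    by (metis Compl_iff card.empty equals0I nat.simps(3))
  have "- insert m A = - A - {m}" by auto
  then have "n = card (- insert m A)"
    using Suc(2) m by simp
  then have IH: "emb_S (b_lines (insert m A)) * emb_x (1 * (\<Prod>k\<in>insert m A. L k)) \<in> U"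
    using Suc(1) by simp
  have i: "rp m \<in> T" by simp
  obtain w where w: "bil (\<alpha> (rp m)) w = 1" "\<And>k. k \<in> T - {rp m} \<Longrightarrow> bil (\<alpha> k) w = 0"
  proof (cases "T - {rp m} = {}")
    case True
    obtain x where "bil (\<alpha> (rp m)) x \<noteq> 0"
      using \<alpha>_nz[of "rp m"] by (auto simp: vec_eq_iff) (metis bil_axis(1))
    then show ?thesis
      using that[of "(1 / bil (\<alpha> (rp m)) x) *s x"] True by auto
  next
    case False
    then obtain k where k: "k \<in> T" "k \<noteq> rp m" by auto
    have "card (T - {rp m}) \<le> Suc 0"
      using assms i by simp
    then have "\<forall>x\<in>T - {rp m}. \<forall>y\<in>T - {rp m}. x = y"
      by (rule iffD1[OF card_le_Suc0_iff_eq, rotated]) simp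
    with k have "T - {rp m} \<subseteq> {k}" by blast
    with dual_direction[OF i k(1)] k(2) that show ?thesis
      by blast
  qed
  have "emb_S ((s_line (rp m) + of_nat (Suc (mult_in A (rp m)))) * b_lines (insert m A)) * emb_x (1 * (\<Prod>m\<in>A. L m)) \<in> U"
    by (rule line_step_U[OF i w(1), where z = "\<lambda>_. 0"])
      (use w(2) U_insert[OF m IH] in \<open>simp_all add: emb_x_simps U_zero\<close>)
  then show ?case
    unfolding b_lines_insert[OF m] by simp
qed

end

section \<open>At least three lines: multipliers of high degree and the center\<close>

context arr_plane
begin

lemma HP_mult: "HP M p \<Longrightarrow> HP N q \<Longrightarrow> HP (M + N) (p * q)"
proof (induction rule: HP.induct)
  case (HP_const c)
  then show ?case
  proof (induction rule: HP.induct)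
    case (HP_const c')
    then show ?case using HP.HP_const[of "c * c'"] by (simp add: Const_mult)
  qed (auto simp: distrib_left mult.left_commute[of "Const c"] intro: HP.intros)
qed (auto simp: distrib_right mult.assoc intro: HP.intros)

lemma HP_scale: "HP M p \<Longrightarrow> HP M (Const c * p)"
  using HP_mult[OF HP_const] by fastforce

lemma HP_L: "HP (Suc 0) (L m)"
  using HP_add[OF HP_scale[OF HP_u[OF HP_const[of 1]], of "bil (\<alpha> m) e\<^sub>u"]
      HP_scale[OF HP_v[OF HP_const[of 1]], of "bil (\<alpha> m) e\<^sub>v"]]
  by (simp flip: L_plane)

lemma HP_L_power: "HP n (L m ^ n)"
  by (induction n) (use HP_const[of 1] HP_mult[OF HP_L] in auto)

lemma HP_prod_L: "HP (card A) (\<Prod>m\<in>A. L m)"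
  by (induction A rule: infinite_finite_induct) (use HP_const[of 1] HP_mult[OF HP_L] in auto)

lemma uv_in_lines:
  assumes "i \<in> T" "k \<in> T" "i \<noteq> k"
  shows "\<exists>a b. u = Const a * L i + Const b * L k" "\<exists>a b. v = Const a * L i + Const b * L k"
proof -
  obtain x where x: "bil (\<alpha> i) x = 1" "bil (\<alpha> k) x = 0"
    using dual_direction[OF assms] by blast
  obtain y where y: "bil (\<alpha> i) y = 0" "bil (\<alpha> k) y = 1"
    using dual_direction[OF assms(2,1)] assms(3) by blast
  have key: "\<exists>a b. lf c = Const a * L i + Const b * L k" if c: "\<And>w. bil a\<^sub>u w = 0 \<Longrightarrow> bil a\<^sub>v w = 0 \<Longrightarrow> bil c w = 0" for c
  proof (intro exI mpoly_eqI)
    fix w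
    define w' where "w' = w - bil (\<alpha> i) w *s x - bil (\<alpha> k) w *s y"
    have 0: "bil (\<alpha> i) w' = 0" "bil (\<alpha> k) w' = 0"
      by (simp_all add: w'_def x y)
    let ?D = "bil (\<alpha> i) e\<^sub>u * bil (\<alpha> k) e\<^sub>v - bil (\<alpha> k) e\<^sub>u * bil (\<alpha> i) e\<^sub>v"
    have pl: "bil (\<alpha> m) w = bil (\<alpha> m) e\<^sub>u * bil a\<^sub>u w + bil (\<alpha> m) e\<^sub>v * bil a\<^sub>v w" for m w
      by (subst \<alpha>_plane) simp
    \<comment> \<open>The coordinates of \<open>x\<close> and \<open>y\<close> form the matrix
      inverse to that of the two forms, so the product of the determinants is one.\<close>
    have "?D * (bil a\<^sub>u x * bil a\<^sub>v y - bil a\<^sub>v x * bil a\<^sub>u y) = 1"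
      using x y pl[of i x] pl[of i y] pl[of k x] pl[of k y] by algebra
    then have "?D \<noteq> 0" by auto
    moreover have "?D * bil a\<^sub>u w' = 0" "?D * bil a\<^sub>v w' = 0"
      using 0 pl[of i w'] pl[of k w'] by algebra+
    ultimately have "bil c w' = 0"
      using c by auto
    then show "ev w (lf c) = ev w (Const (bil c x) * L i + Const (bil c y) * L k)"
      by (simp add: w'_def ev_simps algebra_simps)
  qed
  show "\<exists>a b. u = Const a * L i + Const b * L k" "\<exists>a b. v = Const a * L i + Const b * L k"
    by (rule key; simp)+
qed

text \<open>Division by \<open>L i\<close>: two distinct lines serve as coordinates in place of
  \<open>u\<close> and \<open>v\<close>, and modulo \<open>L i\<close> only the pure power of
  \<open>L k\<close> survives.\<close>

lemma HP_split:
  assumes ik: "i \<in> T" "k \<in> T" "i \<noteq> k" and "HP N p"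
  shows "\<exists>c q. p = c * L k ^ N + L i * q \<and> HP 0 c \<and> (if N = 0 then q = 0 else HP (N - 1) q)"
proof -
  have step: "\<exists>c q. w * p = c * L k ^ Suc N + L i * q \<and> HP 0 c \<and> HP N q"
    if w: "\<exists>a b. w = Const a * L i + Const b * L k"
      and p: "p = c * L k ^ N + L i * q" "HP 0 c" "if N = 0 then q = 0 else HP (N - 1) q" for w p c q N
  proof -
    obtain a b where w: "w = Const a * L i + Const b * L k" using w by blast
    have "HP N (L m * q)" for m
      using p(3) HP_mult[OF HP_L[of m], of "N - 1" q] by (cases N) (auto intro: HP_zero)
    moreover have "HP N (c * L k ^ N)"
      using HP_mult[OF p(2) HP_L_power[of N k]] by simp
    ultimately have "HP N (Const a * (c * L k ^ N) + (Const a * (L i * q) + Const b * (L k * q)))"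
      by (intro HP_add HP_scale)
    moreover have "w * p = (Const b * c) * L k ^ Suc N +
        L i * (Const a * (c * L k ^ N) + (Const a * (L i * q) + Const b * (L k * q)))"
      unfolding w p(1) by (simp add: algebra_simps)
    ultimately show ?thesis
      using HP_scale[OF p(2)] by blast
  qed
  show ?thesis
    using assms(4)
  proof (induction rule: HP.induct)
    case (HP_const c)
    show ?case by (intro exI[of _ "Const c"] exI[of _ 0]) (simp add: HP.HP_const)
  next
    case (HP_add M p q)
    then obtain c c' r r' where 1: "p = c * L k ^ M + L i * r" "HP 0 c" "if M = 0 then r = 0 else HP (M - 1) r"
      and 2: "q = c' * L k ^ M + L i * r'" "HP 0 c'" "if M = 0 then r' = 0 else HP (M - 1) r'" by blast
    have "p + q = (c + c') * L k ^ M + L i * (r + r')"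
      unfolding 1(1) 2(1) by (simp add: algebra_simps)
    moreover have "if M = 0 then r + r' = 0 else HP (M - 1) (r + r')"
      using 1(3) 2(3) by (auto intro: HP.HP_add split: if_splits)
    ultimately show ?case
      using HP.HP_add[OF 1(2) 2(2)] by blast
  next
    case (HP_u M p)
    then obtain c q where "p = c * L k ^ M + L i * q" "HP 0 c" "if M = 0 then q = 0 else HP (M - 1) q" by blast
    from step[OF uv_in_lines(1)[OF ik] this] show ?case by simp
  next
    case (HP_v M p)
    then obtain c q where "p = c * L k ^ M + L i * q" "HP 0 c" "if M = 0 then q = 0 else HP (M - 1) q" by blast
    from step[OF uv_in_lines(2)[OF ik] this] show ?case by simp
  next
    case (HP_xi M p \<xi>)
    then obtain c q where 1: "p = c * L k ^ M + L i * q" "HP 0 c" "if M = 0 then q = 0 else HP (M - 1) q" by blast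
    have "lf \<xi> * p = (lf \<xi> * c) * L k ^ M + L i * (lf \<xi> * q)"
      unfolding 1(1) by (simp add: algebra_simps)
    moreover have "if M = 0 then lf \<xi> * q = 0 else HP (M - 1) (lf \<xi> * q)"
      using 1(3) HP_xi by (auto intro: HP.HP_xi split: if_splits)
    ultimately show ?case
      using HP.HP_xi[OF 1(2) HP_xi.hyps(2,3)] by blast
  qed
qed

text \<open>As in \<open>HP_split\<close>, but the coefficient of the power of \<open>L k\<close> is
  now a nonzero constant, because no factor is divisible by \<open>L i\<close>. It can therefore be
  inverted in \<open>b_lines_HP\<close>.\<close>

lemma prod_L_split:
  assumes ik: "i \<in> T" "k \<in> T" "i \<noteq> k" and "A \<subseteq> T - {i}"
  shows "\<exists>C q. C \<noteq> 0 \<and> (\<Prod>m\<in>A. L m) = Const C * L k ^ card A + L i * q \<and> (if A = {} then q = 0 else HP (card A - 1) q)"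
proof -
  have "finite A" by simp
  then show ?thesis
    using assms(4)
  proof (induction A rule: finite_induct)
    case empty
    show ?case by (intro exI[of _ 1] exI[of _ 0]) simp
  next
    case (insert m A)
    then obtain C q where C: "C \<noteq> 0" "(\<Prod>m\<in>A. L m) = Const C * L k ^ card A + L i * q"
      "if A = {} then q = 0 else HP (card A - 1) q" by auto
    obtain x where x: "bil (\<alpha> i) x = 1" "bil (\<alpha> k) x = 0"
      using dual_direction[OF ik] by blast
    obtain a b where u: "u = Const a * L i + Const b * L k" using uv_in_lines(1)[OF ik] by blast
    obtain a' b' where v: "v = Const a' * L i + Const b' * L k" using uv_in_lines(2)[OF ik] by blast
    define p where "p = bil (\<alpha> m) e\<^sub>u * a + bil (\<alpha> m) e\<^sub>v * a'"
    define r where "r = bil (\<alpha> m) e\<^sub>u * b + bil (\<alpha> m) e\<^sub>v * b'"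
    have m: "L m = Const p * L i + Const r * L k"
      by (subst L_plane) (simp add: u v p_def r_def Const_add Const_mult algebra_simps)
    have "\<not> L i dvd L m"
      using insert(4) ik by (intro not_parallel_T) auto
    then have "r \<noteq> 0"
      by (auto simp: m)
    have q: "HP (card A) (L m * q)"
    proof (cases "A = {}")
      case False
      then have "card A = Suc (card A - 1)"
        by (simp add: Suc_diff_1 card_gt_0_iff)
      moreover have "HP (Suc 0 + (card A - 1)) (L m * q)"
        using C(3) False by (intro HP_mult HP_L) auto
      ultimately show ?thesis by simp
    qed (use C(3) HP_zero in auto)
    have "(\<Prod>m\<in>insert m A. L m) = Const (r * C) * L k ^ card (insert m A) +
        L i * (Const p * (Const C * L k ^ card A) + L m * q)"
    proof -
      have "(\<Prod>m\<in>insert m A. L m) = L m * (Const C * L k ^ card A) + L m * (L i * q)"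
        using insert(1,2) by (simp add: C(2) distrib_left)
      also have "L m * (Const C * L k ^ card A) = (Const p * L i + Const r * L k) * (Const C * L k ^ card A)"
        by (simp only: m)
      finally show ?thesis
        using insert(1,2) by (simp add: Const_mult algebra_simps)
    qed
    moreover have "HP (card A) (Const p * (Const C * L k ^ card A) + L m * q)"
      by (intro HP_add HP_scale HP_L_power q)
    ultimately show ?case
      using \<open>r \<noteq> 0\<close> C(1) insert(1,2) by (intro exI[of _ "r * C"] exI) auto
  qed
qed

lemma HP_Suc_closed:
  assumes "\<And>p. HP N p \<Longrightarrow> emb_S B * emb_x (p * r) \<in> U" and "HP (Suc N) p"
  shows "emb_S B * emb_x (p * r) \<in> U"
  using assms(2)
proof (induction "Suc N" p rule: HP.induct)
  case (HP_add p q)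
  then show ?case by (simp add: emb_x_simps distrib_left distrib_right U_add)
next
  case (HP_u p)
  then show ?case
    using U_emb_x[OF assms(1), of p u] by (simp add: emb_x_simps mult_ac)
next
  case (HP_v p)
  then show ?case
    using U_emb_x[OF assms(1), of p v] by (simp add: emb_x_simps mult_ac)
next
  case (HP_xi p \<xi>)
  then have "emb_x (lf \<xi>) * (emb_S B * emb_x (p * r)) \<in> U"
    by (intro U_emb_x) auto
  then show ?case by (simp add: emb_x_simps mult_ac)
qed

lemma dpoly_plane:
  assumes "HP M p" "M > 0"
  shows "HP (M - 1) (dpoly (x *s e\<^sub>u + y *s e\<^sub>v) p)"
proof -
  have "dpoly (x *s e\<^sub>u + y *s e\<^sub>v) p = Const x * dpoly e\<^sub>u p + Const y * dpoly e\<^sub>v p"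
    by (simp add: dpoly_def Const_add Const_mult distrib_right sum.distrib sum_distrib_left mult.assoc)
  then show ?thesis
    using HP_dpoly[OF assms(1)] assms(2) by (auto intro!: HP_add HP_scale)
qed

text \<open>Modulo \<open>L i\<close> every form of degree \<open>N + 1\<close> is a multiple of one
  form \<open>y\<close> adapted to the lines. A multiple of \<open>L i\<close> adjoins the new
  factor by itself, with a cofactor of degree \<open>N\<close> as the induction requires;
  \<open>y\<close> is treated by \<open>line_step_U\<close>.\<close>

theorem b_lines_HP:
  assumes "card T \<ge> 3" "HP (card (- A) + card T - 3) p"
  shows "emb_S (b_lines A) * emb_x (p * (\<Prod>m\<in>A. L m)) \<in> U"
  using assms(2)
proof (induction "card (- A)" arbitrary: A p)
  case 0
  then have "A = UNIV" by auto
  then show ?case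
    using U_emb_x[OF U_base, of p] by (simp add: b_lines_UNIV emb_S_simps emb_x_simps)
next
  case (Suc n)
  define N where "N = n + card T - 3"
  have N: "card (- A) + card T - 3 = Suc N"
    using Suc(2) assms(1) by (simp add: N_def)
  obtain m where m: "m \<notin> A"
    using Suc(2) by (metis Compl_iff card.empty equals0I nat.simps(3))
  have "- insert m A = - A - {m}" by auto
  then have n: "n = card (- insert m A)"
    using Suc(2) m by simp
  define i where "i = rp m"
  have i: "i \<in> T" by (simp add: i_def)
  let ?B = "b_lines (insert m A)" and ?P = "\<Prod>m\<in>A. L m"
  have IH: "emb_S ?B * emb_x (q * (L i * ?P)) \<in> U" if "HP N q" for q
    unfolding i_def using that n by (intro U_insert[OF m] Suc(1)) (simp_all add: N_def)
  have "card (T - {i}) \<noteq> 0"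
    using assms(1) i by simp
  then obtain k where k: "k \<in> T" "k \<noteq> i"
    by (metis DiffE card.empty ex_in_conv insertI1)
  note ik = i k(1) k(2)[symmetric]
  define Q where "Q = T - {i, k}"
  have card_Q: "card Q = card T - 2"
    using i k by (simp add: Q_def card_Diff_insert)
  \<comment> \<open>All lines except \<open>i\<close> and \<open>k\<close> divide \<open>y\<close>,
    which cancels their poles; the pole along \<open>k\<close> is avoided by a direction tangent to
    \<open>k\<close>. The power \<open>n\<close> fills the degree up to
    \<open>N + 1\<close>.\<close>
  define y where "y = L k ^ n * (\<Prod>m\<in>Q. L m)"
  have "HP (n + card Q) y"
    unfolding y_def by (intro HP_mult HP_L_power HP_prod_L)
  moreover have "n + card Q = Suc N"
    using assms(1) unfolding card_Q N_def by linarith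
  ultimately have y: "HP (Suc N) y" by simp
  obtain w0 where w0: "bil (\<alpha> i) w0 = 1" "bil (\<alpha> k) w0 = 0"
    using dual_direction[OF ik] by blast
  \<comment> \<open>Keeping only the components in the plane makes the derivative of
    \<open>y\<close> homogeneous of degree \<open>N\<close> and leaves the values of all forms
    unchanged.\<close>
  define w where "w = bil a\<^sub>u w0 *s e\<^sub>u + bil a\<^sub>v w0 *s e\<^sub>v"
  have "bil (\<alpha> m) w = bil (\<alpha> m) w0" for m
    by (subst (2) \<alpha>_plane) (simp add: w_def mult.commute)
  with w0 have w: "bil (\<alpha> i) w = 1" "bil (\<alpha> k) w = 0" by auto
  define z where "z = (\<lambda>r. L k ^ n * (\<Prod>m\<in>Q - {r}. L m))"
  have Y: "emb_S ((s_line i + of_nat (Suc (mult_in A i))) * ?B) * emb_x (y * ?P) \<in> U"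
  proof (rule line_step_U[OF i w(1), where z = z])
    show "bil (\<alpha> r) w = 0 \<or> y = L r * z r" if "r \<in> T - {i}" for r
    proof (cases "r = k")
      case False
      with that have "r \<in> Q" by (auto simp: Q_def)
      then show ?thesis
        by (simp add: y_def z_def prod.remove[of Q r] mult_ac)
    qed (use w in simp)
    show "emb_S ?B * emb_x (y * (L i * ?P)) \<in> U"
      using HP_Suc_closed[OF IH y] by blast
    show "emb_S ?B * emb_x (dpoly w y * (L i * ?P)) \<in> U"
      using dpoly_plane[OF y] unfolding w_def by (intro IH) simp
    fix r assume "r \<in> T - {i}" "bil (\<alpha> r) w \<noteq> 0"
    with w(2) have r: "r \<in> Q" by (auto simp: Q_def)
    have "HP (n + card (Q - {r})) (z r)"
      unfolding z_def by (intro HP_mult HP_L_power HP_prod_L)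
    moreover have "n + card (Q - {r}) = N"
      using r assms(1) by (simp add: card_Q N_def)
    ultimately show "emb_S ?B * emb_x (z r * (L i * ?P)) \<in> U"
      by (intro IH) simp
  qed
  obtain C q where C: "C \<noteq> 0" "(\<Prod>m\<in>Q. L m) = Const C * L k ^ card Q + L i * q"
    "if Q = {} then q = 0 else HP (card Q - 1) q"
    using prod_L_split[OF ik, of Q] by (auto simp: Q_def)
  have "Q \<noteq> {}" using assms(1) card_Q by auto
  then have "HP (n + (card Q - 1)) (L k ^ n * q)"
    using C(3) by (intro HP_mult HP_L_power) simp
  moreover have "n + (card Q - 1) = N" "n + card Q = Suc N"
    using assms(1) by (simp_all add: card_Q N_def)
  ultimately have q: "HP N (L k ^ n * q)" and yN: "y = Const C * L k ^ Suc N + L i * (L k ^ n * q)"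
    by (simp_all add: y_def C(2) algebra_simps flip: power_add)
  obtain c r where p: "p = c * L k ^ Suc N + L i * r" "HP 0 c" "HP N r"
    using HP_split[OF ik Suc(3)[unfolded N]] by auto
  have "Const (1 / C) * Const C = (1 :: ('n, complex) mpoly)"
    using C(1) by (simp flip: Const_mult)
  moreover have "(Const (1 / C) * c) * y = (Const (1 / C) * Const C) * (c * L k ^ Suc N) + L i * (Const (1 / C) * (c * (L k ^ n * q)))"
    unfolding yN by (simp only: distrib_left mult_ac)
  ultimately have p': "p = (Const (1 / C) * c) * y + (r - Const (1 / C) * (c * (L k ^ n * q))) * L i"
    unfolding p(1) by (simp add: algebra_simps)
  have "HP N (r + Const (- 1) * (Const (1 / C) * (c * (L k ^ n * q))))"
    using HP_mult[OF p(2) q] by (intro HP_add HP_scale p(3)) simp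
  then have "HP N (r - Const (1 / C) * (c * (L k ^ n * q)))"
    by (simp add: Const_uminus)
  then have R: "emb_S ((s_line i + of_nat (Suc (mult_in A i)))) * (emb_S ?B * emb_x ((r - Const (1 / C) * (c * (L k ^ n * q))) * (L i * ?P))) \<in> U"
    by (intro U_emb_S IH)
  define s where "s = s_line i + of_nat (Suc (mult_in A i))"
  define r' where "r' = r - Const (1 / C) * (c * (L k ^ n * q))"
  have "emb_S (b_lines A) * emb_x (p * ?P) = emb_S (s * ?B) * emb_x (((Const (1 / C) * c) * y + r' * L i) * ?P)"
    unfolding b_lines_insert[OF m] i_def[symmetric] s_def[symmetric] by (subst (1) p') (simp only: r'_def)
  also have "\<dots> = emb_x (Const (1 / C) * c) * (emb_S (s * ?B) * emb_x (y * ?P)) +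
      emb_S s * (emb_S ?B * emb_x (r' * (L i * ?P)))"
    by (simp only: emb_x_simps(3,4) emb_S_simps(4) distrib_left distrib_right mult_ac)
  finally have "emb_S (b_lines A) * emb_x (p * ?P) = \<dots>" .
  then show ?case
    using U_add[OF U_emb_x[OF Y] R] unfolding s_def[symmetric] r'_def[symmetric] by simp
qed

text \<open>The induction hypothesis is applied to \<open>u h\<close> and \<open>v h\<close>, whose
  degree is larger by one; this shift of \<open>\<epsilon>\<close> yields consecutive factors, and
  the constant 2 is the divergence of the Euler field.\<close>

lemma euler_lift:
  assumes "emb_x u * nabF F e\<^sub>u h + emb_x v * nabF F e\<^sub>v h = emb_S \<epsilon> * h"
    and "\<And>a b. a + b = N \<Longrightarrow> emb_x (u ^ a * v ^ b) * h \<in> U"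
  shows "emb_S (\<Prod>j<N. \<epsilon> + of_nat (2 + j)) * h \<in> U"
  using assms
proof (induction N arbitrary: h \<epsilon>)
  case 0
  then show ?case using 0(2)[of 0 0] by (simp add: emb_S_simps emb_x_simps)
next
  case (Suc N)
  let ?p = "\<Prod>j<N. (\<epsilon> + 1) + of_nat (2 + j)"
  have nab: "nabF F e\<^sub>u (emb_x u * h) = h + emb_x u * nabF F e\<^sub>u h" "nabF F e\<^sub>v (emb_x u * h) = emb_x u * nabF F e\<^sub>v h"
    "nabF F e\<^sub>u (emb_x v * h) = emb_x v * nabF F e\<^sub>u h" "nabF F e\<^sub>v (emb_x v * h) = h + emb_x v * nabF F e\<^sub>v h"
    by (simp_all add: nabF_emb_x emb_x_simps)
  have 1: "emb_S ?p * (emb_x u * h) \<in> U"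
  proof (rule Suc.IH)
    have "emb_x u * nabF F e\<^sub>u (emb_x u * h) + emb_x v * nabF F e\<^sub>v (emb_x u * h) =
        emb_x u * h + emb_x u * (emb_x u * nabF F e\<^sub>u h + emb_x v * nabF F e\<^sub>v h)"
      unfolding nab by (simp only: distrib_left mult_ac ac_simps)
    then show "emb_x u * nabF F e\<^sub>u (emb_x u * h) + emb_x v * nabF F e\<^sub>v (emb_x u * h) = emb_S (\<epsilon> + 1) * (emb_x u * h)"
      unfolding Suc(2) by (simp add: emb_S_simps algebra_simps)
    fix a b assume "a + b = N"
    then show "emb_x (u ^ a * v ^ b) * (emb_x u * h) \<in> U"
      using Suc(3)[of "Suc a" b] by (simp add: emb_x_simps mult_ac)
  qed
  have 2: "emb_S ?p * (emb_x v * h) \<in> U"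
  proof (rule Suc.IH)
    have "emb_x u * nabF F e\<^sub>u (emb_x v * h) + emb_x v * nabF F e\<^sub>v (emb_x v * h) =
        emb_x v * h + emb_x v * (emb_x u * nabF F e\<^sub>u h + emb_x v * nabF F e\<^sub>v h)"
      unfolding nab by (simp only: distrib_left mult_ac ac_simps)
    then show "emb_x u * nabF F e\<^sub>u (emb_x v * h) + emb_x v * nabF F e\<^sub>v (emb_x v * h) = emb_S (\<epsilon> + 1) * (emb_x v * h)"
      unfolding Suc(2) by (simp add: emb_S_simps algebra_simps)
    fix a b assume "a + b = N"
    then show "emb_x (u ^ a * v ^ b) * (emb_x v * h) \<in> U"
      using Suc(3)[of a "Suc b"] by (simp add: emb_x_simps mult_ac)
  qed
  have "nabF F e\<^sub>u (emb_S ?p * (emb_x u * h)) + nabF F e\<^sub>v (emb_S ?p * (emb_x v * h)) \<in> U"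
    by (intro U_add U_nabF 1 2)
  also have "nabF F e\<^sub>u (emb_S ?p * (emb_x u * h)) + nabF F e\<^sub>v (emb_S ?p * (emb_x v * h)) =
      emb_S ?p * (h + h + (emb_x u * nabF F e\<^sub>u h + emb_x v * nabF F e\<^sub>v h))"
    unfolding nabF_emb_S nab by (simp only: distrib_left distrib_right mult_ac add_ac)
  also have "\<dots> = emb_S ((\<epsilon> + 2) * ?p) * h"
    unfolding Suc(2) emb_S_simps(3,4) emb_S_of_nat[of 2, simplified] by (simp add: algebra_simps)
  also have "(\<epsilon> + 2) * ?p = (\<Prod>j<Suc N. \<epsilon> + of_nat (2 + j))"
    unfolding prod.lessThan_Suc_shift by (simp add: add_ac)
  finally show ?case .
qed

theorem b_center:
  assumes "card T \<ge> 3"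
  shows "emb_S (b_lines A * (\<Prod>j<card (- A) + card T - 3. ((\<Sum>m\<in>UNIV. Var (\<phi> m)) + of_nat (card A)) + of_nat (2 + j))) *
    emb_x (\<Prod>m\<in>A. L m) \<in> U"
proof -
  let ?h = "emb_S (b_lines A) * emb_x (\<Prod>m\<in>A. L m)" and ?\<epsilon> = "(\<Sum>m\<in>UNIV. Var (\<phi> m)) + of_nat (card A)"
  let ?t = "\<lambda>w i. kc (bil (\<alpha> i) w) / kp (L i)"
  have L: "kp u * ?t e\<^sub>u i + kp v * ?t e\<^sub>v i = 1" for i
  proof -
    have "kp u * kc (bil (\<alpha> i) e\<^sub>u) + kp v * kc (bil (\<alpha> i) e\<^sub>v) = kp (L i)"
      using arg_cong[OF L_plane[of i], of kp] by (simp add: kp_simps kc_def mult.commute)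
    then show ?thesis
      using \<alpha>_nz[of i] by (simp add: add_divide_distrib[symmetric])
  qed
  have c: "emb_x u * (Const (?t e\<^sub>u i) * x) + emb_x v * (Const (?t e\<^sub>v i) * x) = x" for i and x :: "('n, 'r) FS"
    using arg_cong[OF L[of i], of "\<lambda>y. Const y * x"]
    by (simp only: Const_add Const_mult emb_x_kp distrib_right mult.assoc mult_1_left Const_1)
  have "(\<Sum>i\<in>T. s_line i) = (\<Sum>m\<in>UNIV. Var (\<phi> m) :: ('r, complex) mpoly)"
    using sum_lines[of "\<lambda>_. 1" "\<lambda>m. Var (\<phi> m) :: ('r, complex) mpoly" UNIV] by (simp add: s_line_def)
  moreover have "(\<Sum>i\<in>T. of_nat (mult_in A i)) = (of_nat (card A) :: ('r, complex) mpoly)"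
    using card_lines[of A] by (simp flip: of_nat_sum)
  ultimately have \<epsilon>: "(\<Sum>i\<in>T. emb_S (s_line i + of_nat (mult_in A i))) = (emb_S ?\<epsilon> :: ('n, 'r) FS)"
    by (simp add: emb_S_simps(8)[symmetric] sum.distrib)
  have "emb_x u * nabF F e\<^sub>u ?h + emb_x v * nabF F e\<^sub>v ?h = emb_S ?\<epsilon> * ?h"
  proof -
    let ?X = "emb_S (b_lines A) * emb_x (\<Prod>m\<in>A. L m)"
    have "emb_x u * nabF F e\<^sub>u ?h + emb_x v * nabF F e\<^sub>v ?h = ?X *
      (\<Sum>i\<in>T. emb_x u * (Const (?t e\<^sub>u i) * emb_S (s_line i + of_nat (mult_in A i))) +
        emb_x v * (Const (?t e\<^sub>v i) * emb_S (s_line i + of_nat (mult_in A i))))"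
      unfolding nabF_emb_S nabF_prod_L sum.distrib sum_distrib_left[symmetric]
      by (simp only: distrib_left mult_ac)
    then show ?thesis
      unfolding c \<epsilon> by (simp only: mult_ac)
  qed
  moreover have "emb_x (u ^ a * v ^ b) * ?h \<in> U" if "a + b = card (- A) + card T - 3" for a b
  proof -
    have "HP (card (- A) + card T - 3) (u ^ a * v ^ b)"
      using HP_monom[of a b] that by simp
    then show ?thesis
      using b_lines_HP[OF assms, of A "u ^ a * v ^ b"] by (simp only: emb_x_simps(4) mult_ac)
  qed
  ultimately show ?thesis
    using euler_lift[of ?h ?\<epsilon>] by (simp add: emb_S_simps(4) mult_ac)
qed

end

section \<open>Unique factorization of arrangements\<close>

lemma lf_dvd_prod_list:
  assumes "a \<noteq> 0" "lf a dvd prod_list ps"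
  shows "\<exists>p\<in>set ps. lf a dvd p"
  using assms(2)
proof (induction ps)
  case Nil
  then show ?case using lf_not_Const[OF assms(1), of 1] by simp
next
  case (Cons p ps)
  then show ?case using lf_prime[OF assms(1), of p "prod_list ps"] by auto
qed

lemma hyperplane_scale: "t \<noteq> 0 \<Longrightarrow> zero_locus {lf (t *s a)} = zero_locus {lf a}"
  by (simp add: hyperplane_lf)

text \<open>Primeness of linear forms matches the first factor of one list with a proportional
  factor of the other, which has the same hyperplane. This makes the description in
  \<open>num_factors_at\<close> unambiguous.\<close>

lemma num_factors_unique:
  fixes ls ls' :: "('n::{finite,linorder}, complex) mpoly list"
  assumes "\<forall>l\<in>set ls. linear_form l" "\<forall>l\<in>set ls'. linear_form l" "c \<noteq> 0" "c' \<noteq> 0"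
    and "Const c * prod_list ls = Const c' * prod_list ls'"
  shows "length (filter (\<lambda>l. X \<subseteq> zero_locus {l}) ls) = length (filter (\<lambda>l. X \<subseteq> zero_locus {l}) ls')"
  using assms
proof (induction ls arbitrary: c c' ls')
  case Nil
  show ?case
  proof (cases ls')
    case (Cons l ks)
    then obtain a where a: "a \<noteq> 0" "l = lf a"
      using Nil(2) by (auto simp: linear_form_iff)
    then have "lf a dvd Const c"
      using Nil(5) Cons by (metis dvd_mult dvd_mult2 dvd_refl mult_1_right prod_list.Cons prod_list.Nil)
    with a Nil(3) show ?thesis
      using lf_not_Const by blast
  qed simp
next
  case (Cons l ls)
  then obtain a where a: "a \<noteq> 0" "l = lf a"
    by (auto simp: linear_form_iff)
  have "lf a dvd Const c' * prod_list ls'"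
    unfolding Cons(6)[symmetric] by (simp add: a)
  moreover have "\<not> lf a dvd Const c'"
    using a Cons(5) lf_not_Const by blast
  ultimately obtain l' where l': "l' \<in> set ls'" "lf a dvd l'"
    using lf_prime[OF a(1)] lf_dvd_prod_list[OF a(1)] by blast
  then obtain a' where a': "a' \<noteq> 0" "l' = lf a'"
    using Cons(3) by (auto simp: linear_form_iff)
  then obtain t where t: "a' = t *s a"
    using l'(2) lf_dvd_lf_iff[OF a(1)] by blast
  with a' have "t \<noteq> 0" by auto
  obtain xs ys where ls': "ls' = xs @ l' # ys"
    using split_list[OF l'(1)] by blast
  have "lf a * (Const c * prod_list ls) = lf a * (Const (c' * t) * prod_list (xs @ ys))"
    using Cons(6) by (simp add: ls' a a' t lf_scale Const_mult mult_ac)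
  then have "Const c * prod_list ls = Const (c' * t) * prod_list (xs @ ys)"
    using a(1) by simp
  then have "length (filter (\<lambda>l. X \<subseteq> zero_locus {l}) ls) = length (filter (\<lambda>l. X \<subseteq> zero_locus {l}) (xs @ ys))"
    using Cons(2-5) \<open>t \<noteq> 0\<close> by (intro Cons(1)) (auto simp: ls')
  moreover have "zero_locus {l'} = zero_locus {l}"
    using hyperplane_scale[OF \<open>t \<noteq> 0\<close>] by (simp add: a a' t)
  ultimately show ?case
    by (simp add: ls')
qed

lemma num_factors_at_eq:
  fixes L :: "'d::finite \<Rightarrow> ('n::{finite,linorder}, complex) mpoly"
  assumes "c \<noteq> 0" "\<And>m. linear_form (L m)"
  shows "num_factors_at (Const c * (\<Prod>m\<in>A. L m)) X = card {m \<in> A. X \<subseteq> zero_locus {L m}}"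
proof -
  obtain xs where xs: "set xs = A" "distinct xs"
    using finite_distinct_list[of A] by auto
  have p: "(\<Prod>m\<in>A. L m) = prod_list (map L xs)"
    using prod.distinct_set_conv_list[OF xs(2), of L] xs(1) by simp
  have lin: "\<forall>l\<in>set (map L xs). linear_form l"
    using assms(2) by auto
  have "length (filter (\<lambda>l. X \<subseteq> zero_locus {l}) (map L xs)) = length (filter (\<lambda>m. X \<subseteq> zero_locus {L m}) xs)"
    by (simp add: filter_map comp_def)
  also have "\<dots> = card {m \<in> A. X \<subseteq> zero_locus {L m}}"
    using distinct_card[OF distinct_filter[OF xs(2)]] xs(1) by (simp flip: distinct_card add: xs(2))
  finally have len: "length (filter (\<lambda>l. X \<subseteq> zero_locus {l}) (map L xs)) = card {m \<in> A. X \<subseteq> zero_locus {L m}}" .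
  show ?thesis
    unfolding num_factors_at_def
  proof (rule the_equality)
    show "\<exists>c' ls. c' \<noteq> 0 \<and> (\<forall>l\<in>set ls. linear_form l) \<and> Const c * (\<Prod>m\<in>A. L m) = Const c' * prod_list ls \<and>
        card {m \<in> A. X \<subseteq> zero_locus {L m}} = length (filter (\<lambda>l. X \<subseteq> zero_locus {l}) ls)"
      by (rule exI[of _ c], rule exI[of _ "map L xs"]) (use assms lin p len in simp)
    fix k
    assume "\<exists>c' ls. c' \<noteq> 0 \<and> (\<forall>l\<in>set ls. linear_form l) \<and> Const c * (\<Prod>m\<in>A. L m) = Const c' * prod_list ls \<and>
        k = length (filter (\<lambda>l. X \<subseteq> zero_locus {l}) ls)"
    then obtain c' ls where "c' \<noteq> 0" "\<forall>l\<in>set ls. linear_form l" "Const c * prod_list (map L xs) = Const c' * prod_list ls"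
        "k = length (filter (\<lambda>l. X \<subseteq> zero_locus {l}) ls)"
      unfolding p by blast
    then show "k = card {m \<in> A. X \<subseteq> zero_locus {L m}}"
      using num_factors_unique[OF lin, of ls c c'] assms(1) len by simp
  qed
qed

text \<open>Each linear form is prime and divides either \<open>p\<close> or its cofactor; splitting
  them off one by one leaves units. For \<open>f'\<close> this yields the index set \<open>A\<close>
  and the constant \<open>c\<close>.\<close>

lemma dvd_prod_lf:
  fixes p q :: "('n::{finite,linorder}, complex) mpoly"
  assumes "finite A" "\<And>m. m \<in> A \<Longrightarrow> a m \<noteq> 0" "p * q = (\<Prod>m\<in>A. lf (a m))"
  shows "\<exists>M c. M \<subseteq> A \<and> c \<noteq> 0 \<and> p = Const c * (\<Prod>m\<in>M. lf (a m))"
  using assms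
proof (induction A arbitrary: p q rule: finite_induct)
  case empty
  then obtain c where "c \<noteq> 0" "p = Const c"
    using mpoly_unit[of p q] by auto
  then show ?case
    by (intro exI[of _ "{}"] exI[of _ c]) simp
next
  case (insert m A)
  then have nz: "lf (a m) \<noteq> 0" by simp
  have "lf (a m) dvd p * q"
    using insert by simp
  then consider p' where "p = lf (a m) * p'" | q' where "q = lf (a m) * q'"
    using lf_prime[of "a m" p q] insert(4) by (auto elim!: dvdE)
  then show ?case
  proof cases
    case 1
    then have "lf (a m) * (p' * q) = lf (a m) * (\<Prod>m\<in>A. lf (a m))"
      using insert by (simp add: mult.assoc)
    then have "p' * q = (\<Prod>m\<in>A. lf (a m))" using nz by simp
    then obtain M c where M: "M \<subseteq> A" "c \<noteq> 0" "p' = Const c * (\<Prod>m\<in>M. lf (a m))"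
      using insert by blast
    have "m \<notin> M" "finite M" using M insert(1,2) by (auto intro: finite_subset)
    then have "p = Const c * (\<Prod>m\<in>insert m M. lf (a m))"
      by (simp add: 1 M(3) mult_ac)
    then show ?thesis
      using M by (intro exI[of _ "insert m M"] exI[of _ c]) auto
  next
    case 2
    then have "lf (a m) * (p * q') = lf (a m) * (\<Prod>m\<in>A. lf (a m))"
      using insert by (simp add: mult.left_commute)
    then have "p * q' = (\<Prod>m\<in>A. lf (a m))" using nz by simp
    then obtain M c where "M \<subseteq> A" "c \<noteq> 0" "p = Const c * (\<Prod>m\<in>M. lf (a m))"
      using insert by blast
    then show ?thesis by blast
  qed
qed

section \<open>Variables occurring in a polynomial and linear changes of coordinates\<close>

lemma ev_cong_vars:
  assumes "\<And>i. i \<in> poly_vars p \<Longrightarrow> x $ i = y $ i"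
  shows "ev x p = ev y p"
proof -
  have "x $ i = y $ i" if "m \<in> Poly_Mapping.keys p" "i \<in> Poly_Mapping.keys m" for m i
    using assms that by (auto simp: poly_vars_def)
  then show ?thesis
    unfolding ev_def subst_poly_def by (intro sum.cong prod.cong refl arg_cong2[where f = "(*)"]) simp
qed

text \<open>If a form involving \<open>x\<^sub>i\<close> divides \<open>p\<close>, then every point can be moved into its zero locus by
  changing \<open>x\<^sub>i\<close> only.\<close>

lemma lf_dvd_poly_vars:
  assumes "lf a dvd p" "p \<noteq> 0" "a $ i \<noteq> 0"
  shows "i \<in> poly_vars p"
proof (rule ccontr)
  assume i: "i \<notin> poly_vars p"
  have a: "a \<noteq> 0" using assms(3) by auto
  have "ev x p = 0" for x
  proof -
    let ?y = "x - (bil a x / a $ i) *s axis i 1"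
    have "bil a ?y = 0" using assms(3) by simp
    then have "ev ?y p = 0"
      using assms(1) by (simp add: lf_dvd_iff[OF a])
    moreover have "ev x p = ev ?y p"
      using i by (intro ev_cong_vars) (auto simp: axis_def)
    ultimately show ?thesis by simp
  qed
  then show False
    using mpoly_eq_0I assms(2) by blast
qed

lemma arrangement_nonzero:
  fixes p :: "('n::{finite,linorder}, complex) mpoly"
  assumes "arrangement p" shows "p \<noteq> 0"
  using assms by (auto simp: arrangement_def linear_form_def prod_list_zero_iff)

lemma arrangement_factor:
  assumes "arrangement p" "poly_vars p \<noteq> {}"
  shows "\<exists>a. a \<noteq> 0 \<and> lf a dvd p"
proof -
  obtain ls where ls: "\<forall>l\<in>set ls. linear_form l" "p = prod_list ls"
    using assms(1) by (auto simp: arrangement_def)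
  have "ls \<noteq> []"
    using assms(2) by (auto simp: ls poly_vars_def)
  then obtain l ks where "ls = l # ks" by (cases ls) auto
  then show ?thesis
    using ls by (auto simp: linear_form_iff)
qed

lemma is_hom_linear_change: "is_hom (linear_change A)"
proof -
  have "linear_change A = subst_poly Const (\<lambda>i. \<Sum>j\<in>UNIV. Const (A $ i $ j) * Var j)"
    by (simp add: linear_change_def[abs_def])
  then show ?thesis by (simp add: is_hom_subst is_hom_Const)
qed

lemma linear_change_Const: "linear_change A (Const c) = Const c"
  by (simp add: linear_change_def is_hom_Const)

lemma linear_change_lf: "linear_change A (lf a) = lf (a v* A)"
proof (rule mpoly_eqI)
  fix x
  have V: "linear_change A (Var i) = (\<Sum>j\<in>UNIV. Const (A $ i $ j) * Var j)" for i
    by (simp add: linear_change_def is_hom_Const)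
  have "linear_change A (lf a) = (\<Sum>i\<in>UNIV. Const (a $ i) * (\<Sum>j\<in>UNIV. Const (A $ i $ j) * Var j))"
    by (simp add: lf_def is_homD[OF is_hom_linear_change] V linear_change_Const)
  then have "ev x (linear_change A (lf a)) = (\<Sum>i\<in>UNIV. \<Sum>j\<in>UNIV. a $ i * (A $ i $ j * x $ j))"
    by (simp add: ev_simps sum_distrib_left)
  also have "\<dots> = (\<Sum>j\<in>UNIV. \<Sum>i\<in>UNIV. a $ i * (A $ i $ j * x $ j))"
    by (rule sum.swap)
  also have "\<dots> = bil (a v* A) x"
    by (simp add: bil_def vector_matrix_mult_def sum_distrib_left sum_distrib_right mult_ac)
  finally show "ev x (linear_change A (lf a)) = ev x (lf (a v* A))" by simp
qed

lemma vector_matrix_nonzero: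
  fixes A :: "complex ^ 'n ^ 'n"
  assumes "invertible A" "a \<noteq> 0" shows "a v* A \<noteq> 0"
proof
  assume "a v* A = 0"
  moreover obtain B where "A ** B = mat 1"
    using assms(1) by (auto simp: invertible_def)
  ultimately have "a = 0 v* B"
    by (metis vector_matrix_mul_assoc vector_matrix_mul_rid)
  then show False using assms(2) by simp
qed

section \<open>Edges of an arrangement of rank at most two\<close>

lemma subspace_bil: "vec.subspace {x. bil a x = 0}"
  by (auto simp: vec.subspace_def)

lemma dim_cut:
  assumes S: "vec.subspace S" and x: "x \<in> S" "bil a x \<noteq> 0"
  shows "vec.dim S = vec.dim (S \<inter> {x. bil a x = 0}) + 1"
proof -
  let ?K = "S \<inter> {x. bil a x = 0}"
  have K: "vec.subspace ?K"
    using S subspace_bil by (rule vec.subspace_inter)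
  have "S \<subseteq> vec.span (insert x ?K)"
  proof
    fix y assume y: "y \<in> S"
    let ?t = "bil a y / bil a x"
    have "y - ?t *s x \<in> S"
      using S x y by (intro vec.subspace_diff vec.subspace_scale)
    then have "y - ?t *s x \<in> ?K"
      using x by simp
    then show "y \<in> vec.span (insert x ?K)"
      unfolding vec.span_breakdown_eq by (intro exI[of _ ?t] vec.span_base)
  qed
  moreover have "vec.span (insert x ?K) \<subseteq> S"
    using S x by (intro vec.span_minimal) auto
  ultimately have "vec.span (insert x ?K) = S"
    by (rule subset_antisym[rotated])
  then have "vec.dim S = vec.dim (insert x ?K)"
    using vec.dim_span[of "insert x ?K"] by simp
  moreover have "x \<notin> vec.span ?K"
    using x K by (simp add: vec.span_eq_iff[THEN iffD2])
  ultimately show ?thesis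
    by (simp add: vec.dim_insert)
qed

lemma ex_bil_nonzero: "a \<noteq> 0 \<Longrightarrow> \<exists>x. bil a x \<noteq> 0"
  by (auto simp: vec_eq_iff) (metis bil_axis(1))

lemma exists_arr_lines:
  assumes "arr \<alpha> \<phi> F"
  shows "\<exists>rp cf. arr_lines \<alpha> \<phi> F rp cf"
proof -
  interpret arr \<alpha> \<phi> F by fact
  let ?H = "\<lambda>m. {x. bil (\<alpha> m) x = 0}"
  \<comment> \<open>The choice depends on the hyperplane only, hence is the same for all parallel
    factors.\<close>
  define rp where "rp = (\<lambda>m. SOME k. ?H k = ?H m)"
  have rp: "?H (rp m) = ?H m" for m
    unfolding rp_def by (rule someI[of "\<lambda>k. ?H k = ?H m" m]) simp
  have rp_eq: "?H m = ?H k \<Longrightarrow> rp m = rp k" for m k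
    unfolding rp_def by simp
  have dvd: "L m dvd L k \<longleftrightarrow> ?H m \<subseteq> ?H k" for m k
    by (auto simp: lf_dvd_iff[OF \<alpha>_nz])
  have "\<exists>t. \<alpha> m = t *s \<alpha> (rp m)" for m
    using rp[of m] dvd[of "rp m" m] by (simp add: lf_dvd_lf_iff[OF \<alpha>_nz])
  then obtain cf where cf: "\<And>m. \<alpha> m = cf m *s \<alpha> (rp m)" by metis
  have "arr_lines \<alpha> \<phi> F rp cf"
  proof (unfold_locales)
    show "\<alpha> m = cf m *s \<alpha> (rp m)" for m by (rule cf)
    show idem: "rp (rp m) = rp m" for m by (rule rp_eq[OF rp])
    show "\<not> L (rp m) dvd L (rp m')" if "rp m \<noteq> rp m'" for m m'
    proof
      assume *: "L (rp m) dvd L (rp m')"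
      then obtain t where t: "\<alpha> (rp m') = t *s \<alpha> (rp m)"
        by (auto simp: lf_dvd_lf_iff[OF \<alpha>_nz])
      then have "t \<noteq> 0" using \<alpha>_nz[of "rp m'"] by auto
      then have "?H (rp m') = ?H (rp m)" by (simp add: t)
      then have "rp (rp m') = rp (rp m)" by (rule rp_eq)
      with idem that show False by simp
    qed
  qed
  then show ?thesis by blast
qed

context arr_lines
begin

abbreviation "H m \<equiv> zero_locus {L m}"

lemma H_eq: "H m = {x. bil (\<alpha> m) x = 0}"
  by (rule hyperplane_lf)

lemma H_rp: "H (rp m) = H m"
proof -
  have "H m = {x. bil (cf m *s \<alpha> (rp m)) x = 0}"
    unfolding H_eq by (simp only: \<alpha>_rp[symmetric])
  then show ?thesis
    using cf_nz[of m] by (simp add: H_eq)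
qed

lemma H_subset_iff: "H m \<subseteq> H k \<longleftrightarrow> L m dvd L k"
  by (auto simp: H_eq lf_dvd_iff[OF \<alpha>_nz])

lemma H_subset_rp: "H m \<subseteq> H k \<longleftrightarrow> rp m = rp k"
proof
  assume "H m \<subseteq> H k"
  then have "L (rp m) dvd L (rp k)"
    by (simp add: H_rp flip: H_subset_iff)
  then show "rp m = rp k"
    using not_parallel by blast
next
  assume "rp m = rp k"
  then show "H m \<subseteq> H k"
    by (metis H_rp order_refl)
qed

lemma subspace_H: "vec.subspace (H m)"
  unfolding H_eq by (rule subspace_bil)

lemma dim_H: "CARD('n) = vec.dim (H m) + 1"
proof -
  obtain x where "bil (\<alpha> m) x \<noteq> 0"
    using ex_bil_nonzero[OF \<alpha>_nz] by blast
  from dim_cut[OF vec.subspace_UNIV UNIV_I this] show ?thesis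
    unfolding vec_dim_card H_eq Int_UNIV_left .
qed

lemma codim_H: "codim (H m) = 1"
  using dim_H[of m] by (simp add: codim_def)

lemma dim_H_H:
  assumes "rp m \<noteq> rp k" shows "CARD('n) = vec.dim (H m \<inter> H k) + 2"
proof -
  have "\<not> H m \<subseteq> H k" using assms H_subset_rp by blast
  then obtain x where "x \<in> H m" "bil (\<alpha> k) x \<noteq> 0"
    by (auto simp: H_eq)
  then have "vec.dim (H m) = vec.dim (H m \<inter> H k) + 1"
    using dim_cut[OF subspace_H] by (auto simp: H_eq)
  then show ?thesis
    using dim_H[of m] by simp
qed

end

locale rank_two = arr_lines \<alpha> \<phi> F rp cf
  for \<alpha> :: "'d::finite \<Rightarrow> complex ^ 'n::{finite,linorder}" and \<phi> :: "'d \<Rightarrow> 'r::finite"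
    and F :: "'r \<Rightarrow> ('n, complex) mpoly" and rp :: "'d \<Rightarrow> 'd" and cf :: "'d \<Rightarrow> complex" +
  assumes rank: "arr_rank L \<le> 2"
begin

definition Z :: "(complex, 'n) vec set" where
  "Z = (\<Inter>m. H m)"

text \<open>Rank at most two enters here: two distinct hyperplanes already cut out codimension two,
  so every other one contains their intersection.\<close>

lemma Z_eq:
  assumes "rp m \<noteq> rp k" shows "Z = H m \<inter> H k"
proof (rule vec.subspace_dim_equal)
  show "vec.subspace Z"
    unfolding Z_def by (intro vec.subspace_Inter) (auto simp: subspace_H)
  show "vec.subspace (H m \<inter> H k)"
    by (intro vec.subspace_inter subspace_H)
  show "Z \<subseteq> H m \<inter> H k" by (auto simp: Z_def)
  have "CARD('n) - vec.dim Z \<le> 2"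
    using rank by (simp add: arr_rank_def codim_def Z_def)
  then show "vec.dim (H m \<inter> H k) \<le> vec.dim Z"
    using dim_H_H[OF assms] by linarith
qed

lemma codim_Z: "rp m \<noteq> rp k \<Longrightarrow> codim Z = 2"
  using Z_eq[of m k] dim_H_H[of m k] by (simp add: codim_def)

lemma two_lines: "card T \<ge> 2 \<Longrightarrow> \<exists>i k. i \<in> T \<and> k \<in> T \<and> i \<noteq> k"
proof (rule ccontr)
  assume "\<not> ?thesis" and T: "card T \<ge> 2"
  then have "\<forall>x\<in>T. \<forall>y\<in>T. x = y" by blast
  then have "card T \<le> Suc 0"
    by (rule iffD2[OF card_le_Suc0_iff_eq, rotated]) simp
  with T show False by simp
qed

lemma H_neq_Z:
  assumes "i \<in> T" "k \<in> T" "i \<noteq> k" shows "H m \<noteq> Z"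
proof -
  have "rp i \<noteq> rp k" using assms(3) rp_T[OF assms(1)] rp_T[OF assms(2)] by simp
  then have "codim Z = 2" by (rule codim_Z)
  then show ?thesis using codim_H[of m] by auto
qed

lemma in_span_of_two:
  assumes "i \<in> T" "k \<in> T" "i \<noteq> k"
  shows "\<exists>x y. bil (\<alpha> i) x = 1 \<and> bil (\<alpha> i) y = 0 \<and> bil (\<alpha> k) x = 0 \<and> bil (\<alpha> k) y = 1 \<and>
    (\<forall>m. \<alpha> m = bil (\<alpha> m) x *s \<alpha> i + bil (\<alpha> m) y *s \<alpha> k)"
proof -
  obtain x where x: "bil (\<alpha> i) x = 1" "bil (\<alpha> k) x = 0"
    using dual_direction[OF assms] by blast
  obtain y where y: "bil (\<alpha> i) y = 0" "bil (\<alpha> k) y = 1"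
    using dual_direction[OF assms(2,1)] assms(3) by blast
  have span: "\<alpha> m = bil (\<alpha> m) x *s \<alpha> i + bil (\<alpha> m) y *s \<alpha> k" for m
  proof -
    have "bil (\<alpha> m) w = bil (bil (\<alpha> m) x *s \<alpha> i + bil (\<alpha> m) y *s \<alpha> k) w" for w
    proof -
      define w' where "w' = w - bil (\<alpha> i) w *s x - bil (\<alpha> k) w *s y"
      have "rp i \<noteq> rp k" using assms(3) rp_T[OF assms(1)] rp_T[OF assms(2)] by simp
      moreover have "w' \<in> H i \<inter> H k"
        by (simp add: w'_def H_eq x y)
      ultimately have "w' \<in> Z"
        using Z_eq[of i k] by simp
      then have "w' \<in> H m"
        by (auto simp: Z_def)
      then show ?thesis
        by (simp add: w'_def H_eq algebra_simps)
    qed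
    from this[of "axis _ 1"] show ?thesis
      by (simp add: vec_eq_iff)
  qed
  with x y show ?thesis by blast
qed

lemma exists_plane:
  assumes "card T \<ge> 2"
  shows "\<exists>a\<^sub>u a\<^sub>v e\<^sub>u e\<^sub>v. arr_plane \<alpha> \<phi> F rp cf a\<^sub>u a\<^sub>v e\<^sub>u e\<^sub>v"
proof -
  obtain i k where ik: "i \<in> T" "k \<in> T" "i \<noteq> k"
    using two_lines[OF assms] by blast
  obtain x y where xy: "bil (\<alpha> i) x = 1" "bil (\<alpha> i) y = 0" "bil (\<alpha> k) x = 0" "bil (\<alpha> k) y = 1"
    and span: "\<And>m. \<alpha> m = bil (\<alpha> m) x *s \<alpha> i + bil (\<alpha> m) y *s \<alpha> k"
    using in_span_of_two[OF ik] by blast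
  \<comment> \<open>A shear of the dual basis: \<open>s\<close> avoids the finitely many ratios for
    which some form would vanish on \<open>x - s *s y\<close>.\<close>
  obtain s where s: "s \<notin> range (\<lambda>m. bil (\<alpha> m) x / bil (\<alpha> m) y)"
    using ex_new_if_finite[OF infinite_UNIV_char_0[where 'a = complex], of "range (\<lambda>m. bil (\<alpha> m) x / bil (\<alpha> m) y)"]
    by auto
  have "arr_plane \<alpha> \<phi> F rp cf (\<alpha> i) (\<alpha> k + s *s \<alpha> i) (x - s *s y) y"
  proof (unfold_locales)
    fix m
    show "\<alpha> m = bil (\<alpha> m) (x - s *s y) *s \<alpha> i + bil (\<alpha> m) y *s (\<alpha> k + s *s \<alpha> i)"
      using span[of m] by (simp add: vec_eq_iff algebra_simps)
    show "bil (\<alpha> m) (x - s *s y) \<noteq> 0"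
    proof
      assume *: "bil (\<alpha> m) (x - s *s y) = 0"
      show False
      proof (cases "bil (\<alpha> m) y = 0")
        case True
        with * have "bil (\<alpha> m) x = 0" by simp
        with True span[of m] \<alpha>_nz[of m] show False by simp
      next
        case False
        with * have "s = bil (\<alpha> m) x / bil (\<alpha> m) y" by (simp add: field_simps)
        with s show False by auto
      qed
    qed
  qed (simp_all add: xy)
  then show ?thesis by blast
qed

lemma edges_eq: "edges L = insert UNIV (H ` T \<union> (if card T \<ge> 2 then {Z} else {}))"
proof
  show "edges L \<subseteq> insert UNIV (H ` T \<union> (if card T \<ge> 2 then {Z} else {}))"
  proof
    fix X assume "X \<in> edges L"
    then obtain I where X: "X = (\<Inter>m\<in>I. H m)" by (auto simp: edges_def)
    consider "I = {}" | m where "m \<in> I" "\<forall>k\<in>I. rp k = rp m" | m k where "m \<in> I" "k \<in> I" "rp m \<noteq> rp k"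
      by blast
    then show "X \<in> insert UNIV (H ` T \<union> (if card T \<ge> 2 then {Z} else {}))"
    proof cases
      case 2
      have "H k = H m" if "k \<in> I" for k
        using 2(2) that H_subset_rp[of k m] H_subset_rp[of m k] by (intro subset_antisym) auto
      then have "X = (\<Inter>k\<in>I. H m)"
        unfolding X by (rule INF_cong[OF refl])
      also have "\<dots> = H (rp m)"
        unfolding H_rp using 2(1) by (intro INF_const) auto
      finally have "X = H (rp m)" .
      then show ?thesis by simp
    next
      case 3
      then have "X \<subseteq> H m \<inter> H k" by (auto simp: X)
      moreover have "Z \<subseteq> X" by (auto simp: X Z_def)
      ultimately have "X = Z"
        unfolding Z_eq[OF 3(3)] by (rule subset_antisym)
      moreover have "card {rp m, rp k} \<le> card T"
        by (intro card_mono) auto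
      ultimately show ?thesis using 3(3) by simp
    qed (simp add: X)
  qed
next
  have "UNIV \<in> edges L"
    unfolding edges_def by (auto intro!: exI[of _ "{}"])
  moreover have "H m \<in> edges L" for m
    unfolding edges_def by (auto intro!: exI[of _ "{m}"])
  moreover have "Z \<in> edges L"
    unfolding edges_def Z_def by auto
  ultimately show "insert UNIV (H ` T \<union> (if card T \<ge> 2 then {Z} else {})) \<subseteq> edges L"
    by auto
qed

lemma J_at_H: "J_at L (H i) = {m. rp m = rp i}"
  unfolding J_at_def H_subset_rp by auto

lemma J_at_Z: "J_at L Z = UNIV"
  unfolding J_at_def Z_def by auto

lemma H_neq_UNIV: "H m \<noteq> UNIV"
  using ex_bil_nonzero[OF \<alpha>_nz, of m] by (auto simp: H_eq)

lemma Z_neq_UNIV: "Z \<noteq> UNIV"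
  using H_neq_UNIV by (auto simp: Z_def)

section \<open>Decomposability of the edges\<close>

lemma change_factors:
  assumes "invertible A" "linear_change A (\<Prod>m\<in>M. L m) = p * q" "lf b dvd p" "b \<noteq> 0"
  obtains m where "m \<in> M" "lf (\<alpha> m v* A) dvd p"
proof -
  have "linear_change A (\<Prod>m\<in>M. L m) = (\<Prod>m\<in>M. lf (\<alpha> m v* A))"
    by (simp add: is_homD[OF is_hom_linear_change] linear_change_lf)
  then have "lf b dvd (\<Prod>m\<in>M. lf (\<alpha> m v* A))"
    using assms(2,3) by (metis dvd_mult2)
  then obtain m where m: "m \<in> M" "lf b dvd lf (\<alpha> m v* A)"
    using lf_dvd_prod[OF assms(4), of M] by auto
  then obtain t where t: "\<alpha> m v* A = t *s b"
    by (auto simp: lf_dvd_lf_iff[OF assms(4)])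
  moreover have "\<alpha> m v* A \<noteq> 0"
    by (rule vector_matrix_nonzero[OF assms(1) \<alpha>_nz])
  ultimately have "t \<noteq> 0" by auto
  then have "lf (\<alpha> m v* A) dvd lf b"
    using lf_dvd_lf_iff[OF \<open>\<alpha> m v* A \<noteq> 0\<close>, of b] t by (auto intro!: exI[of _ "1 / t"])
  with that m(1) assms(3) show ?thesis
    using dvd_trans by blast
qed

text \<open>Being prime, each transformed form divides \<open>p\<close> or \<open>q\<close> and thus
  uses the variables of one side only; \<open>m\<close> and \<open>k\<close> witness that both sides
  occur.\<close>

lemma decomposition_sides:
  assumes "decomposable L X"
  obtains A :: "((complex, 'n) vec, 'n) vec" and Y m k where "invertible A" "m \<in> J_at L X" "k \<in> J_at L X"
    "\<And>r. (\<alpha> m v* A) $ r \<noteq> 0 \<Longrightarrow> r \<in> Y" "\<And>r. (\<alpha> k v* A) $ r \<noteq> 0 \<Longrightarrow> r \<notin> Y"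
    "\<And>i. i \<in> J_at L X \<Longrightarrow> (\<forall>r. (\<alpha> i v* A) $ r \<noteq> 0 \<longrightarrow> r \<in> Y) \<or> (\<forall>r. (\<alpha> i v* A) $ r \<noteq> 0 \<longrightarrow> r \<notin> Y)"
proof -
  obtain A Y p q where A: "invertible A" and p: "arrangement p" "poly_vars p \<noteq> {}" "poly_vars p \<subseteq> Y"
    and q: "arrangement q" "poly_vars q \<noteq> {}" "poly_vars q \<subseteq> - Y"
    and eq: "linear_change A (\<Prod>m\<in>J_at L X. L m) = p * q"
    using assms unfolding decomposable_def localized_arr_def by blast
  have P: "r \<in> Y" if "lf (\<alpha> i v* A) dvd p" "(\<alpha> i v* A) $ r \<noteq> 0" for i r
    using lf_dvd_poly_vars[OF that(1) arrangement_nonzero[OF p(1)] that(2)] p(3) by blast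
  have Q: "r \<notin> Y" if "lf (\<alpha> i v* A) dvd q" "(\<alpha> i v* A) $ r \<noteq> 0" for i r
    using lf_dvd_poly_vars[OF that(1) arrangement_nonzero[OF q(1)] that(2)] q(3) by blast
  obtain m where m: "m \<in> J_at L X" "lf (\<alpha> m v* A) dvd p"
    using arrangement_factor[OF p(1,2)] change_factors[OF A eq] by blast
  obtain k where k: "k \<in> J_at L X" "lf (\<alpha> k v* A) dvd q"
    using arrangement_factor[OF q(1,2)] change_factors[OF A eq[unfolded mult.commute[of p]]] by blast
  have sides: "lf (\<alpha> i v* A) dvd p \<or> lf (\<alpha> i v* A) dvd q" if "i \<in> J_at L X" for i
  proof (rule lf_prime[OF vector_matrix_nonzero[OF A \<alpha>_nz]])
    have "linear_change A (\<Prod>m\<in>J_at L X. L m) = (\<Prod>m\<in>J_at L X. lf (\<alpha> m v* A))"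
      by (simp add: is_homD[OF is_hom_linear_change] linear_change_lf)
    then show "lf (\<alpha> i v* A) dvd p * q"
      using dvd_prodI[OF finite that, of "\<lambda>m. lf (\<alpha> m v* A)"] by (simp only: eq[symmetric])
  qed
  show ?thesis
  proof (rule that[OF A m(1) k(1)])
    fix i assume "i \<in> J_at L X"
    then show "(\<forall>r. (\<alpha> i v* A) $ r \<noteq> 0 \<longrightarrow> r \<in> Y) \<or> (\<forall>r. (\<alpha> i v* A) $ r \<noteq> 0 \<longrightarrow> r \<notin> Y)"
      using sides P Q by blast
  qed (use P Q m(2) k(2) in blast)+
qed

text \<open>All factors through a hyperplane are proportional and involve the same variables, so
  they cannot occupy both sides.\<close>

lemma H_indecomposable: "\<not> decomposable L (H i)"
proof
  assume "decomposable L (H i)"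
  then obtain A :: "((complex, 'n) vec, 'n) vec" and Y m k where A: "invertible A" and mk: "rp m = rp i" "rp k = rp i"
    and m: "\<And>r. (\<alpha> m v* A) $ r \<noteq> 0 \<Longrightarrow> r \<in> Y" and k: "\<And>r. (\<alpha> k v* A) $ r \<noteq> 0 \<Longrightarrow> r \<notin> Y"
    by (rule decomposition_sides) (auto simp: J_at_H)
  have scale: "\<alpha> m v* A = cf m *s (\<alpha> (rp i) v* A)" if "rp m = rp i" for m
  proof -
    have "\<alpha> m v* A = (cf m *s \<alpha> (rp m)) v* A"
      by (simp only: \<alpha>_rp[symmetric])
    then show ?thesis
      unfolding scalar_vector_matrix_assoc that .
  qed
  obtain r where r: "(\<alpha> (rp i) v* A) $ r \<noteq> 0"
    using vector_matrix_nonzero[OF A \<alpha>_nz, of "rp i"] by (auto simp: vec_eq_iff)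
  have "r \<in> Y"
    using m[of r] r cf_nz[of m] by (simp add: scale[OF mk(1)])
  moreover have "r \<notin> Y"
    using k[of r] r cf_nz[of k] by (simp add: scale[OF mk(2)])
  ultimately show False by simp
qed

text \<open>A third line is a combination of lines from the two sides with both coefficients
  nonzero, so its form mixes the two sets of variables.\<close>

lemma Z_indecomposable:
  assumes "card T \<ge> 3" shows "\<not> decomposable L Z"
proof
  assume "decomposable L Z"
  then obtain A :: "((complex, 'n) vec, 'n) vec" and Y m k where A: "invertible A"
    and m: "\<And>r. (\<alpha> m v* A) $ r \<noteq> 0 \<Longrightarrow> r \<in> Y" and k: "\<And>r. (\<alpha> k v* A) $ r \<noteq> 0 \<Longrightarrow> r \<notin> Y"
    and side: "\<And>i. (\<forall>r. (\<alpha> i v* A) $ r \<noteq> 0 \<longrightarrow> r \<in> Y) \<or> (\<forall>r. (\<alpha> i v* A) $ r \<noteq> 0 \<longrightarrow> r \<notin> Y)"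
    by (rule decomposition_sides) (auto simp: J_at_Z)
  note scale = scalar_vector_matrix_assoc[of _ _ A]
  have nz: "\<exists>r. (\<alpha> i v* A) $ r \<noteq> 0" for i
    using vector_matrix_nonzero[OF A \<alpha>_nz, of i] by (auto simp: vec_eq_iff)
  have rp_A: "(\<alpha> (rp i) v* A) $ r \<noteq> 0 \<longleftrightarrow> (\<alpha> i v* A) $ r \<noteq> 0" for i r
  proof -
    have "\<alpha> i v* A = cf i *s (\<alpha> (rp i) v* A)"
      using scale[of "cf i" "\<alpha> (rp i)"] by (simp only: \<alpha>_rp[symmetric])
    then show ?thesis using cf_nz[of i] by simp
  qed
  obtain r r' where r: "(\<alpha> m v* A) $ r \<noteq> 0" "(\<alpha> k v* A) $ r' \<noteq> 0"
    using nz by blast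
  have 0: "(\<alpha> k v* A) $ r = 0" "(\<alpha> m v* A) $ r' = 0"
    using m k r by blast+
  have ne: "rp m \<noteq> rp k"
    using rp_A[of m r] rp_A[of k r] r 0 by auto
  have "\<not> T \<subseteq> {rp m, rp k}"
  proof
    assume "T \<subseteq> {rp m, rp k}"
    then have "card T \<le> card {rp m, rp k}" by (intro card_mono) auto
    also have "\<dots> \<le> 2" by (simp add: card_insert_if)
    finally show False using assms by simp
  qed
  then obtain i where i: "i \<in> T" "i \<noteq> rp m" "i \<noteq> rp k" by blast
  have T: "rp m \<in> T" "rp k \<in> T" by auto
  obtain x y where xy: "bil (\<alpha> (rp m)) x = 1" "bil (\<alpha> (rp m)) y = 0" "bil (\<alpha> (rp k)) x = 0" "bil (\<alpha> (rp k)) y = 1"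
    and span: "\<And>i. \<alpha> i = bil (\<alpha> i) x *s \<alpha> (rp m) + bil (\<alpha> i) y *s \<alpha> (rp k)"
    using in_span_of_two[OF T ne] by blast
  have "bil (\<alpha> i) x \<noteq> 0"
  proof
    assume "bil (\<alpha> i) x = 0"
    then have "\<alpha> i = bil (\<alpha> i) y *s \<alpha> (rp k)" using span[of i] by simp
    then have "L (rp k) dvd L i" unfolding lf_dvd_lf_iff[OF \<alpha>_nz] by blast
    then show False using not_parallel_T[OF T(2) i(1)] i(3) by simp
  qed
  moreover have "bil (\<alpha> i) y \<noteq> 0"
  proof
    assume "bil (\<alpha> i) y = 0"
    then have "\<alpha> i = bil (\<alpha> i) x *s \<alpha> (rp m)" using span[of i] by simp
    then have "L (rp m) dvd L i" unfolding lf_dvd_lf_iff[OF \<alpha>_nz] by blast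
    then show False using not_parallel_T[OF T(1) i(1)] i(2) by simp
  qed
  moreover have "\<alpha> i v* A = bil (\<alpha> i) x *s (\<alpha> (rp m) v* A) + bil (\<alpha> i) y *s (\<alpha> (rp k) v* A)"
    unfolding scale[symmetric] vector_matrix_left_distrib[symmetric] span[symmetric] ..
  ultimately have "(\<alpha> i v* A) $ r \<noteq> 0" "(\<alpha> i v* A) $ r' \<noteq> 0"
    using r 0 rp_A[of m r] rp_A[of k r] rp_A[of m r'] rp_A[of k r'] by auto
  then show False
    using side[of i] m[OF r(1)] k[OF r(2)] by blast
qed

lemma exists_linear_coordinates:
  assumes "rp i \<noteq> rp k"
  shows "\<exists>(A :: ((complex, 'n) vec, 'n) vec) r s. invertible A \<and> r \<noteq> s \<and>
    \<alpha> i v* A = axis r 1 \<and> \<alpha> k v* A = axis s 1"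
proof -
  obtain r where r: "\<alpha> i $ r \<noteq> 0"
    using \<alpha>_nz[of i] by (auto simp: vec_eq_iff)
  have "\<exists>s. \<alpha> i $ r * \<alpha> k $ s - \<alpha> i $ s * \<alpha> k $ r \<noteq> 0"
  proof (rule ccontr)
    assume "\<not> ?thesis"
    then have "\<alpha> i $ r * \<alpha> k $ s = \<alpha> i $ s * \<alpha> k $ r" for s by simp
    then have "\<alpha> k $ s = (\<alpha> k $ r / \<alpha> i $ r) * \<alpha> i $ s" for s
      using r by (simp add: field_simps)
    then have "\<alpha> k = (\<alpha> k $ r / \<alpha> i $ r) *s \<alpha> i"
      unfolding vec_eq_iff vector_smult_component by blast
    then have "L i dvd L k" unfolding lf_dvd_lf_iff[OF \<alpha>_nz] by blast
    then show False using assms by (simp flip: H_subset_iff add: H_subset_rp)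
  qed
  then obtain s where s: "\<alpha> i $ r * \<alpha> k $ s - \<alpha> i $ s * \<alpha> k $ r \<noteq> 0" by blast
  have rs: "r \<noteq> s" using s by auto
  \<comment> \<open>The rows \<open>r\<close> and \<open>s\<close> of the identity are replaced by
    the two forms; the nonzero minor at \<open>r\<close>, \<open>s\<close> makes the kernel trivial,
    and the inverse of \<open>B\<close> is the required change of coordinates.\<close>
  define B :: "((complex, 'n) vec, 'n) vec" where "B = (\<chi> t. if t = r then \<alpha> i else if t = s then \<alpha> k else axis t 1)"
  have Bx: "(B *v x) $ t = (if t = r then bil (\<alpha> i) x else if t = s then bil (\<alpha> k) x else x $ t)" for x t
  proof -
    have "(B *v x) $ t = bil (B $ t) x"
      by (simp add: matrix_vector_mult_def bil_def)
    then show ?thesis by (simp add: B_def)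
  qed
  have "x = 0" if "B *v x = 0" for x
  proof -
    have x: "bil (\<alpha> i) x = 0" "bil (\<alpha> k) x = 0"
      using Bx[of x r] Bx[of x s] rs unfolding that by auto
    have x0: "x $ t = 0" if "t \<noteq> r" "t \<noteq> s" for t
      using Bx[of x t] that unfolding \<open>B *v x = 0\<close> by simp
    have two: "bil a x = a $ r * x $ r + a $ s * x $ s" for a
    proof -
      have "bil a x = (\<Sum>t\<in>{r, s}. a $ t * x $ t)"
        unfolding bil_def using x0 by (intro sum.mono_neutral_right) auto
      then show ?thesis using rs by simp
    qed
    have "x $ r = 0" "x $ s = 0"
      using x(1,2) s unfolding two by algebra+
    with x0 show ?thesis by (metis vec_eq_iff zero_index)
  qed
  then obtain A where A: "A ** B = mat 1"
    using matrix_left_invertible_ker[of B] by blast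
  then have A': "B ** A = mat 1" by (simp add: matrix_left_right_inverse)
  then have "invertible A" unfolding invertible_left_inverse by blast
  have row: "(B $ t) v* A = axis t 1" for t
  proof -
    have "B $ t = axis t 1 v* B"
      by (simp add: vec_eq_iff vector_matrix_mult_def axis_def if_distrib if_distribR cong: if_cong)
    then have "(B $ t) v* A = axis t 1 v* (B ** A)"
      by (simp only: vector_matrix_mul_assoc)
    then show ?thesis by (simp add: A')
  qed
  show ?thesis
    by (intro exI conjI) (use \<open>invertible A\<close> row[of r] row[of s] rs in \<open>simp_all add: B_def\<close>)
qed

lemma Z_decomposable:
  assumes "card T = 2" shows "decomposable L Z"
proof -
  obtain i k where ik: "i \<in> T" "k \<in> T" "i \<noteq> k"
    using two_lines assms by auto
  have T: "T = {i, k}"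
    using ik assms by (intro card_seteq[symmetric]) auto
  have "rp i \<noteq> rp k" using ik(3) rp_T[OF ik(1)] rp_T[OF ik(2)] by simp
  then obtain A :: "((complex, 'n) vec, 'n) vec" and r s
    where A: "invertible A" "r \<noteq> s" "\<alpha> i v* A = axis r 1" "\<alpha> k v* A = axis s 1"
    using exists_linear_coordinates by blast
  have pos: "mult_in UNIV j > 0" if "j \<in> T" for j
    using rp_T[OF that] by (auto simp: card_gt_0_iff)
  define C where "C = (\<Prod>m\<in>UNIV. cf m)"
  have C: "C \<noteq> 0" by (simp add: C_def cf_nz)
  \<comment> \<open>An arrangement carries no separate scalar. The constant from normalizing
    parallel factors goes to \<open>p\<close>, where one of the linear factors absorbs it.\<close>
  define p where "p = Const C * Var r ^ mult_in UNIV i"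
  define q where "q = (Const 1 * Var s ^ mult_in UNIV k :: ('n, complex) mpoly)"
  have monom: "arrangement (Const c * Var t ^ n) \<and> poly_vars (Const c * Var t ^ n) = {t}"
    if "c \<noteq> 0" "n > 0" for c :: complex and t :: 'n and n
  proof
    obtain n' where n: "n = Suc n'" using \<open>n > 0\<close> gr0_implies_Suc by blast
    have "linear_form (Const c * Var t)" "linear_form (Var t)"
      unfolding lf_axis[symmetric] lf_scale[symmetric] linear_form_iff using \<open>c \<noteq> 0\<close>
      by (auto intro!: exI[of _ "c *s axis t 1"] exI[of _ "axis t 1"] simp: axis_eq_0_iff)
    then show "arrangement (Const c * Var t ^ n)"
      unfolding arrangement_def n
      by (intro exI[of _ "(Const c * Var t) # replicate n' (Var t)"]) (auto simp: mult.assoc)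
    show "poly_vars (Const c * Var t ^ n) = {t}"
      using that by (simp add: Var_power Const_def mult_single poly_vars_def)
  qed
  have "linear_change A (\<Prod>m\<in>UNIV. L m) = p * q"
    unfolding prod_lines T using ik(3)
    by (simp add: is_homD[OF is_hom_linear_change] linear_change_Const linear_change_lf A(3,4) lf_axis
        p_def q_def C_def mult.assoc)
  then have "linear_change A (localized_arr L Z) = p * q"
    by (simp add: localized_arr_def J_at_Z)
  moreover have "Z \<in> edges L" using edges_eq assms by simp
  moreover have "arrangement p" "poly_vars p = {r}" "arrangement q" "poly_vars q = {s}"
    unfolding p_def q_def
    using monom[OF C pos[OF ik(1)], of r] monom[OF one_neq_zero pos[OF ik(2)], of s] by blast+
  ultimately show ?thesis
    unfolding decomposable_def using A(1,2) Z_neq_UNIV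
    by (intro conjI exI[of _ A] exI[of _ "{r}"] exI[of _ p] exI[of _ q]) auto
qed

lemma indecomposable_edges:
  "{X \<in> edges L. indecomposable L X} = H ` T \<union> (if card T \<ge> 3 then {Z} else {})"
proof -
  have T: "card T = 2" if "card T \<ge> 2" "\<not> card T \<ge> 3"
    using that by simp
  show ?thesis
    using edges_eq H_indecomposable H_neq_UNIV Z_indecomposable Z_neq_UNIV Z_decomposable[OF T]
    by (auto simp: indecomposable_def split: if_splits)
qed

end

section \<open>Polynomials vanishing on a union of affine hyperplanes\<close>

text \<open>On the next hyperplane the product of the earlier factors is not identically zero. By
  irreducibility of the hyperplane the quotient vanishes on it, so the next factor divides the
  quotient.\<close>

lemma affine_prod_dvd:
  fixes b :: "('v::finite, complex) mpoly"
  assumes "finite K" "\<And>k. k \<in> K \<Longrightarrow> a k \<noteq> 0"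
    and "\<And>k k'. k \<in> K \<Longrightarrow> k' \<in> K \<Longrightarrow> k \<noteq> k' \<Longrightarrow> \<exists>x. bil (a k') x + c k' = 0 \<and> bil (a k) x + c k \<noteq> 0"
    and "\<And>k x. k \<in> K \<Longrightarrow> bil (a k) x + c k = 0 \<Longrightarrow> ev x b = 0"
  shows "(\<Prod>k\<in>K. lf (a k) + Const (c k)) dvd b"
  using assms
proof (induction K rule: finite_induct)
  case (insert k0 K)
  let ?l = "\<lambda>k. lf (a k) + Const (c k)"
  let ?C = "{x. bil (a k0) x + c k0 = 0}"
  have "(\<Prod>k\<in>K. ?l k) dvd b"
    by (rule insert.IH) (use insert(4-6) in blast)+
  then obtain h where h: "b = (\<Prod>k\<in>K. ?l k) * h" ..
  have "ev x h = 0" if x: "x \<in> ?C" for x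
  proof (rule ccontr)
    assume hx: "ev x h \<noteq> 0"
    let ?p = "\<lambda>k. if k \<in> K then ?l k else h"
    have "\<exists>y\<in>?C. \<forall>k\<in>insert k0 K. ev y (?p k) \<noteq> 0"
    proof (rule common_nonzero)
      show "x' + t *s (y - x') \<in> ?C" if "x' \<in> ?C" "y \<in> ?C" for x' y t
      proof -
        have "bil (a k0) x' = - c k0" "bil (a k0) y = - c k0"
          using that by (auto simp: eq_neg_iff_add_eq_0)
        then show ?thesis by simp
      qed
      fix k assume "k \<in> insert k0 K"
      then show "\<exists>y\<in>?C. ev y (?p k) \<noteq> 0"
        using insert(2) insert(5)[of k k0] hx x by (auto simp: ev_simps)
    qed (use insert(1) x in auto)
    then obtain y where y: "y \<in> ?C" "\<And>k. k \<in> insert k0 K \<Longrightarrow> ev y (?p k) \<noteq> 0" by blast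
    have "ev y (\<Prod>k\<in>K. ?l k) \<noteq> 0"
      unfolding ev_simps(9) using insert(1) y(2) by (auto simp: prod_zero_iff split: if_splits) (metis insertI2)
    moreover have "ev y h \<noteq> 0"
      using y(2)[of k0] insert(2) by simp
    moreover have "ev y b = 0"
      using y(1) by (intro insert(6)[of k0]) auto
    ultimately show False
      by (simp add: h ev_simps(4))
  qed
  then have "?l k0 dvd h"
    using affine_dvd_iff[of "a k0" "c k0" h] insert(4)[of k0] by auto
  then show ?case
    using insert(1,2) unfolding h by (simp add: mult.commute mult_dvd_mono)
qed simp

lemma bil_indicator: "bil (\<chi> m. if m \<in> J then 1 else 0) x = (\<Sum>m\<in>J. x $ m)"
  by (simp add: bil_def if_distrib if_distribR sum.If_cases cong: if_cong)

lemma lf_indicator: "lf (\<chi> m. if m \<in> J then 1 else 0) = (\<Sum>m\<in>J. Var m)"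
  by (rule mpoly_eqI) (simp add: bil_indicator ev_simps)

text \<open>From a zero of the second function one either already avoids the zeros of the first, or
  moves in a direction that changes the first sum and not the second. For \<open>J = J'\<close> the
  constants separate.\<close>

lemma indicator_separated:
  fixes J J' :: "'d::finite set" and c c' :: complex
  assumes "J \<noteq> {}" "J' \<noteq> {}" "J \<noteq> J' \<or> c \<noteq> c'"
  shows "\<exists>x :: complex ^ 'd. (\<Sum>m\<in>J'. x $ m) + c' = 0 \<and> (\<Sum>m\<in>J. x $ m) + c \<noteq> 0"
proof -
  have sum_axis: "(\<Sum>m\<in>A. (t *s axis k 1 :: complex ^ 'd) $ m) = (if k \<in> A then t else 0)" for A t k
  proof -
    have "(\<Sum>m\<in>A. (t *s axis k 1 :: complex ^ 'd) $ m) = (\<Sum>m\<in>A. if m = k then t else 0)"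
      by (intro sum.cong) (auto simp: axis_def)
    then show ?thesis by simp
  qed
  obtain k' where k': "k' \<in> J'" using assms by blast
  define x0 where "x0 = (- c') *s (axis k' 1 :: complex ^ 'd)"
  have x0: "(\<Sum>m\<in>J'. x0 $ m) + c' = 0"
    unfolding x0_def sum_axis using k' by simp
  show ?thesis
  proof (cases "J = J'")
    case True
    then show ?thesis
      using x0 assms(3) by (intro exI[of _ x0]) (auto simp: add_eq_0_iff2)
  next
    case False
    have "\<exists>w :: complex ^ 'd. (\<Sum>m\<in>J'. w $ m) = 0 \<and> (\<Sum>m\<in>J. w $ m) \<noteq> 0"
    proof (cases "J \<subseteq> J'")
      case True
      then obtain m0 m1 where "m0 \<in> J" "m1 \<in> J'" "m1 \<notin> J" using False assms(1) by blast
      then show ?thesis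
        using True sum_axis[of 1 m0] sum_axis[of 1 m1]
        by (intro exI[of _ "axis m0 1 - axis m1 1"]) (auto simp: sum_subtractf)
    next
      case False
      then obtain m0 where "m0 \<in> J" "m0 \<notin> J'" by blast
      then show ?thesis
        using sum_axis[of 1 m0] by (intro exI[of _ "axis m0 1"]) auto
    qed
    then obtain w :: "complex ^ 'd" where w: "(\<Sum>m\<in>J'. w $ m) = 0" "(\<Sum>m\<in>J. w $ m) \<noteq> 0" by blast
    then show ?thesis
    proof (cases "(\<Sum>m\<in>J. x0 $ m) + c = 0")
      case True
      then have "(\<Sum>m\<in>J. (x0 + w) $ m) + c = (\<Sum>m\<in>J. w $ m)"
        by (simp add: sum.distrib add_ac)
      with w(2) have "(\<Sum>m\<in>J. (x0 + w) $ m) + c \<noteq> 0"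
        by (simp only:) simp
      moreover have "(\<Sum>m\<in>J'. (x0 + w) $ m) + c' = 0"
        using w(1) x0 by (simp add: sum.distrib)
      ultimately show ?thesis by blast
    qed (use x0 in blast)
  qed
qed

section \<open>The Bernstein--Sato polynomial of an arrangement of rank at most two\<close>

context rank_two
begin

text \<open>The candidate generator, indexed by the factors that make up \<open>f'\<close>. The
  center contributes from three lines on; with two lines it is a decomposable edge.\<close>

definition b_poly :: "'d set \<Rightarrow> ('r, complex) mpoly" where
  "b_poly A = b_lines A * (if card T \<ge> 3 then
     \<Prod>j<card (- A) + card T - 3. ((\<Sum>m\<in>UNIV. Var (\<phi> m)) + of_nat (card A)) + of_nat (2 + j) else 1)"

lemma b_poly_in_U: "emb_S (b_poly A) * emb_x (\<Prod>m\<in>A. L m) \<in> U"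
proof (cases "card T \<ge> 3")
  case True
  then obtain a\<^sub>u a\<^sub>v e\<^sub>u e\<^sub>v where "arr_plane \<alpha> \<phi> F rp cf a\<^sub>u a\<^sub>v e\<^sub>u e\<^sub>v"
    using exists_plane by auto
  then interpret arr_plane \<alpha> \<phi> F rp cf a\<^sub>u a\<^sub>v e\<^sub>u e\<^sub>v .
  show ?thesis
    using b_center[OF True, of A] True by (simp add: b_poly_def)
next
  case False
  then show ?thesis
    using b_lines_two[of A] by (simp add: b_poly_def)
qed

lemma BS_ideal_iff:
  assumes "f = g * f'"
  shows "b \<in> BS_ideal g f' F \<longleftrightarrow> emb_S b * emb_x f' \<in> U"
  by (simp add: BS_ideal_def U_def assms)

lemma b_poly_in_BS_ideal:
  assumes "f = g * f'" "f' = Const c * (\<Prod>m\<in>A. L m)"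
  shows "b_poly A \<in> BS_ideal g f' F"
  unfolding BS_ideal_iff[OF assms(1)]
  using U_emb_x[OF b_poly_in_U[of A], of "Const c"] by (simp add: assms(2) emb_x_simps(4) mult_ac)

lemma BS_ideal_mult: "f = g * f' \<Longrightarrow> b \<in> BS_ideal g f' F \<Longrightarrow> b * h \<in> BS_ideal g f' F"
  using U_emb_S[of "emb_S b * emb_x f'" h] by (simp add: BS_ideal_iff emb_S_simps(4) mult_ac)

lemma BS_ideal_vanishes:
  assumes g: "f = g * f'" and f': "f' = Const c * (\<Prod>m\<in>A. L m)" "c \<noteq> 0" and A: "A \<noteq> UNIV"
    and b: "b \<in> BS_ideal g f' F" and \<sigma>: "ev \<sigma> (b_poly A) = 0"
  shows "ev \<sigma> b = 0"
proof -
  obtain P where P: "P \<in> weyl_action F" "emb_S b * emb_x f' = P (emb_x f)"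
    using b unfolding BS_ideal_def g by blast
  consider (line) "ev \<sigma> (b_lines A) = 0"
    | (center) "card T \<ge> 3" "ev \<sigma> (\<Prod>j<card (- A) + card T - 3. ((\<Sum>m\<in>UNIV. Var (\<phi> m)) + of_nat (card A)) + of_nat (2 + j)) = 0"
    using \<sigma> by (auto simp: b_poly_def ev_simps(2,4) split: if_splits)
  then show ?thesis
  proof cases
    case line
    interpret lines_sigma \<alpha> \<phi> F rp cf \<sigma> by unfold_locales
    have "\<exists>i\<in>T. (\<Prod>j\<in>{mult_in A i..<mult_in UNIV i}. ev \<sigma> (s_line i + of_nat (Suc j))) = 0"
      using line unfolding b_lines_def ev_simps(9) by (rule iffD1[OF prod_zero_iff, rotated]) simp
    then obtain i where i: "i \<in> T" "(\<Prod>j\<in>{mult_in A i..<mult_in UNIV i}. ev \<sigma> (s_line i + of_nat (Suc j))) = 0"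
      by blast
    from i(2) have "\<exists>j\<in>{mult_in A i..<mult_in UNIV i}. ev \<sigma> (s_line i + of_nat (Suc j)) = 0"
      by (rule iffD1[OF prod_zero_iff, rotated]) simp
    with i(1) obtain j where ij: "i \<in> T" "j \<in> {mult_in A i..<mult_in UNIV i}" "ev \<sigma> (s_line i + of_nat (Suc j)) = 0"
      by blast
    have "ev \<sigma> (of_nat k) = of_nat k" for k
      using ev_Const[of \<sigma> "of_nat k"] by (simp only: Const_of_nat)
    then have \<kappa>: "\<kappa> i = - of_nat (Suc j)"
      using ij(3) unfolding ev_simps(3) by (simp only: s_line_def \<kappa>_def ev_simps(8) ev_Var add_eq_0_iff2)
    show ?thesis
      \<comment> \<open>The range of \<open>j\<close> says that \<open>Suc j\<close> exceeds the
        multiplicity in \<open>f'\<close> but not that in \<open>f\<close>.\<close>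
      by (rule line_vanishes[OF P f' ij(1) \<kappa>]) (use ij(2) in auto)
  next
    case center
    have of_nat: "ev \<sigma> (of_nat k) = of_nat k" for k
      using ev_Const[of \<sigma> "of_nat k"] by (simp only: Const_of_nat)
    obtain j where j: "j < card (- A) + card T - 3"
      "ev \<sigma> (((\<Sum>m\<in>UNIV. Var (\<phi> m)) + of_nat (card A)) + of_nat (2 + j)) = 0"
      using center(2) unfolding ev_simps(9) by (auto simp: prod_zero_iff)
    have "(\<Sum>m\<in>UNIV. \<sigma> $ \<phi> m) + of_nat (2 + card A + j) = 0"
      using j(2) unfolding ev_simps(3,8) of_nat ev_Var by (simp add: add_ac)
    then have s: "(\<Sum>m\<in>UNIV. \<sigma> $ \<phi> m) = - of_nat (2 + card A + j)"
      by (simp only: eq_neg_iff_add_eq_0)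
    obtain a\<^sub>u a\<^sub>v e\<^sub>u e\<^sub>v where "arr_plane \<alpha> \<phi> F rp cf a\<^sub>u a\<^sub>v e\<^sub>u e\<^sub>v"
      using exists_plane center(1) by auto
    then interpret arr_plane \<alpha> \<phi> F rp cf a\<^sub>u a\<^sub>v e\<^sub>u e\<^sub>v .
    interpret center_factor \<alpha> \<phi> F rp cf a\<^sub>u a\<^sub>v e\<^sub>u e\<^sub>v \<sigma> A c f' g j "card (- A)"
      by unfold_locales (use f' g s in auto)
    have "- A \<noteq> {}" using A by auto
    then have n: "card (- A) \<ge> 1"
      by (simp only: Suc_le_eq One_nat_def card_gt_0_iff) simp
    show ?thesis
      using j(1) by (intro center_vanishes[OF P center(1) n]) linarith
  qed
qed

section \<open>Comparison with the product over indecomposable edges\<close>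

lemma num_factors_L: "num_factors_at (Const c * (\<Prod>m\<in>A. L m)) X = card {m \<in> A. X \<subseteq> H m}" if "c \<noteq> 0"
  by (rule num_factors_at_eq[OF that]) (use \<alpha>_nz in \<open>auto simp: linear_form_iff\<close>)

lemma num_factors_F: "num_factors_at (F k) X = card {m. \<phi> m = k \<and> X \<subseteq> H m}"
  using num_factors_L[of 1 "{m. \<phi> m = k}" X] by (simp add: F_eq)

lemma sum_factors: "(\<Sum>k\<in>UNIV. of_nat (num_factors_at (F k) X) * Var k) = (\<Sum>m\<in>J_at L X. Var (\<phi> m) :: ('r, complex) mpoly)"
proof -
  have "(\<Sum>m\<in>J_at L X. Var (\<phi> m) :: ('r, complex) mpoly) = (\<Sum>k\<in>UNIV. \<Sum>m | m \<in> J_at L X \<and> \<phi> m = k. Var (\<phi> m))"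
    by (subst sum.group) auto
  also have "\<dots> = (\<Sum>k\<in>UNIV. of_nat (num_factors_at (F k) X) * Var k)"
  proof (rule sum.cong[OF refl])
    fix k
    have "(\<Sum>m | m \<in> J_at L X \<and> \<phi> m = k. Var (\<phi> m)) = (\<Sum>m | m \<in> J_at L X \<and> \<phi> m = k. Var k :: ('r, complex) mpoly)"
      by (intro sum.cong) auto
    then show "(\<Sum>m | m \<in> J_at L X \<and> \<phi> m = k. Var (\<phi> m)) = of_nat (num_factors_at (F k) X) * (Var k :: ('r, complex) mpoly)"
      by (simp add: num_factors_F J_at_def conj_commute)
  qed
  finally show ?thesis ..
qed

text \<open>A hyperplane has \<open>d_red = r = 1\<close>, so its index runs over the multiplicity
  missing from \<open>f'\<close> and the range is empty if nothing is missing. The center has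
  \<open>d_red = card T\<close> and \<open>r = 2\<close>, which gives
  \<open>card (- A) + card T - 3\<close> values.\<close>

theorem b_poly_eq:
  assumes f': "f' = Const c * (\<Prod>m\<in>A. L m)" "c \<noteq> 0"
  shows "(\<Prod>X\<in>{X \<in> edges L. indecomposable L X}.
      \<Prod>j\<in>{0 .. int (d_red_at L X) + int (d_at L X) - 2 * int (codim X) - int (num_factors_at f' X)}.
        P_at f' F X + of_int j) = b_poly A"
proof -
  let ?n = "\<lambda>X. int (d_red_at L X) + int (d_at L X) - 2 * int (codim X) - int (num_factors_at f' X)"
  let ?g = "\<lambda>X. \<Prod>j\<in>{0 .. ?n X}. P_at f' F X + of_int j"
  have inj: "inj_on H T"
    by (rule inj_onI) (metis H_subset_rp order_refl rp_T)
  have H: "?g (H i) = (\<Prod>j\<in>{mult_in A i..<mult_in UNIV i}. s_line i + of_nat (Suc j))" if i: "i \<in> T" for i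
  proof -
    have J: "J_at L (H i) = {m. rp m = i}"
      using J_at_H[of i] rp_T[OF i] by simp
    have "(\<lambda>m. H m) ` J_at L (H i) = {H i}"
      unfolding J using H_subset_rp rp_T[OF i] by (fastforce intro: subset_antisym)
    then have dr: "d_red_at L (H i) = 1" by (simp add: d_red_at_def)
    have d: "d_at L (H i) = mult_in UNIV i" by (simp add: d_at_def J)
    have "{m \<in> A. H i \<subseteq> H m} = {m \<in> A. rp m = i}"
      unfolding H_subset_rp rp_T[OF i] by auto
    then have nf: "num_factors_at f' (H i) = mult_in A i"
      unfolding f'(1) num_factors_L[OF f'(2)] by simp
    have P: "P_at f' F (H i) = s_line i + 1 + of_nat (mult_in A i)"
      unfolding P_at_def sum_factors J codim_H nf s_line_def by simp
    have le: "mult_in A i \<le> mult_in UNIV i"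
      by (intro card_mono) auto
    show ?thesis
      unfolding dr d codim_H nf P
      by (rule prod.reindex_bij_witness[where i = "\<lambda>j. int j - int (mult_in A i)" and j = "\<lambda>z. nat (z + int (mult_in A i))"])
        (use le in \<open>auto simp: algebra_simps of_nat_nat\<close>)
  qed
  have lines: "(\<Prod>X\<in>H ` T. ?g X) = b_lines A"
    unfolding b_lines_def prod.reindex[OF inj] comp_def by (rule prod.cong[OF refl H])
  show ?thesis
  proof (cases "card T \<ge> 3")
    case True
    then obtain i k where ik: "i \<in> T" "k \<in> T" "i \<noteq> k" using two_lines by auto
    then have ne: "rp i \<noteq> rp k" using rp_T by metis
    have "(\<lambda>m. H m) ` UNIV = H ` T"
    proof -
      have "H m \<in> H ` T" for m
        by (rule image_eqI[where x = "rp m"]) (simp_all add: H_rp)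
      then show ?thesis by auto
    qed
    then have dr: "d_red_at L Z = card T"
      unfolding d_red_at_def J_at_Z using card_image[OF inj] by simp
    have d: "d_at L Z = CARD('d)" by (simp add: d_at_def J_at_Z)
    have "{m \<in> A. Z \<subseteq> H m} = A" by (auto simp: Z_def)
    then have nf: "num_factors_at f' Z = card A"
      unfolding f'(1) num_factors_L[OF f'(2)] by simp
    have P: "P_at f' F Z = ((\<Sum>m\<in>UNIV. Var (\<phi> m)) + of_nat (card A)) + 2"
      unfolding P_at_def sum_factors J_at_Z codim_Z[OF ne] nf by simp
    have "card (- A) + card A = CARD('d)"
      by (subst card_Un_disjoint[symmetric]) (auto simp: Compl_partition2)
    then have n: "int (card T) + int CARD('d) - 2 * int 2 - int (card A) = int (card (- A) + card T - 3) - 1"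
      using True by linarith
    have Z: "?g Z = (\<Prod>j<card (- A) + card T - 3. ((\<Sum>m\<in>UNIV. Var (\<phi> m)) + of_nat (card A)) + of_nat (2 + j))"
      unfolding dr d codim_Z[OF ne] nf P n
      by (rule prod.reindex_bij_witness[where i = int and j = nat]) (auto simp: algebra_simps of_nat_nat)
    have "Z \<notin> H ` T" using H_neq_Z[OF ik] by auto
    then have "(\<Prod>X\<in>insert Z (H ` T). ?g X) = ?g Z * (\<Prod>X\<in>H ` T. ?g X)"
      by (intro prod.insert) auto
    then show ?thesis
      unfolding indecomposable_edges lines Z using True by (simp add: b_poly_def mult.commute)
  next
    case False
    then show ?thesis
      unfolding indecomposable_edges using lines by (simp add: b_poly_def)
  qed
qed

theorem zero_locus_BS_ideal:
  assumes "f = g * f'" "f' = Const c * (\<Prod>m\<in>A. L m)" "c \<noteq> 0" "A \<noteq> UNIV"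
  shows "zero_locus (BS_ideal g f' F) = zero_locus {b_poly A}"
  using b_poly_in_BS_ideal[OF assms(1,2)] BS_ideal_vanishes[OF assms] by (auto simp: zero_locus_ev)

end

text \<open>For the factorization into linear forms, the affine factors of \<open>b_poly\<close> are pairwise distinct.\<close>

theorem BS_ideal_principal:
  assumes "rank_two \<alpha> id L rp cf"
    and "(\<Prod>m\<in>UNIV. lf (\<alpha> m)) = g * f'" "f' = Const c * (\<Prod>m\<in>A. lf (\<alpha> m))" "c \<noteq> 0" "A \<noteq> UNIV"
  shows "BS_ideal g f' L = principal_ideal (rank_two.b_poly id rp A)"
proof -
  interpret rank_two \<alpha> id L rp cf by fact
  note a = assms(2-5)
  let ?N = "card (- A) + card T - 3"
  \<comment> \<open>An index set for the affine factors: \<open>Some i\<close> stands for a line and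
    \<open>None\<close> for the center, paired with the shift \<open>j\<close>.\<close>
  define K where "K = (\<Union>i\<in>T. (\<lambda>j. (Some i, j)) ` {mult_in A i..<mult_in UNIV i}) \<union>
    (if card T \<ge> 3 then (\<lambda>j. (None, j)) ` {..<?N} else {})"
  define J where "J = (\<lambda>(x, j :: nat). case x of None \<Rightarrow> UNIV | Some i \<Rightarrow> {m. rp m = i})"
  define k where "k = (\<lambda>(x :: 'a option, j). case x of None \<Rightarrow> card A + (2 + j) | Some i \<Rightarrow> Suc j)"
  let ?a = "\<lambda>z. \<chi> m. if m \<in> J z then 1 else (0 :: complex)" and ?c = "\<lambda>z. of_nat (k z) :: complex"
  have fac: "lf (?a z) + Const (?c z) = (\<Sum>m\<in>J z. Var m) + of_nat (k z)" for z
    by (simp add: lf_indicator Const_of_nat)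
  have prod: "(\<Prod>z\<in>K. lf (?a z) + Const (?c z)) = b_poly A"
  proof -
    have 1: "(\<Prod>z\<in>(\<Union>i\<in>T. (\<lambda>j. (Some i, j)) ` {mult_in A i..<mult_in UNIV i}). lf (?a z) + Const (?c z)) = b_lines A"
    proof -
      have "(\<Prod>z\<in>(\<Union>i\<in>T. (\<lambda>j. (Some i, j)) ` {mult_in A i..<mult_in UNIV i}). lf (?a z) + Const (?c z)) =
          (\<Prod>i\<in>T. \<Prod>z\<in>(\<lambda>j. (Some i, j)) ` {mult_in A i..<mult_in UNIV i}. lf (?a z) + Const (?c z))"
        by (rule prod.UNION_disjoint) auto
      also have "\<dots> = b_lines A"
        unfolding b_lines_def
      proof (rule prod.cong[OF refl])
        fix i
        have "inj_on (\<lambda>j :: nat. (Some i, j)) {mult_in A i..<mult_in UNIV i}" by (auto simp: inj_on_def)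
        then show "(\<Prod>z\<in>(\<lambda>j. (Some i, j)) ` {mult_in A i..<mult_in UNIV i}. lf (?a z) + Const (?c z)) =
            (\<Prod>j\<in>{mult_in A i..<mult_in UNIV i}. s_line i + of_nat (Suc j))"
          unfolding fac by (simp add: prod.reindex J_def k_def s_line_def)
      qed
      finally show ?thesis .
    qed
    have inj: "inj_on (\<lambda>j :: nat. (None :: 'a option, j)) {..<?N}" by (auto simp: inj_on_def)
    have 2: "(\<Prod>z\<in>(\<lambda>j. (None, j)) ` {..<?N}. lf (?a z) + Const (?c z)) =
        (\<Prod>j<?N. ((\<Sum>m\<in>UNIV. Var (id m)) + of_nat (card A)) + of_nat (2 + j))"
      unfolding fac prod.reindex[OF inj] comp_def by (intro prod.cong) (simp_all add: J_def k_def add.assoc)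
    show ?thesis
    proof (cases "card T \<ge> 3")
      case True
      then show ?thesis
        unfolding K_def using 1 2 by (subst prod.union_disjoint) (auto simp: b_poly_def)
    qed (use 1 in \<open>simp add: K_def b_poly_def\<close>)
  qed
  have J_ne: "J z \<noteq> {}" if "z \<in> K" for z
    using that by (auto simp: K_def J_def split: if_splits)
  \<comment> \<open>With \<open>\<phi> = id\<close> the variables of different lines form disjoint
    nonempty sets, none of which is everything when there are three lines. Factors of the same edge
    differ in the constant.\<close>
  have sep: "J z \<noteq> J z' \<or> ?c z \<noteq> ?c z'" if "z \<in> K" "z' \<in> K" "z \<noteq> z'" for z z'
  proof -
    have UNIV: "{m. rp m = i} \<noteq> UNIV" if T3: "card T \<ge> 3" for i
    proof
      assume "{m. rp m = i} = UNIV"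
      then have "T \<subseteq> {i}" by auto
      then have "card T \<le> card {i}" by (intro card_mono) auto
      with T3 show False by simp
    qed
    have inj: "i = i'" if "i \<in> T" "i' \<in> T" "{m. rp m = i} = {m. rp m = i'}" for i i'
      using that rp_T[of i] by auto
    obtain x j x' j' where z: "z = (x, j)" "z' = (x', j')"
      by (cases z, cases z')
    have T3: "card T \<ge> 3" if "x = None \<or> x' = None"
      using that \<open>z \<in> K\<close> \<open>z' \<in> K\<close> by (auto simp: K_def z split: if_splits)
    have T: "i \<in> T" if "x = Some i \<or> x' = Some i" for i
      using that \<open>z \<in> K\<close> \<open>z' \<in> K\<close> by (auto simp: K_def z split: if_splits)
    show ?thesis
    proof (cases "x = x'")
      case True
      then have "j \<noteq> j'" using \<open>z \<noteq> z'\<close> by (simp add: z)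
      then show ?thesis by (simp add: True k_def z split: option.split)
    next
      case False
      then consider i where "x = None" "x' = Some i" | i where "x' = None" "x = Some i"
        | i i' where "x = Some i" "x' = Some i'" "i \<noteq> i'"
        by (cases x; cases x') auto
      then show ?thesis
      proof cases
        case (1 i)
        then show ?thesis using UNIV[OF T3, of i] by (auto simp: J_def z)
      next
        case (2 i)
        then show ?thesis using UNIV[OF T3, of i] by (auto simp: J_def z)
      next
        case (3 i i')
        then show ?thesis using inj[OF T T, of i i'] by (auto simp: J_def z)
      qed
    qed
  qed
  have "BS_ideal g f' L \<subseteq> principal_ideal (b_poly A)"
  proof
    fix b assume b: "b \<in> BS_ideal g f' L"
    have "(\<Prod>z\<in>K. lf (?a z) + Const (?c z)) dvd b"
    proof (rule affine_prod_dvd)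
      show "finite K" by (simp add: K_def)
      show "?a z \<noteq> 0" if "z \<in> K" for z
        using J_ne[OF that] by (auto simp: vec_eq_iff)
      show "\<exists>x. bil (?a z') x + ?c z' = 0 \<and> bil (?a z) x + ?c z \<noteq> 0" if "z \<in> K" "z' \<in> K" "z \<noteq> z'" for z z'
        unfolding bil_indicator using indicator_separated[OF J_ne[OF that(1)] J_ne[OF that(2)] sep[OF that]] .
      fix z x assume z: "z \<in> K" "bil (?a z) x + ?c z = 0"
      have "ev x (b_poly A) = 0"
        unfolding prod[symmetric] ev_simps(9)
        by (rule prod_zero) (use z in \<open>auto simp: K_def ev_simps intro!: bexI[of _ z]\<close>)
      then show "ev x b = 0"
        by (rule BS_ideal_vanishes[OF a b])
    qed
    then show "b \<in> principal_ideal (b_poly A)"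
      unfolding prod principal_ideal_def by (auto elim: dvdE)
  qed
  moreover have "principal_ideal (b_poly A) \<subseteq> BS_ideal g f' L"
    using BS_ideal_mult[OF a(1) b_poly_in_BS_ideal[OF a(1,2)]] by (auto simp: principal_ideal_def)
  ultimately show ?thesis by blast
qed

theorem theorem4p25:
  fixes l :: "'d::finite \<Rightarrow> ('n::{finite,linorder}, complex) mpoly"
    and F :: "'r::finite \<Rightarrow> ('n, complex) mpoly"
    and f f' g :: "('n, complex) mpoly"
  assumes forms: "\<And>m. linear_form (l m)"
    and f: "f = (\<Prod>m\<in>UNIV. l m)"
    and rank: "arr_rank l \<le> 2"
    and F: "factorization l F"
    and f': "f' dvd f" "principal_ideal f' \<noteq> principal_ideal f"
    and g: "f = g * f'"
  shows "zero_locus (BS_ideal g f' F) =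
           zero_locus {\<Prod>X\<in>{X \<in> edges l. indecomposable l X}.
             \<Prod>j\<in>{0 .. int (d_red_at l X) + int (d_at l X) - 2 * int (codim X)
                       - int (num_factors_at f' X)}.
               P_at f' F X + of_int j} \<and>
         BS_ideal g f' l =
           principal_ideal (\<Prod>X\<in>{X \<in> edges l. indecomposable l X}.
             \<Prod>j\<in>{0 .. int (d_red_at l X) + int (d_at l X) - 2 * int (codim X)
                       - int (num_factors_at f' X)}.
               P_at f' l X + of_int j)"
proof -
  have "\<exists>\<alpha>. \<forall>m. \<alpha> m \<noteq> 0 \<and> l m = lf (\<alpha> m)"
    using forms by (intro choice) (simp add: linear_form_iff)
  then obtain \<alpha> where \<alpha>: "\<And>m. \<alpha> m \<noteq> 0" "l = (\<lambda>m. lf (\<alpha> m))" by auto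
  obtain \<phi> where \<phi>: "\<And>k. F k = (\<Prod>m | \<phi> m = k. lf (\<alpha> m))"
    using F by (auto simp: factorization_def \<alpha>(2))
  have 1: "arr \<alpha> \<phi> F" and 2: "arr \<alpha> id (\<lambda>m. lf (\<alpha> m))"
    by unfold_locales (simp_all add: \<alpha>(1) \<phi>)
  obtain rp cf where lines: "arr_lines \<alpha> \<phi> F rp cf"
    using exists_arr_lines[OF 1] by blast
  have "arr_lines_axioms \<alpha> rp cf"
    using lines by (rule arr_lines.axioms(2))
  then have lines': "arr_lines \<alpha> id (\<lambda>m. lf (\<alpha> m)) rp cf"
    using 2 by (intro arr_lines.intro)
  have rank': "rank_two_axioms \<alpha>"
    using rank by (intro rank_two_axioms.intro) (simp add: \<alpha>(2))
  interpret F: rank_two \<alpha> \<phi> F rp cf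
    using lines rank' by (rule rank_two.intro)
  interpret L: rank_two \<alpha> id "\<lambda>m. lf (\<alpha> m)" rp cf
    using lines' rank' by (rule rank_two.intro)
  have fg: "(\<Prod>m\<in>UNIV. lf (\<alpha> m)) = g * f'"
    using f g by (simp add: \<alpha>(2))
  obtain A c where A: "f' = Const c * (\<Prod>m\<in>A. lf (\<alpha> m))" "c \<noteq> 0"
    using dvd_prod_lf[of UNIV \<alpha> f' g] \<alpha>(1) fg by (auto simp: mult.commute)
  \<comment> \<open>Otherwise \<open>f'\<close> and \<open>f\<close> would agree up to a unit. Hence
    \<open>g\<close> has positive degree, as the dimension count requires.\<close>
  have "A \<noteq> UNIV"
  proof
    assume "A = UNIV"
    then have "f' = Const c * f" by (simp add: A f \<alpha>(2))
    moreover have "Const c * Const (1 / c) = (1 :: ('n, complex) mpoly)"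
      using A(2) by (simp flip: Const_mult)
    then have "f = Const c * f * Const (1 / c)"
      by (metis mult.assoc mult.commute mult_1)
    ultimately have unit: "f' * h = f * (Const c * h)" "f * h = f' * (Const (1 / c) * h)" for h
      by (simp_all only: mult_ac)
    have "principal_ideal f' = principal_ideal f"
    proof (intro subset_antisym subsetI)
      fix x assume "x \<in> principal_ideal f'"
      then show "x \<in> principal_ideal f"
        unfolding principal_ideal_def using unit(1) by auto
    next
      fix x assume "x \<in> principal_ideal f"
      then show "x \<in> principal_ideal f'"
        unfolding principal_ideal_def using unit(2) by auto
    qed
    with f'(2) show False by contradiction
  qed
  note A = A this
  show ?thesis
    using F.zero_locus_BS_ideal[OF fg A] BS_ideal_principal[OF L.rank_two_axioms fg A]
    unfolding F.b_poly_eq[OF A(1,2), symmetric] L.b_poly_eq[OF A(1,2), symmetric] \<alpha>(2) by blast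
qed

end
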